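(* Suppose the noise random field $\{\varepsilon_{i_1,i_2,i_3}\}$ is weakly stationary with mean zero and satisfies the functional central limit theorem $$Z_n(v_1,v_2,v_3):=(n_1n_2n_3)^{-1/2}\sum_{i_1=1}^{\lfloor n_1v_1\rfloor}\sum_{i_2=1}^{\lfloor n_2v_2\rfloor}\sum_{i_3=1}^{\lfloor n_3v_3\rfloor}\varepsilon_{i_1,i_2,i_3}\Rightarrow\sigma B(v_1,v_2,v_3)\quad\text{in } D[0,1]^3$$ as $\min_{1\le i\le 3}n_i\to\infty$, for some constant $\sigma^2\in(0,\infty)$, where $B$ is the standard Brownian motion on $[0,1]^3$. Assume that the sampling periods fulfill $n_j\tau_j\to\overline{\tau}_j$ for $j=1,2,3$ as $\min_{1\le i\le 3}n_i\to\infty$. Then, under the null hypothesis $H_0$ (that the signal $f$ equals the reference signal $f_0$), the process $$\mathcal{F}_n(s,t,r_2,r_3)=\sqrt{\tau_1\tau_2\tau_3}\sum_{l_1=1}^{\lfloor n_1s\rfloor}\sum_{l_2=1}^{n_2}\sum_{l_3=1}^{n_3}\left[y_{l_1,l_2,l_3}-f_0(l_1\tau_1,l_2\tau_2,l_3\tau_3)\right]\varphi(t-l_1\tau_1,r_2-l_2\tau_2,r_3-l_3\tau_3)$$ satisfies $$\mathcal{F}_n(s,t,r_2,r_3)\Rightarrow\mathcal{F}(s,t,r_2,r_3)\quad\text{as }\min_{1\le i\le 3}n_i\to\infty,$$ as processes indexed by $(s,t,r_2,r_3)\in[s_0,1]\times[0,\overline{\tau}_1]\times[0,\overline{\tau}_2]\times[0,\overline{\tau}_3]$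 (weak convergence in the Skorohod space on this box), where $$\mathcal{F}(s,t,r_2,r_3):=\sqrt{\overline{\tau}_1\overline{\tau}_2\overline{\tau}_3}\,\sigma\int_0^s\int_0^1\int_0^1\varphi(t-\overline{\tau}_1z_1,r_2-\overline{\tau}_2z_2,r_3-\overline{\tau}_3z_3)\,\mathrm{d}B(z_1,z_2,z_3).$$
   Context: Setting. Constants $s_0\in(0,1)$, $\Omega_1,\Omega_2,\Omega_3\in(0,\infty)$ and $\overline\tau_1,\overline\tau_2,\overline\tau_3\in(0,\infty)$ are fixed. For sample sizes $n_1,n_2,n_3\in\mathbb N$ there are sampling periods $\tau_j=\tau_{n_j}>0$, $j=1,2,3$. One observes $y_{i_1,i_2,i_3}=f(i_1\tau_1,i_2\tau_2,i_3\tau_3)+\varepsilon_{i_1,i_2,i_3}$, $1\le i_j\le n_j$, where $f$ is the (unknown) signal, $f_0$ is a given reference signal and $\{\varepsilon_{i_1,i_2,i_3}\}$ is a zero mean random field. Under $H_0$ one has $f=f_0$, so $y_{i_1,i_2,i_3}=f_0(i_1\tau_1,i_2\tau_2,i_3\tau_3)+\varepsilon_{i_1,i_2,i_3}$. The subscript $n$ stands for dependence on $(n_1,n_2,n_3)$. Kernel. $\varphi(t,r_2,r_3)=\frac{\sin(\Omega_1t)}{\pi t}\frac{\sin(\Omega_2r_2)}{\pi r_2}\frac{\sin(\Omega_3r_3)}{\pi r_3}$, each factor being set equal to $\Omega_j/\pi$ at argument $0$. Notation. For $u\subseteq\{1,\dots,q\}$, $-u$ denotes its complement and $x_u$ the subvector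 of $x\in\mathbb R^q$ with indices in $u$; for disjoint $u,v$, $x_u:z_v$ is the point with coordinates $x_j$ ($j\in u$) and $z_j$ ($j\in v$). The $q$-fold alternating sum is $[f]_a^b=\sum_{v\subseteq\{1,\dots,q\}}(-1)^{|v|}f(a_v:b_{-v})$. Brownian motion. The standard Brownian motion $B$ on $[0,1]^q$ is the process with a.s. continuous paths, vanishing when some coordinate is $0$, whose increments $B(W)=[B]_s^t$ over pairwise disjoint blocks $W=\prod_j(s_j,t_j]$ are independent normal with mean zero and variance equal to the Lebesgue measure of $W$. Skorohod space. For a box $I\subset\mathbb R^q$, $D(I)$ (written $D[0,1]^q$ for $I=[0,1]^q$) is the space of functions $f:I\to\mathbb R$ such that at each $t\in I$ the limit of $f$ exists along each of the $2^q$ quadrants $\{s\in I: s_pR_pt_p,\ 1\le p\le q\}$, $R_p\in\{<,\ge\}$, and $f(t)$ equals the limit along the quadrant with all $R_p$ equal to $\ge$. It carries the usual multiparameter Skorohod topology (Straf; Bickel–Wichura): $f_n\to f$ iff there are coordinatewise time changes $\lambda_n$ of $I$ (each coordinate an increasing homeomorphism) with $\sup|\lambda_n-\mathrm{id}|\to0$ and $\sup|f_n-f\circ\lambda_n|\to0$. "$\Rightarrow$" is weak convergence. Stochastic integral. The integral with respect to $B$ is a pathwise multivariate Riemann–Stieltjes integral defined through integration by parts. For functions $g,h$ on $[a,b]\subset\mathbb R^q$, $\int_a^b h\,\mathrm dg$ is the limit, as the mesh tends to $0$, of sums over the cells $[y,y^+]$ of product partitions of $h(\tilde y)[g]_{y}^{y^+}$,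 $\tilde y\in[y,y^+]$. When $h$ is not of bounded variation (here $h=B$), one puts $$\int_a^b g\,\mathrm dh:=[hg]_a^b+(-1)^q\int_a^b h\,\mathrm dg+\sum_{v\subseteq\{1,\dots,q\},\,1\le|v|\le q-1}(-1)^{|v|}\int_{a_v}^{b_v}[h\,\mathrm dg]_{a_{-v}}^{b_{-v}},$$ where $\int_{a_v}^{b_v}[h\,\mathrm dg]_{a_{-v}}^{b_{-v}}=\sum_{w\subseteq -v}(-1)^{|w|}\int_{a_v}^{b_v}h\,\mathrm dg$ with the variables in $w$ fixed at $a_w$, those in $(-v)\setminus w$ fixed at $b$, and integration over the variables in $v$. The constant $\sigma^2$ is the long-run variance of the noise: $\sigma^2=\lim\mathrm{Var}\big((n_1n_2n_3)^{-1/2}\sum_{i_1\le n_1}\sum_{i_2\le n_2}\sum_{i_3\le n_3}\varepsilon_{i_1,i_2,i_3}\big)=\sum_{k\in\mathbb Z^3}\mathbb E(\varepsilon_{0}\varepsilon_{k})$. *)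

theory Defs
  imports "HOL-Probability.Probability"
begin

section \<open>Alternating sums over the vertices of a box\<close>

text \<open>The point \<open>x\<^sub>u : z\<^sub>-\<^sub>u\<close>.\<close>

definition glue :: "'q set \<Rightarrow> real ^ 'q \<Rightarrow> real ^ 'q \<Rightarrow> real ^ 'q" where
  "glue u x z = (\<chi> p. if p \<in> u then x $ p else z $ p)"

text \<open>
  For \<open>u = UNIV\<close> this is the \<open>q\<close>-fold alternating sum \<open>[f]\<^sub>a\<^sup>b\<close>. For smaller \<open>u\<close> the alternating sum
  is taken in the coordinates in \<open>u\<close> only, the others being fixed at those of \<open>b\<close>.
\<close>

definition alt_sum :: "'q set \<Rightarrow> (real ^ 'q \<Rightarrow> real) \<Rightarrow> real ^ 'q \<Rightarrow> real ^ 'q \<Rightarrow> real" where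
  "alt_sum u f a b = (\<Sum>v\<in>Pow u. (-1) ^ card v * f (glue v a b))"


section \<open>Standard Brownian motion on the unit cube\<close>

definition block :: "real ^ 'q \<Rightarrow> real ^ 'q \<Rightarrow> (real ^ 'q) set" where
  "block s t = {x. \<forall>p. s $ p < x $ p \<and> x $ p \<le> t $ p}"

text \<open>
  Blocks are nonempty (\<open>s $ p < t $ p\<close> for all \<open>p\<close>): the increment over a degenerate block vanishes
  identically. The second parameter of \<^const>\<open>normal_density\<close> is the standard deviation.
\<close>

definition standard_brownian_motion ::
    "'b measure \<Rightarrow> ('b \<Rightarrow> real ^ 'q \<Rightarrow> real) \<Rightarrow> bool" where
  "standard_brownian_motion N B \<longleftrightarrow>
     prob_space N \<and>
     (\<forall>t\<in>cbox 0 1. (\<lambda>\<omega>. B \<omega> t) \<in> borel_measurable N) \<and>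
     (AE \<omega> in N. continuous_on (cbox 0 1) (B \<omega>)) \<and>
     (AE \<omega> in N. \<forall>t\<in>cbox 0 1. (\<exists>p. t $ p = 0) \<longrightarrow> B \<omega> t = 0) \<and>
     (\<forall>S. (\<forall>(s, t)\<in>S. s \<in> cbox 0 1 \<and> t \<in> cbox 0 1 \<and> (\<forall>p. s $ p < t $ p)) \<and>
          disjoint_family_on (\<lambda>(s, t). block s t) S \<longrightarrow>
          prob_space.indep_vars N (\<lambda>_. borel) (\<lambda>(s, t) \<omega>. alt_sum UNIV (B \<omega>) s t) S \<and>
          (\<forall>(s, t)\<in>S. distributed N lborel (\<lambda>\<omega>. alt_sum UNIV (B \<omega>) s t)
                         (normal_density 0 (sqrt (measure lborel (block s t))))))"


section \<open>The multiparameter Skorohod space on a box\<close>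

definition quadrant :: "real ^ 'q \<Rightarrow> real ^ 'q \<Rightarrow> real ^ 'q \<Rightarrow> 'q set \<Rightarrow> (real ^ 'q) set" where
  "quadrant a b t R = {s \<in> cbox a b. \<forall>p. if p \<in> R then s $ p \<ge> t $ p else s $ p < t $ p}"

text \<open>
  The elements of \<open>D(I)\<close>, \<open>I = cbox a b\<close>, are represented as functions on the whole space that take a
  fixed dummy value outside \<open>I\<close>. Limits along an empty (or one-point) quadrant hold vacuously.
\<close>

definition skorohod_space :: "real ^ 'q \<Rightarrow> real ^ 'q \<Rightarrow> (real ^ 'q \<Rightarrow> real) set" where
  "skorohod_space a b =
     {f \<in> extensional (cbox a b). \<forall>t\<in>cbox a b.
        (\<forall>R. \<exists>l. (f \<longlongrightarrow> l) (at t within quadrant a b t R)) \<and>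
        (f \<longlongrightarrow> f t) (at t within quadrant a b t UNIV)}"

definition time_change :: "real ^ 'q \<Rightarrow> real ^ 'q \<Rightarrow> ('q \<Rightarrow> real \<Rightarrow> real) \<Rightarrow> bool" where
  "time_change a b tc \<longleftrightarrow>
     (\<forall>p. strict_mono_on {a $ p..b $ p} (tc p) \<and>
          (\<exists>\<mu>. homeomorphism {a $ p..b $ p} {a $ p..b $ p} (tc p) \<mu>))"

definition apply_tc :: "('q \<Rightarrow> real \<Rightarrow> real) \<Rightarrow> real ^ 'q \<Rightarrow> real ^ 'q" where
  "apply_tc tc x = (\<chi> p. tc p (x $ p))"

definition skorohod_ball ::
    "real ^ 'q \<Rightarrow> real ^ 'q \<Rightarrow> (real ^ 'q \<Rightarrow> real) \<Rightarrow> real \<Rightarrow> (real ^ 'q \<Rightarrow> real) set" where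
  "skorohod_ball a b f e =
     {g \<in> skorohod_space a b. \<exists>tc. time_change a b tc \<and>
        (\<forall>x\<in>cbox a b. norm (apply_tc tc x - x) < e \<and> \<bar>g x - f (apply_tc tc x)\<bar> < e)}"

text \<open>
  The open sets are those containing a Skorohod ball around each of their points; the lemma
  \<open>limitin_skorohod\<close> below shows that convergence of sequences is the usual one.
\<close>

definition skorohod_topology :: "real ^ 'q \<Rightarrow> real ^ 'q \<Rightarrow> (real ^ 'q \<Rightarrow> real) topology" where
  "skorohod_topology a b =
     topology (\<lambda>U. U \<subseteq> skorohod_space a b \<and> (\<forall>f\<in>U. \<exists>e>0. skorohod_ball a b f e \<subseteq> U))"

definition skorohod_borel :: "real ^ 'q \<Rightarrow> real ^ 'q \<Rightarrow> (real ^ 'q \<Rightarrow> real) measure" where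
  "skorohod_borel a b = sigma (skorohod_space a b) {U. openin (skorohod_topology a b) U}"

lemma skorohod_ball_mono: "e \<le> e' \<Longrightarrow> skorohod_ball a b f e \<subseteq> skorohod_ball a b f e'"
  unfolding skorohod_ball_def by fastforce

lemma openin_skorohod:
  "openin (skorohod_topology a b) U \<longleftrightarrow>
     U \<subseteq> skorohod_space a b \<and> (\<forall>f\<in>U. \<exists>e>0. skorohod_ball a b f e \<subseteq> U)"
proof -
  have "istopology (\<lambda>U. U \<subseteq> skorohod_space a b \<and> (\<forall>f\<in>U. \<exists>e>0. skorohod_ball a b f e \<subseteq> U))"
    unfolding istopology_def
  proof (intro conjI allI impI ballI)
    fix S T f
    assume S: "S \<subseteq> skorohod_space a b \<and> (\<forall>f\<in>S. \<exists>e>0. skorohod_ball a b f e \<subseteq> S)"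
      and T: "T \<subseteq> skorohod_space a b \<and> (\<forall>f\<in>T. \<exists>e>0. skorohod_ball a b f e \<subseteq> T)"
      and f: "f \<in> S \<inter> T"
    then obtain e1 e2 where "e1 > 0" "skorohod_ball a b f e1 \<subseteq> S"
        "e2 > 0" "skorohod_ball a b f e2 \<subseteq> T"
      by blast
    then have "min e1 e2 > 0" "skorohod_ball a b f (min e1 e2) \<subseteq> S \<inter> T"
      using skorohod_ball_mono[of "min e1 e2" e1 a b f] skorohod_ball_mono[of "min e1 e2" e2 a b f]
      by auto
    then show "\<exists>e>0. skorohod_ball a b f e \<subseteq> S \<inter> T"
      by blast
  next
    fix K f
    assume "\<forall>S\<in>K. S \<subseteq> skorohod_space a b \<and> (\<forall>f\<in>S. \<exists>e>0. skorohod_ball a b f e \<subseteq> S)"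
      and "f \<in> \<Union>K"
    then show "\<exists>e>0. skorohod_ball a b f e \<subseteq> \<Union>K"
      by (meson UnionE Union_upper subset_trans)
  qed blast+
  then show ?thesis
    by (simp add: skorohod_topology_def)
qed

lemma topspace_skorohod [simp]: "topspace (skorohod_topology a b) = skorohod_space a b"
proof -
  have "openin (skorohod_topology a b) (skorohod_space a b)"
    unfolding openin_skorohod skorohod_ball_def by (auto intro: exI[of _ 1])
  then show ?thesis
    by (metis openin_skorohod openin_subset openin_topspace subset_antisym)
qed

lemma time_change_ident: "time_change a b (\<lambda>_ x. x)"
  unfolding time_change_def by (auto simp: strict_mono_on_def intro: homeomorphism_ident)

lemma time_change_compose:
  assumes "time_change a b l" "time_change a b m"
  shows "time_change a b (\<lambda>p. l p \<circ> m p)"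
  unfolding time_change_def
proof (intro allI conjI)
  fix p
  obtain l' m' where h: "homeomorphism {a $ p..b $ p} {a $ p..b $ p} (l p) l'"
      "homeomorphism {a $ p..b $ p} {a $ p..b $ p} (m p) m'"
    using assms unfolding time_change_def by meson
  then show "\<exists>\<mu>. homeomorphism {a $ p..b $ p} {a $ p..b $ p} (l p \<circ> m p) \<mu>"
    using homeomorphism_compose by blast
  have "m p ` {a $ p..b $ p} = {a $ p..b $ p}"
    using h(2) by (simp add: homeomorphism_def)
  then show "strict_mono_on {a $ p..b $ p} (l p \<circ> m p)"
    using assms unfolding time_change_def strict_mono_on_def by (metis comp_apply image_eqI)
qed

lemma apply_tc_in_box:
  assumes "time_change a b l" "x \<in> cbox a b"
  shows "apply_tc l x \<in> cbox a b"
proof -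
  have "l p (x $ p) \<in> {a $ p..b $ p}" for p
  proof -
    have "l p ` {a $ p..b $ p} = {a $ p..b $ p}"
      using assms(1) unfolding time_change_def homeomorphism_def by metis
    moreover have "x $ p \<in> {a $ p..b $ p}"
      using assms(2) by (simp add: mem_box_cart)
    ultimately show ?thesis by blast
  qed
  then show ?thesis
    by (simp add: mem_box_cart apply_tc_def)
qed

lemma skorohod_ball_trans:
  assumes "g \<in> skorohod_ball a b f e" "h \<in> skorohod_ball a b g e'"
  shows "h \<in> skorohod_ball a b f (e + e')"
proof -
  obtain l where l: "time_change a b l"
      "\<And>x. x \<in> cbox a b \<Longrightarrow> norm (apply_tc l x - x) < e \<and> \<bar>g x - f (apply_tc l x)\<bar> < e"
    using assms(1) unfolding skorohod_ball_def by blast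
  obtain m where m: "time_change a b m" "h \<in> skorohod_space a b"
      "\<And>x. x \<in> cbox a b \<Longrightarrow> norm (apply_tc m x - x) < e' \<and> \<bar>h x - g (apply_tc m x)\<bar> < e'"
    using assms(2) unfolding skorohod_ball_def by blast
  have "norm (apply_tc (\<lambda>p. l p \<circ> m p) x - x) < e + e' \<and>
        \<bar>h x - f (apply_tc (\<lambda>p. l p \<circ> m p) x)\<bar> < e + e'" if x: "x \<in> cbox a b" for x
  proof -
    have eq: "apply_tc (\<lambda>p. l p \<circ> m p) x = apply_tc l (apply_tc m x)"
      by (simp add: apply_tc_def)
    have y: "apply_tc m x \<in> cbox a b"
      using apply_tc_in_box m(1) x by blast
    have "norm (apply_tc l (apply_tc m x) - x)
            \<le> norm (apply_tc l (apply_tc m x) - apply_tc m x) + norm (apply_tc m x - x)"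
      using norm_triangle_ineq[of "apply_tc l (apply_tc m x) - apply_tc m x" "apply_tc m x - x"]
      by simp
    then show ?thesis
      unfolding eq using l(2)[OF y] m(3)[OF x] by linarith
  qed
  then show ?thesis
    unfolding skorohod_ball_def using m(2) time_change_compose[OF l(1) m(1)] by blast
qed

lemma skorohod_ball_self:
  assumes "f \<in> skorohod_space a b" "e > 0"
  shows "f \<in> skorohod_ball a b f e"
  unfolding skorohod_ball_def using assms time_change_ident[of a b]
  by (auto simp: apply_tc_def intro!: exI[of _ "\<lambda>_ x. x"])

lemma skorohod_nhd:
  assumes "f \<in> skorohod_space a b" "e > 0"
  shows "\<exists>U. openin (skorohod_topology a b) U \<and> f \<in> U \<and> U \<subseteq> skorohod_ball a b f e"
proof -
  define U where "U = (\<Union>e'\<in>{0<..<e}. skorohod_ball a b f e')"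
  have "openin (skorohod_topology a b) U"
    unfolding openin_skorohod
  proof (intro conjI ballI)
    show "U \<subseteq> skorohod_space a b"
      unfolding U_def skorohod_ball_def by blast
    fix g assume "g \<in> U"
    then obtain e' where e': "0 < e'" "e' < e" "g \<in> skorohod_ball a b f e'"
      unfolding U_def by auto
    have "skorohod_ball a b g ((e - e') / 2) \<subseteq> skorohod_ball a b f (e' + (e - e') / 2)"
      using skorohod_ball_trans[OF e'(3)] by blast
    moreover have "e' + (e - e') / 2 \<in> {0<..<e}"
      using e' by (simp add: field_simps)
    ultimately have "skorohod_ball a b g ((e - e') / 2) \<subseteq> U"
      unfolding U_def by blast
    then show "\<exists>e>0. skorohod_ball a b g e \<subseteq> U"
      using e' by (intro exI[of _ "(e - e') / 2"]) auto
  qed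
  moreover have "f \<in> U"
    unfolding U_def using skorohod_ball_self[OF assms(1), of "e / 2"] assms(2)
    by (intro UN_I[of "e / 2"]) auto
  moreover have "U \<subseteq> skorohod_ball a b f e"
    unfolding U_def by (intro UN_least skorohod_ball_mono) simp
  ultimately show ?thesis by blast
qed

lemma limitin_skorohod_ball:
  "limitin (skorohod_topology a b) fs f F \<longleftrightarrow>
     f \<in> skorohod_space a b \<and> (\<forall>e>0. \<forall>\<^sub>F n in F. fs n \<in> skorohod_ball a b f e)"
proof (intro iffI conjI allI impI)
  assume L: "limitin (skorohod_topology a b) fs f F"
  then show f: "f \<in> skorohod_space a b"
    by (simp add: limitin_def)
  fix e :: real assume "e > 0"
  then obtain U where U: "openin (skorohod_topology a b) U" "f \<in> U" "U \<subseteq> skorohod_ball a b f e"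
    using skorohod_nhd[OF f] by blast
  have "\<forall>\<^sub>F n in F. fs n \<in> U"
    using L U(1,2) by (simp add: limitin_def)
  then show "\<forall>\<^sub>F n in F. fs n \<in> skorohod_ball a b f e"
    by (rule eventually_mono) (use U(3) in blast)
next
  assume R: "f \<in> skorohod_space a b \<and> (\<forall>e>0. \<forall>\<^sub>F n in F. fs n \<in> skorohod_ball a b f e)"
  show "limitin (skorohod_topology a b) fs f F"
    unfolding limitin_def
  proof (intro conjI allI impI)
    show "f \<in> topspace (skorohod_topology a b)"
      using R by simp
    fix U assume "openin (skorohod_topology a b) U \<and> f \<in> U"
    then obtain e where e: "e > 0" "skorohod_ball a b f e \<subseteq> U"
      unfolding openin_skorohod by blast
    then have "\<forall>\<^sub>F n in F. fs n \<in> skorohod_ball a b f e"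
      using R by simp
    then show "\<forall>\<^sub>F n in F. fs n \<in> U"
      by (rule eventually_mono) (use e(2) in blast)
  qed
qed

lemma limitin_skorohod:
  assumes fs: "\<And>n. fs n \<in> skorohod_space a b"
  shows "limitin (skorohod_topology a b) fs f sequentially \<longleftrightarrow>
     f \<in> skorohod_space a b \<and>
     (\<exists>tc. (\<forall>n. time_change a b (tc n)) \<and>
        uniform_limit (cbox a b) (\<lambda>n x. norm (apply_tc (tc n) x - x)) (\<lambda>_. 0) sequentially \<and>
        uniform_limit (cbox a b) (\<lambda>n x. \<bar>fs n x - f (apply_tc (tc n) x)\<bar>) (\<lambda>_. 0) sequentially)"
    (is "?L \<longleftrightarrow> _ \<and> (\<exists>tc. ?R tc)")
proof (intro iffI conjI)
  assume L: ?L
  then show "f \<in> skorohod_space a b"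
    by (simp add: limitin_def)
  define P where "P n l e \<longleftrightarrow> (\<forall>x\<in>cbox a b. norm (apply_tc l x - x) < e \<and>
                     \<bar>fs n x - f (apply_tc l x)\<bar> < e)" for n l and e :: real
  have P_mono: "P n l e'" if "P n l e" "e \<le> e'" for n l e e'
    unfolding P_def
  proof (intro ballI conjI)
    fix x assume x: "x \<in> cbox a b"
    have "norm (apply_tc l x - x) < e \<and> \<bar>fs n x - f (apply_tc l x)\<bar> < e"
      using that(1) x unfolding P_def by blast
    then show "norm (apply_tc l x - x) < e'" "\<bar>fs n x - f (apply_tc l x)\<bar> < e'"
      using that(2) by linarith+
  qed
  have ev: "\<forall>\<^sub>F n in sequentially. \<exists>l. time_change a b l \<and> P n l e" if "e > 0" for e
  proof -
    have "\<forall>\<^sub>F n in sequentially. fs n \<in> skorohod_ball a b f e"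
      using L that by (simp add: limitin_skorohod_ball)
    then show ?thesis
      by (rule eventually_mono) (auto simp: skorohod_ball_def P_def)
  qed
  have ex: "\<exists>l. time_change a b l \<and> (\<forall>k\<le>n. (\<exists>l'. time_change a b l' \<and> P n l' (1 / Suc k)) \<longrightarrow>
                P n l (1 / Suc k))" for n
  proof -
    define K where "K = {k. k \<le> n \<and> (\<exists>l'. time_change a b l' \<and> P n l' (1 / Suc k))}"
    have K_iff: "k \<in> K \<longleftrightarrow> k \<le> n \<and> (\<exists>l'. time_change a b l' \<and> P n l' (1 / Suc k))" for k
      by (simp add: K_def)
    have fin: "finite K"
      by (rule finite_subset[of _ "{..n}"]) (auto simp: K_def)
    show ?thesis
    proof (cases "K = {}")
      case True
      show ?thesis
      proof (intro exI[of _ "\<lambda>_ x. x"] conjI allI impI time_change_ident)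
        fix k assume "k \<le> n" "\<exists>l'. time_change a b l' \<and> P n l' (1 / Suc k)"
        then have "k \<in> K"
          by (simp add: K_def)
        with True show "P n (\<lambda>_ x. x) (1 / Suc k)"
          by simp
      qed
    next
      case False
      then have "Max K \<in> K"
        using fin by simp
      then obtain l where l: "time_change a b l" "P n l (1 / Suc (Max K))"
        using K_iff by meson
      have "P n l (1 / Suc k)" if "k \<in> K" for k
        using P_mono[OF l(2)] Max_ge[OF fin that] by (simp add: frac_le)
      then show ?thesis
        using l(1) by (intro exI[of _ l]) (simp add: K_def)
    qed
  qed
  obtain ls where ls': "\<forall>n. time_change a b (ls n) \<and>
      (\<forall>k\<le>n. (\<exists>l'. time_change a b l' \<and> P n l' (1 / Suc k)) \<longrightarrow> P n (ls n) (1 / Suc k))"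
    using choice[OF allI[OF ex]] by (rule exE)
  have ls: "time_change a b (ls n)"
      "\<lbrakk>k \<le> n; \<exists>l'. time_change a b l' \<and> P n l' (1 / Suc k)\<rbrakk> \<Longrightarrow> P n (ls n) (1 / Suc k)" for n k
    using ls' by simp_all
  have P_ls: "\<forall>\<^sub>F n in sequentially. P n (ls n) e" if "e > 0" for e
  proof -
    obtain k where k: "1 / Suc k < e"
      using reals_Archimedean[OF \<open>e > 0\<close>] unfolding inverse_eq_divide by (rule exE)
    have "\<forall>\<^sub>F n in sequentially. \<exists>l'. time_change a b l' \<and> P n l' (1 / Suc k)"
      by (rule ev) simp
    with eventually_ge_at_top[of k] show ?thesis
    proof eventually_elim
      case (elim n)
      then show ?case
        using ls(2)[of k n] k P_mono[of n "ls n" "1 / Suc k" e] by simp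
    qed
  qed
  show "\<exists>tc. ?R tc"
  proof (intro exI[of _ ls] conjI allI ls(1))
    show "uniform_limit (cbox a b) (\<lambda>n x. norm (apply_tc (ls n) x - x)) (\<lambda>_. 0) sequentially"
      unfolding uniform_limit_iff
    proof (intro allI impI)
      fix e :: real assume "e > 0"
      from P_ls[OF this] show "\<forall>\<^sub>F n in sequentially. \<forall>x\<in>cbox a b. dist (norm (apply_tc (ls n) x - x)) 0 < e"
        by (rule eventually_mono) (simp add: P_def)
    qed
    show "uniform_limit (cbox a b) (\<lambda>n x. \<bar>fs n x - f (apply_tc (ls n) x)\<bar>) (\<lambda>_. 0) sequentially"
      unfolding uniform_limit_iff
    proof (intro allI impI)
      fix e :: real assume "e > 0"
      from P_ls[OF this] show "\<forall>\<^sub>F n in sequentially. \<forall>x\<in>cbox a b. dist \<bar>fs n x - f (apply_tc (ls n) x)\<bar> 0 < e"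
        by (rule eventually_mono) (simp add: P_def)
    qed
  qed
next
  assume R: "f \<in> skorohod_space a b \<and> (\<exists>tc. ?R tc)"
  then obtain ls where ls: "?R ls"
    by blast
  have "\<forall>\<^sub>F n in sequentially. fs n \<in> skorohod_ball a b f e" if "e > 0" for e
  proof -
    have "\<forall>\<^sub>F n in sequentially. \<forall>x\<in>cbox a b. norm (apply_tc (ls n) x - x) < e"
         "\<forall>\<^sub>F n in sequentially. \<forall>x\<in>cbox a b. \<bar>fs n x - f (apply_tc (ls n) x)\<bar> < e"
      using ls that unfolding uniform_limit_iff dist_real_def by simp_all
    then show ?thesis
    proof eventually_elim
      case (elim n)
      then show ?case
        unfolding skorohod_ball_def using fs[of n] ls by blast
    qed
  qed
  then show ?L
    unfolding limitin_skorohod_ball using R by blast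
qed


section \<open>Weak convergence of processes\<close>

text \<open>
  \<open>X'\<close> is a version of the process \<open>X\<close> (up to a null set, in the parameter set \<open>cbox a b\<close>) that is a
  random element of the Skorohod space. Allowing a null set is needed since the paths of a Brownian
  motion are continuous, and stochastic integrals defined, only almost surely.
\<close>

definition skorohod_version ::
    "'a measure \<Rightarrow> real ^ 'q \<Rightarrow> real ^ 'q \<Rightarrow> ('a \<Rightarrow> real ^ 'q \<Rightarrow> real) \<Rightarrow>
     ('a \<Rightarrow> real ^ 'q \<Rightarrow> real) \<Rightarrow> bool" where
  "skorohod_version M a b X X' \<longleftrightarrow>
     X' \<in> M \<rightarrow>\<^sub>M skorohod_borel a b \<and> (AE \<omega> in M. \<forall>x\<in>cbox a b. X' \<omega> x = X \<omega> x)"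

text \<open>
  The defining limit relation depends only on the laws of \<open>X' n\<close> and \<open>Y'\<close>, hence not on the choice of
  the versions.
\<close>

definition converges_weakly ::
    "real ^ 'q \<Rightarrow> real ^ 'q \<Rightarrow> 'a measure \<Rightarrow> ('i \<Rightarrow> 'a \<Rightarrow> real ^ 'q \<Rightarrow> real) \<Rightarrow>
     'b measure \<Rightarrow> ('b \<Rightarrow> real ^ 'q \<Rightarrow> real) \<Rightarrow> 'i filter \<Rightarrow> bool" where
  "converges_weakly a b M X N Y F \<longleftrightarrow>
     (\<exists>X' Y'. (\<forall>n. skorohod_version M a b (X n) (X' n)) \<and> skorohod_version N a b Y Y' \<and>
        (\<forall>h. continuous_map (skorohod_topology a b) euclideanreal h \<and>
             bounded (h ` skorohod_space a b) \<longrightarrow>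
             ((\<lambda>n. \<integral>\<omega>. h (X' n \<omega>) \<partial>M) \<longlongrightarrow> (\<integral>\<omega>. h (Y' \<omega>) \<partial>N)) F))"


section \<open>Multivariate Riemann--Stieltjes integration\<close>

text \<open>
  All notions are relative to a set \<open>v\<close> of integration variables; the remaining variables are fixed
  at the coordinates of \<open>c\<close>. A product partition of \<open>[a\<^sub>v, b\<^sub>v]\<close> has the nodes \<open>y p 0 < \<dots> < y p (m p)\<close>
  in coordinate \<open>p \<in> v\<close>; its cells are indexed by \<open>k \<in> (\<Pi>\<^sub>E p\<in>v. {..<m p})\<close>.
\<close>

definition product_partition ::
    "'q set \<Rightarrow> real ^ 'q \<Rightarrow> real ^ 'q \<Rightarrow> ('q \<Rightarrow> nat) \<Rightarrow> ('q \<Rightarrow> nat \<Rightarrow> real) \<Rightarrow> bool" where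
  "product_partition v a b m y \<longleftrightarrow>
     (\<forall>p\<in>v. y p 0 = a $ p \<and> y p (m p) = b $ p \<and> (\<forall>i<m p. y p i < y p (Suc i)))"

definition node :: "'q set \<Rightarrow> real ^ 'q \<Rightarrow> ('q \<Rightarrow> nat \<Rightarrow> real) \<Rightarrow> ('q \<Rightarrow> nat) \<Rightarrow> real ^ 'q" where
  "node v c y k = (\<chi> p. if p \<in> v then y p (k p) else c $ p)"

definition has_RS_integral ::
    "'q set \<Rightarrow> real ^ 'q \<Rightarrow> real ^ 'q \<Rightarrow> real ^ 'q \<Rightarrow> (real ^ 'q \<Rightarrow> real) \<Rightarrow> (real ^ 'q \<Rightarrow> real) \<Rightarrow>
     real \<Rightarrow> bool" where
  "has_RS_integral v c a b h g L \<longleftrightarrow>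
     (\<forall>e>0. \<exists>d>0. \<forall>m y \<xi>.
        product_partition v a b m y \<and>
        (\<forall>p\<in>v. \<forall>i<m p. y p (Suc i) - y p i < d) \<and>
        (\<forall>k\<in>(\<Pi>\<^sub>E p\<in>v. {..<m p}). \<xi> k \<in> cbox (node v c y k) (node v c y (\<lambda>p. Suc (k p)))) \<longrightarrow>
        \<bar>(\<Sum>k\<in>(\<Pi>\<^sub>E p\<in>v. {..<m p}).
            h (\<xi> k) * alt_sum v g (node v c y k) (node v c y (\<lambda>p. Suc (k p)))) - L\<bar> < e)"

definition RS_integral ::
    "'q set \<Rightarrow> real ^ 'q \<Rightarrow> real ^ 'q \<Rightarrow> real ^ 'q \<Rightarrow> (real ^ 'q \<Rightarrow> real) \<Rightarrow> (real ^ 'q \<Rightarrow> real) \<Rightarrow>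
     real" where
  "RS_integral v c a b h g = (THE L. has_RS_integral v c a b h g L)"

text \<open>\<open>\<integral>\<^sub>a\<^sup>b g dh\<close> for \<open>h\<close> not of bounded variation, through integration by parts.\<close>

definition RS_by_parts ::
    "real ^ 'q \<Rightarrow> real ^ 'q \<Rightarrow> (real ^ 'q \<Rightarrow> real) \<Rightarrow> (real ^ 'q \<Rightarrow> real) \<Rightarrow> real" where
  "RS_by_parts a b g h =
     alt_sum UNIV (\<lambda>x. h x * g x) a b +
     (-1) ^ CARD('q) * RS_integral UNIV b a b h g +
     (\<Sum>v | 1 \<le> card v \<and> card v \<le> CARD('q) - 1.
        (-1) ^ card v * (\<Sum>w\<in>Pow (- v). (-1) ^ card w * RS_integral v (glue w a b) a b h g))"


section \<open>The noise random field and the monitoring process\<close>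

definition min_to_infinity :: "(nat ^ 3) filter" where
  "min_to_infinity = filtercomap (\<lambda>n. Min (range (\<lambda>j. n $ j))) at_top"

definition weakly_stationary :: "'a measure \<Rightarrow> (int ^ 3 \<Rightarrow> 'a \<Rightarrow> real) \<Rightarrow> bool" where
  "weakly_stationary M \<epsilon> \<longleftrightarrow>
     (\<forall>i. \<epsilon> i \<in> borel_measurable M \<and> integrable M (\<lambda>\<omega>. (\<epsilon> i \<omega>)\<^sup>2)) \<and>
     (\<forall>i k. (\<integral>\<omega>. \<epsilon> (i + k) \<omega> \<partial>M) = (\<integral>\<omega>. \<epsilon> i \<omega> \<partial>M)) \<and>
     (\<forall>i j k. (\<integral>\<omega>. (\<epsilon> (i + k) \<omega> - (\<integral>\<omega>'. \<epsilon> (i + k) \<omega>' \<partial>M)) * (\<epsilon> (j + k) \<omega> - (\<integral>\<omega>'. \<epsilon> (j + k) \<omega>' \<partial>M)) \<partial>M) =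
              (\<integral>\<omega>. (\<epsilon> i \<omega> - (\<integral>\<omega>'. \<epsilon> i \<omega>' \<partial>M)) * (\<epsilon> j \<omega> - (\<integral>\<omega>'. \<epsilon> j \<omega>' \<partial>M)) \<partial>M))"

definition partial_sum_process ::
    "(int ^ 3 \<Rightarrow> 'a \<Rightarrow> real) \<Rightarrow> nat ^ 3 \<Rightarrow> 'a \<Rightarrow> real ^ 3 \<Rightarrow> real" where
  "partial_sum_process \<epsilon> n \<omega> v =
     real (n $ 1 * n $ 2 * n $ 3) powr (-1/2) *
     (\<Sum>i\<^sub>1 = 1..\<lfloor>real (n $ 1) * v $ 1\<rfloor>. \<Sum>i\<^sub>2 = 1..\<lfloor>real (n $ 2) * v $ 2\<rfloor>.
        \<Sum>i\<^sub>3 = 1..\<lfloor>real (n $ 3) * v $ 3\<rfloor>. \<epsilon> (vector [i\<^sub>1, i\<^sub>2, i\<^sub>3]) \<omega>)"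

definition long_run_variance :: "'a measure \<Rightarrow> (int ^ 3 \<Rightarrow> 'a \<Rightarrow> real) \<Rightarrow> real \<Rightarrow> bool" where
  "long_run_variance M \<epsilon> V \<longleftrightarrow>
     ((\<lambda>n. prob_space.variance M (\<lambda>\<omega>. partial_sum_process \<epsilon> n \<omega> 1)) \<longlongrightarrow> V) min_to_infinity \<and>
     ((\<lambda>k. \<integral>\<omega>. \<epsilon> 0 \<omega> * \<epsilon> k \<omega> \<partial>M) has_sum V) UNIV"

definition kernel :: "real ^ 3 \<Rightarrow> real ^ 3 \<Rightarrow> real" where
  "kernel \<Omega> x = (\<Prod>j\<in>UNIV. if x $ j = 0 then \<Omega> $ j / pi else sin (\<Omega> $ j * x $ j) / (pi * x $ j))"

text \<open>The sampling period along axis \<open>j\<close> for sample sizes \<open>n\<close> is \<open>\<tau> j (n $ j)\<close>.\<close>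

definition sampling_point :: "(3 \<Rightarrow> nat \<Rightarrow> real) \<Rightarrow> nat ^ 3 \<Rightarrow> int ^ 3 \<Rightarrow> real ^ 3" where
  "sampling_point \<tau> n l = (\<chi> j. of_int (l $ j) * \<tau> j (n $ j))"

definition observation ::
    "(real ^ 3 \<Rightarrow> real) \<Rightarrow> (3 \<Rightarrow> nat \<Rightarrow> real) \<Rightarrow> (int ^ 3 \<Rightarrow> 'a \<Rightarrow> real) \<Rightarrow>
     nat ^ 3 \<Rightarrow> int ^ 3 \<Rightarrow> 'a \<Rightarrow> real" where
  "observation f \<tau> \<epsilon> n l \<omega> = f (sampling_point \<tau> n l) + \<epsilon> l \<omega>"

text \<open>The argument \<open>x\<close> of the following two processes is \<open>(s, t, r\<^sub>2, r\<^sub>3)\<close>.\<close>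

definition monitoring_process ::
    "real ^ 3 \<Rightarrow> (3 \<Rightarrow> nat \<Rightarrow> real) \<Rightarrow> (real ^ 3 \<Rightarrow> real) \<Rightarrow>
     (nat ^ 3 \<Rightarrow> int ^ 3 \<Rightarrow> 'a \<Rightarrow> real) \<Rightarrow> nat ^ 3 \<Rightarrow> 'a \<Rightarrow> real ^ 4 \<Rightarrow> real" where
  "monitoring_process \<Omega> \<tau> f\<^sub>0 y n \<omega> x =
     sqrt (\<tau> 1 (n $ 1) * \<tau> 2 (n $ 2) * \<tau> 3 (n $ 3)) *
     (\<Sum>l\<^sub>1 = 1..\<lfloor>real (n $ 1) * x $ 1\<rfloor>. \<Sum>l\<^sub>2 = 1..int (n $ 2). \<Sum>l\<^sub>3 = 1..int (n $ 3).
        (y n (vector [l\<^sub>1, l\<^sub>2, l\<^sub>3]) \<omega> - f\<^sub>0 (sampling_point \<tau> n (vector [l\<^sub>1, l\<^sub>2, l\<^sub>3]))) *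
        kernel \<Omega> (vector [x $ 2, x $ 3, x $ 4] - sampling_point \<tau> n (vector [l\<^sub>1, l\<^sub>2, l\<^sub>3])))"

definition limit_process ::
    "real ^ 3 \<Rightarrow> real ^ 3 \<Rightarrow> real \<Rightarrow> ('b \<Rightarrow> real ^ 3 \<Rightarrow> real) \<Rightarrow> 'b \<Rightarrow> real ^ 4 \<Rightarrow> real" where
  "limit_process \<Omega> \<tau>bar \<sigma> B \<omega> x =
     sqrt (\<tau>bar $ 1 * \<tau>bar $ 2 * \<tau>bar $ 3) * \<sigma> *
     RS_by_parts 0 (vector [x $ 1, 1, 1])
       (\<lambda>z. kernel \<Omega> (vector [x $ 2 - \<tau>bar $ 1 * z $ 1, x $ 3 - \<tau>bar $ 2 * z $ 2,
                               x $ 4 - \<tau>bar $ 3 * z $ 3]))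
       (B \<omega>)"

end

theory Submission
  imports Defs "HOL-Real_Asymp.Real_Asymp"
begin

text \<open>
  Under the null hypothesis the residuals are the noise itself, so the monitoring process is a
  deterministic linear functional \<open>\<Psi>\<^sub>n\<close> of the partial sum process \<open>Z\<^sub>n\<close>: it is the discrete integral of
  the kernel against the increments of \<open>Z\<^sub>n\<close>. Summation by parts moves the differences from \<open>Z\<^sub>n\<close> to the
  kernel (\<open>Abel_summation_PiE\<close>, \<open>monitoring_process_eq\<close>). The kernel is a product of continuously
  differentiable functions of one variable with bounded derivatives, so the resulting weights have
  bounded total size, and uniform closeness of paths carries over to their images under \<open>\<Psi>\<^sub>n\<close>.

  The limit process is treated in the same way. Almost every path \<open>c\<close> of Brownian motion is continuous and
  vanishes when a coordinate is zero, so the integration by parts formula reduces to a signed sum of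
  Stieltjes integrals of \<open>c\<close> over the faces through the upper corner. These have densities, because the
  integrand is a product of smooth functions (\<open>RS_by_parts_eq_parts_functional\<close>). The same comparison of
  Riemann sums and integrals (\<open>Riemann_Stieltjes_sum_estimate\<close>) that proves the existence of these
  integrals also shows that \<open>\<Psi>\<^sub>n w\<close> is uniformly close to the limit functional \<open>\<Psi> c\<close> when \<open>n\<close> is large
  and the path \<open>w\<close> is uniformly close to the continuous path \<open>c\<close> (\<open>monitor_functional_uniform_limit\<close>).

  It remains to pass from the weak convergence of \<open>Z\<^sub>n\<close> to that of \<open>\<Psi>\<^sub>n Z\<^sub>n\<close>. The functionals \<open>\<Psi>\<^sub>n\<close> vary
  with \<open>n\<close>, and they evaluate paths at grid points, which is not a continuous operation in the Skorohod
  topology. But if \<open>w\<^sub>n\<close> tends to a continuous path \<open>c\<close> in that topology, then it tends to \<open>c\<close> uniformly,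
  and hence \<open>\<Psi>\<^sub>n w\<^sub>n\<close> tends to \<open>\<Psi> c\<close> uniformly. This is enough for \<open>extended_continuous_mapping\<close>. Given
  a bounded continuous functional \<open>h\<close>, one replaces \<open>h (\<Psi>\<^sub>n w)\<close>, for all large \<open>n\<close> together, by an
  infimal convolution with a multiple of the Skorohod distance. This is a continuous test function from below, and it recovers
  \<open>h (\<Psi> c)\<close> as the multiple grows.
\<close>

section \<open>The Skorohod topology and its Borel sets\<close>

lemma skorohod_ball_subset_space: "skorohod_ball a b f e \<subseteq> skorohod_space a b"
  unfolding skorohod_ball_def by blast

lemma skorohod_ball_uniform:
  assumes "g \<in> skorohod_space a b" "0 < e" "\<And>x. x \<in> cbox a b \<Longrightarrow> \<bar>g x - f x\<bar> < e"
  shows "g \<in> skorohod_ball a b f e"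
  unfolding skorohod_ball_def using assms time_change_ident[of a b]
  by (auto simp: apply_tc_def intro!: exI[of _ "\<lambda>_ x. x"])

text \<open>
  The inverse time changes exchange the roles of the two paths, and they are as close to the identity
  as the original ones.
\<close>

lemma skorohod_ball_sym:
  assumes g: "g \<in> skorohod_ball a b f e" and f: "f \<in> skorohod_space a b"
  shows "f \<in> skorohod_ball a b g e"
proof -
  obtain l where l: "time_change a b l"
      "\<And>x. x \<in> cbox a b \<Longrightarrow> norm (apply_tc l x - x) < e \<and> \<bar>g x - f (apply_tc l x)\<bar> < e"
    using g unfolding skorohod_ball_def by blast
  have "\<forall>p. \<exists>\<mu>. homeomorphism {a $ p..b $ p} {a $ p..b $ p} (l p) \<mu>"
    using l(1) unfolding time_change_def by blast
  then obtain m where m: "\<And>p. homeomorphism {a $ p..b $ p} {a $ p..b $ p} (l p) (m p)"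
    by metis
  have "strict_mono_on {a $ p..b $ p} (m p)" for p
  proof (rule strict_mono_onI)
    fix r s assume rs: "r \<in> {a $ p..b $ p}" "s \<in> {a $ p..b $ p}" "r < s"
    have lm: "l p (m p r) = r" "l p (m p s) = s" "m p r \<in> {a $ p..b $ p}" "m p s \<in> {a $ p..b $ p}"
      using m[of p] rs unfolding homeomorphism_def by auto
    have "strict_mono_on {a $ p..b $ p} (l p)"
      using l(1) unfolding time_change_def by blast
    then have "m p s \<le> m p r \<Longrightarrow> l p (m p s) \<le> l p (m p r)"
      using lm(3,4) by (simp add: strict_mono_on_leD)
    then show "m p r < m p s"
      using lm rs(3) by linarith
  qed
  then have tm: "time_change a b m"
    unfolding time_change_def using m homeomorphism_symD by blast
  have "norm (apply_tc m x - x) < e \<and> \<bar>f x - g (apply_tc m x)\<bar> < e" if x: "x \<in> cbox a b" for x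
  proof -
    have "l p (m p (x $ p)) = x $ p" for p
      using m[of p] x unfolding homeomorphism_def by (auto simp: mem_box_cart)
    then have "apply_tc l (apply_tc m x) = x"
      by (simp add: apply_tc_def vec_eq_iff)
    with l(2)[OF apply_tc_in_box[OF tm x]] show ?thesis
      by (metis abs_minus_commute norm_minus_commute)
  qed
  then show ?thesis
    unfolding skorohod_ball_def using f tm by blast
qed

lemma continuous_map_skorohodI:
  assumes "\<And>f \<epsilon>. f \<in> skorohod_space a b \<Longrightarrow> 0 < \<epsilon> \<Longrightarrow>
             \<exists>e>0. \<forall>g\<in>skorohod_ball a b f e. \<bar>h g - h f\<bar> < \<epsilon>"
  shows "continuous_map (skorohod_topology a b) euclideanreal h"
unfolding continuous_map_def
proof (intro conjI allI impI)
  fix U assume U: "openin euclideanreal U"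
  show "openin (skorohod_topology a b) {x \<in> topspace (skorohod_topology a b). h x \<in> U}"
    unfolding openin_skorohod
  proof (intro conjI ballI)
    fix f assume f: "f \<in> {x \<in> topspace (skorohod_topology a b). h x \<in> U}"
    with U have "open U" "h f \<in> U" "f \<in> skorohod_space a b"
      by auto
    then obtain \<epsilon> where \<epsilon>: "\<epsilon> > 0" "ball (h f) \<epsilon> \<subseteq> U"
      using open_contains_ball by blast
    obtain e where e: "e > 0" "\<forall>g\<in>skorohod_ball a b f e. \<bar>h g - h f\<bar> < \<epsilon>"
      using assms[OF \<open>f \<in> skorohod_space a b\<close> \<epsilon>(1)] by blast
    have "skorohod_ball a b f e \<subseteq> {x \<in> topspace (skorohod_topology a b). h x \<in> U}"
    proof
      fix g assume g: "g \<in> skorohod_ball a b f e"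
      then have "\<bar>h g - h f\<bar> < \<epsilon>"
        using e(2) by blast
      then have "h g \<in> ball (h f) \<epsilon>"
        by (simp add: dist_real_def abs_minus_commute)
      then show "g \<in> {x \<in> topspace (skorohod_topology a b). h x \<in> U}"
        using subsetD[OF \<epsilon>(2)] subsetD[OF skorohod_ball_subset_space g] by simp
    qed
    then show "\<exists>e>0. skorohod_ball a b f e \<subseteq> {x \<in> topspace (skorohod_topology a b). h x \<in> U}"
      using e(1) by blast
  qed auto
qed auto

lemma continuous_map_skorohodD:
  assumes h: "continuous_map (skorohod_topology a b) euclideanreal h"
    and f: "f \<in> skorohod_space a b" and "0 < \<epsilon>"
  shows "\<exists>e>0. \<forall>g\<in>skorohod_ball a b f e. \<bar>h g - h f\<bar> < \<epsilon>"
proof -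
  have "openin (skorohod_topology a b) {x \<in> topspace (skorohod_topology a b). h x \<in> ball (h f) \<epsilon>}"
    using h by (intro openin_continuous_map_preimage) auto
  then obtain e where "e > 0" "skorohod_ball a b f e \<subseteq> {x \<in> topspace (skorohod_topology a b). h x \<in> ball (h f) \<epsilon>}"
    unfolding openin_skorohod using f \<open>0 < \<epsilon>\<close> by auto
  then show ?thesis
    by (intro exI[of _ e]) (auto simp: dist_real_def abs_minus_commute)
qed

lemma space_skorohod_borel [simp]: "space (skorohod_borel a b) = skorohod_space a b"
  unfolding skorohod_borel_def by (rule space_measure_of) (auto simp: openin_skorohod)

lemma sets_skorohod_borel:
  "sets (skorohod_borel a b) = sigma_sets (skorohod_space a b) {U. openin (skorohod_topology a b) U}"
  unfolding skorohod_borel_def by (rule sets_measure_of) (auto simp: openin_skorohod)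

lemma borel_measurable_skorohod_continuous:
  assumes h: "continuous_map (skorohod_topology a b) euclideanreal h"
  shows "h \<in> borel_measurable (skorohod_borel a b)"
proof (rule borel_measurableI)
  fix S :: "real set" assume "open S"
  then have "openin (skorohod_topology a b) {x \<in> topspace (skorohod_topology a b). h x \<in> S}"
    using h by (intro openin_continuous_map_preimage) auto
  moreover have "h -` S \<inter> space (skorohod_borel a b) = {x \<in> topspace (skorohod_topology a b). h x \<in> S}"
    by auto
  ultimately show "h -` S \<inter> space (skorohod_borel a b) \<in> sets (skorohod_borel a b)"
    by (simp add: sets_skorohod_borel sigma_sets.Basic)
qed

section \<open>Lipschitz envelopes and extended continuous mapping\<close>

text \<open>
  The infimal convolution of the functionals \<open>\<phi> i\<close>, \<open>i \<in> E\<close>, with \<open>k\<close> times the Skorohod distance: the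
  largest \<open>k\<close>-Lipschitz functional below all of them, cut off at \<open>C\<close>. The distance is not introduced
  separately; the radius \<open>e\<close> of a ball that contains the competitor \<open>w\<close> takes its place. The element
  \<open>C\<close> keeps the set nonempty, so that the infimum also makes sense for empty \<open>E\<close>.
\<close>

definition envelope ::
    "real ^ 'q \<Rightarrow> real ^ 'q \<Rightarrow> ('i \<Rightarrow> (real ^ 'q \<Rightarrow> real) \<Rightarrow> real) \<Rightarrow> 'i set \<Rightarrow> real \<Rightarrow> real \<Rightarrow>
     (real ^ 'q \<Rightarrow> real) \<Rightarrow> real" where
  "envelope a b \<phi> E C k z =
     Inf (insert C {\<phi> i w + k * e | i w e. i \<in> E \<and> 0 < e \<and> w \<in> skorohod_ball a b z e})"

lemma envelope_bdd:
  assumes "\<forall>i\<in>E. \<forall>w\<in>skorohod_space a b. - C \<le> \<phi> i w" "0 \<le> C" "0 \<le> k"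
    and y: "y \<in> insert C {\<phi> i w + k * e | i w e. i \<in> E \<and> 0 < e \<and> w \<in> skorohod_ball a b z e}"
  shows "- C \<le> y"
  using y
proof
  assume "y \<in> {\<phi> i w + k * e | i w e. i \<in> E \<and> 0 < e \<and> w \<in> skorohod_ball a b z e}"
  then obtain i w e where y: "y = \<phi> i w + k * e" "i \<in> E" "0 < e" "w \<in> skorohod_ball a b z e"
    by blast
  then have "- C \<le> \<phi> i w" "0 \<le> k * e"
    using assms(1) \<open>0 \<le> k\<close> skorohod_ball_subset_space[of a b z e] by auto
  then show ?thesis
    using y by linarith
qed (use assms in simp)

lemma envelope_ge:
  assumes "\<forall>i\<in>E. \<forall>w\<in>skorohod_space a b. - C \<le> \<phi> i w" "0 \<le> C" "0 \<le> k"
  shows "- C \<le> envelope a b \<phi> E C k z"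
  unfolding envelope_def using envelope_bdd[OF assms] by (intro cInf_greatest) auto

lemma envelope_le_bound:
  assumes "\<forall>i\<in>E. \<forall>w\<in>skorohod_space a b. - C \<le> \<phi> i w" "0 \<le> C" "0 \<le> k"
  shows "envelope a b \<phi> E C k z \<le> C"
  unfolding envelope_def by (intro cInf_lower bdd_belowI[of _ "- C"] envelope_bdd[OF assms]) auto

lemma envelope_le_ball:
  assumes "\<forall>i\<in>E. \<forall>w\<in>skorohod_space a b. - C \<le> \<phi> i w" "0 \<le> C" "0 \<le> k"
    and "i \<in> E" "0 < e" "w \<in> skorohod_ball a b z e"
  shows "envelope a b \<phi> E C k z \<le> \<phi> i w + k * e"
  unfolding envelope_def using assms(4-)
  by (intro cInf_lower bdd_belowI[of _ "- C"] envelope_bdd[OF assms(1-3)]) auto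

lemma envelope_le:
  assumes "\<forall>i\<in>E. \<forall>w\<in>skorohod_space a b. - C \<le> \<phi> i w" "0 \<le> C" "0 \<le> k"
    and "i \<in> E" "z \<in> skorohod_space a b"
  shows "envelope a b \<phi> E C k z \<le> \<phi> i z"
proof (rule field_le_epsilon)
  fix \<epsilon> :: real assume "0 < \<epsilon>"
  have "envelope a b \<phi> E C k z \<le> \<phi> i z + k * (\<epsilon> / (k + 1))"
    using assms \<open>0 < \<epsilon>\<close> by (intro envelope_le_ball skorohod_ball_self) auto
  also have "k * (\<epsilon> / (k + 1)) \<le> \<epsilon>"
    using \<open>0 < \<epsilon>\<close> \<open>0 \<le> k\<close> by (simp add: field_simps)
  finally show "envelope a b \<phi> E C k z \<le> \<phi> i z + \<epsilon>"
    by simp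
qed

text \<open>
  A competitor for \<open>z\<close> at cost \<open>e'\<close> is a competitor for \<open>z'\<close> at cost \<open>e + e'\<close>, since radii of
  Skorohod balls add up along a chain. As balls are symmetric, exchanging \<open>z\<close> and \<open>z'\<close> turns this
  one-sided bound into Lipschitz continuity.
\<close>

lemma envelope_Lipschitz:
  assumes bd: "\<forall>i\<in>E. \<forall>w\<in>skorohod_space a b. - C \<le> \<phi> i w" "0 \<le> C" "0 \<le> k"
    and z: "z \<in> skorohod_ball a b z' e" and "0 < e"
  shows "envelope a b \<phi> E C k z' \<le> envelope a b \<phi> E C k z + k * e"
proof -
  have "envelope a b \<phi> E C k z' - k * e \<le> y"
    if "y \<in> insert C {\<phi> i w + k * e | i w e. i \<in> E \<and> 0 < e \<and> w \<in> skorohod_ball a b z e}" for y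
    using that
  proof
    assume "y = C"
    then show ?thesis
      using envelope_le_bound[OF bd, of z'] \<open>0 \<le> k\<close> \<open>0 < e\<close> by (simp add: add_increasing2 diff_le_eq)
  next
    assume "y \<in> {\<phi> i w + k * e | i w e. i \<in> E \<and> 0 < e \<and> w \<in> skorohod_ball a b z e}"
    then obtain i w e' where y: "y = \<phi> i w + k * e'" "i \<in> E" "0 < e'" "w \<in> skorohod_ball a b z e'"
      by blast
    have "envelope a b \<phi> E C k z' \<le> \<phi> i w + k * (e + e')"
      using y \<open>0 < e\<close> by (intro envelope_le_ball[OF bd] skorohod_ball_trans[OF z]) auto
    then show ?thesis
      using y by (simp add: algebra_simps)
  qed
  then have "envelope a b \<phi> E C k z' - k * e \<le> envelope a b \<phi> E C k z"
    unfolding envelope_def[of a b \<phi> E C k z] by (intro cInf_greatest) auto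
  then show ?thesis by simp
qed

lemma continuous_map_envelope:
  assumes bd: "\<forall>i\<in>E. \<forall>w\<in>skorohod_space a b. - C \<le> \<phi> i w" "0 \<le> C" "0 \<le> k"
  shows "continuous_map (skorohod_topology a b) euclideanreal (envelope a b \<phi> E C k)"
proof (rule continuous_map_skorohodI)
  fix f and \<epsilon> :: real assume f: "f \<in> skorohod_space a b" and "0 < \<epsilon>"
  define e where "e = \<epsilon> / (k + 1)"
  have e: "0 < e" "k * e < \<epsilon>"
    using \<open>0 < \<epsilon>\<close> \<open>0 \<le> k\<close> by (auto simp: e_def field_simps)
  have "\<bar>envelope a b \<phi> E C k g - envelope a b \<phi> E C k f\<bar> < \<epsilon>" if g: "g \<in> skorohod_ball a b f e" for g
    using envelope_Lipschitz[OF bd g e(1)] envelope_Lipschitz[OF bd skorohod_ball_sym[OF g f] e(1)] e(2)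
    by linarith
  then show "\<exists>e>0. \<forall>g\<in>skorohod_ball a b f e. \<bar>envelope a b \<phi> E C k g - envelope a b \<phi> E C k f\<bar> < \<epsilon>"
    using e(1) by blast
qed

lemma bounded_envelope:
  assumes bd: "\<forall>i\<in>E. \<forall>w\<in>skorohod_space a b. - C \<le> \<phi> i w" "0 \<le> C" "0 \<le> k"
  shows "\<bar>envelope a b \<phi> E C k z\<bar> \<le> C"
  using envelope_ge[OF bd] envelope_le_bound[OF bd] by (simp add: abs_le_iff minus_le_iff)

text \<open>
  For open \<open>U\<close>, the envelope \<open>g\<close> of the indicator function of \<open>U\<close> is a continuous function that is
  positive exactly on \<open>U\<close>. Hence \<open>Y \<omega> \<in> U\<close> can be read off from the real number \<open>g (Y \<omega>)\<close>, which is a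
  limit of measurable functions of \<open>\<omega>\<close>.
\<close>

lemma measurable_skorohod_limit:
  assumes X: "\<And>n. X n \<in> N \<rightarrow>\<^sub>M skorohod_borel a b"
    and Y: "\<And>\<omega>. \<omega> \<in> space N \<Longrightarrow> Y \<omega> \<in> skorohod_space a b"
    and lim: "\<And>\<omega> e. \<omega> \<in> space N \<Longrightarrow> 0 < e \<Longrightarrow> \<forall>\<^sub>F n in sequentially. X n \<omega> \<in> skorohod_ball a b (Y \<omega>) e"
  shows "Y \<in> N \<rightarrow>\<^sub>M skorohod_borel a b"
  unfolding skorohod_borel_def
proof (rule measurable_measure_of)
  show "Y \<in> space N \<rightarrow> skorohod_space a b" using Y by blast
  fix U assume "U \<in> {U. openin (skorohod_topology a b) U}"
  then have U: "openin (skorohod_topology a b) U" by simp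
  define \<phi> where "\<phi> = (\<lambda>(_::unit) w. if w \<in> U then 1 else 0 :: real)"
  define g where "g = envelope a b \<phi> UNIV 1 1"
  have g: "continuous_map (skorohod_topology a b) euclideanreal g"
    unfolding g_def by (rule continuous_map_envelope) (auto simp: \<phi>_def)
  have gpos: "0 < g z \<longleftrightarrow> z \<in> U" if z: "z \<in> skorohod_space a b" for z
  proof
    assume "0 < g z"
    moreover have "g z \<le> \<phi> () z"
      unfolding g_def using z by (intro envelope_le) (auto simp: \<phi>_def)
    ultimately show "z \<in> U"
      by (auto simp: \<phi>_def split: if_splits)
  next
    assume "z \<in> U"
    then obtain e where e: "e > 0" "skorohod_ball a b z e \<subseteq> U"
      using U unfolding openin_skorohod by blast
    have "min e 1 \<le> g z"
      unfolding g_def envelope_def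
    proof (intro cInf_greatest)
      fix y assume "y \<in> insert 1 {\<phi> i w + 1 * e |i w e. i \<in> UNIV \<and> 0 < e \<and> w \<in> skorohod_ball a b z e}"
      then consider "y = 1" | i w e' where "y = \<phi> i w + e'" "0 < e'" "w \<in> skorohod_ball a b z e'"
        by auto
      then show "min e 1 \<le> y"
      proof cases
        case 2
        then show ?thesis
          using e skorohod_ball_mono[of e' e a b z] by (cases "e' \<le> e") (auto simp: \<phi>_def)
      qed simp
    qed simp
    then show "0 < g z"
      using e(1) by linarith
  qed
  have "(\<lambda>\<omega>. g (Y \<omega>)) \<in> borel_measurable N"
  proof (rule borel_measurable_LIMSEQ_real)
    show "(\<lambda>\<omega>. g (X n \<omega>)) \<in> borel_measurable N" for n
      using measurable_compose[OF X borel_measurable_skorohod_continuous[OF g]] by simp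
    fix \<omega> assume \<omega>: "\<omega> \<in> space N"
    show "(\<lambda>n. g (X n \<omega>)) \<longlonglongrightarrow> g (Y \<omega>)"
    proof (rule tendstoI)
      fix \<epsilon> :: real assume "0 < \<epsilon>"
      then obtain e where "e > 0" "\<forall>w\<in>skorohod_ball a b (Y \<omega>) e. \<bar>g w - g (Y \<omega>)\<bar> < \<epsilon>"
        using continuous_map_skorohodD[OF g Y[OF \<omega>]] by blast
      with lim[OF \<omega>, of e] show "\<forall>\<^sub>F n in sequentially. dist (g (X n \<omega>)) (g (Y \<omega>)) < \<epsilon>"
        by (auto elim!: eventually_mono simp: dist_real_def)
    qed
  qed
  then have "{\<omega> \<in> space N. 0 < g (Y \<omega>)} \<in> sets N"
    by measurable
  moreover have "Y -` U \<inter> space N = {\<omega> \<in> space N. 0 < g (Y \<omega>)}"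
    using gpos Y by auto
  ultimately show "Y -` U \<inter> space N \<in> sets N" by simp
qed (auto simp: openin_skorohod)

text \<open>
  Let \<open>g k\<close> be the envelope with slope \<open>k\<close> of the functionals \<open>\<phi> n\<close> with \<open>k \<le> sz n\<close>. It is a bounded
  continuous test function, and it lies below \<open>\<phi> n\<close> for those \<open>n\<close>; so the expectation of \<open>g k (Z0 \<omega>)\<close>
  is an asymptotic lower bound for the expectation of \<open>W n\<close>. A competitor at distance more than
  \<open>2 * C / k\<close> from \<open>Z0 \<omega>\<close> pays more than it can gain, and one that is closer has a value near \<open>W0 \<omega>\<close>
  by the limit hypothesis. Therefore \<open>min (W0 \<omega>) (g k (Z0 \<omega>))\<close> tends to \<open>W0 \<omega>\<close>, and dominated
  convergence concludes.

  The variables \<open>W n\<close> are kept separate from \<open>\<phi> n (Z n \<omega>)\<close> because the functionals \<open>\<phi> n\<close> carry no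
  measurability.
\<close>

lemma weak_limit_lower_bound:
  fixes sz :: "'i \<Rightarrow> nat" and W :: "'i \<Rightarrow> 'a \<Rightarrow> real" and W0 :: "'b \<Rightarrow> real" and Z :: "'i \<Rightarrow> 'a \<Rightarrow> real ^ 'q \<Rightarrow> real"
  defines "F \<equiv> filtercomap sz at_top"
  assumes M: "prob_space M" and N: "prob_space N"
    and Z: "\<And>n. Z n \<in> M \<rightarrow>\<^sub>M skorohod_borel a b" and Z0: "Z0 \<in> N \<rightarrow>\<^sub>M skorohod_borel a b"
    and weak: "\<And>h. continuous_map (skorohod_topology a b) euclideanreal h \<Longrightarrow>
                 bounded (h ` skorohod_space a b) \<Longrightarrow>
                 ((\<lambda>n. \<integral>\<omega>. h (Z n \<omega>) \<partial>M) \<longlongrightarrow> (\<integral>\<omega>. h (Z0 \<omega>) \<partial>N)) F"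
    and W: "\<And>n. W n \<in> borel_measurable M" and W0: "W0 \<in> borel_measurable N"
    and bd: "\<And>n \<omega>. \<bar>W n \<omega>\<bar> \<le> C" "\<And>\<omega>. \<bar>W0 \<omega>\<bar> \<le> C" "\<And>n w. \<bar>\<phi> n w\<bar> \<le> C"
    and eq: "\<And>n. AE \<omega> in M. W n \<omega> = \<phi> n (Z n \<omega>)"
    and lim: "AE \<omega> in N. \<forall>\<epsilon>>0. \<exists>d>0. \<exists>k. \<forall>n. k \<le> sz n \<longrightarrow>
                (\<forall>w\<in>skorohod_ball a b (Z0 \<omega>) d. W0 \<omega> - \<epsilon> < \<phi> n w)"
    and "0 < \<epsilon>"
  shows "\<forall>\<^sub>F n in F. (\<integral>\<omega>. W0 \<omega> \<partial>N) - \<epsilon> < (\<integral>\<omega>. W n \<omega> \<partial>M)"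
proof -
  interpret M: prob_space M by fact
  interpret N: prob_space N by fact
  have C: "0 \<le> C" using bd(2)[of undefined] by linarith
  define g where "g k = envelope a b \<phi> {n. k \<le> sz n} C (real k)" for k
  have pb: "\<forall>i\<in>{n. k \<le> sz n}. \<forall>w\<in>skorohod_space a b. - C \<le> \<phi> i w" for k
    using bd(3) by (meson abs_le_D2 minus_le_iff)
  have g: "continuous_map (skorohod_topology a b) euclideanreal (g k)" for k
    unfolding g_def using C by (intro continuous_map_envelope pb) auto
  have gC: "\<bar>g k z\<bar> \<le> C" for k z
    unfolding g_def using C by (intro bounded_envelope pb) auto
  have mg: "(\<lambda>\<omega>. g k (Z n \<omega>)) \<in> borel_measurable M" "(\<lambda>\<omega>. g k (Z0 \<omega>)) \<in> borel_measurable N" for k n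
    using measurable_compose[OF Z borel_measurable_skorohod_continuous[OF g]]
      measurable_compose[OF Z0 borel_measurable_skorohod_continuous[OF g]] by simp_all
  \<comment> \<open>The minimum with \<open>W0\<close> makes a pointwise limit out of a pointwise asymptotic lower bound.\<close>
  have "(\<lambda>k. \<integral>\<omega>. min (W0 \<omega>) (g k (Z0 \<omega>)) \<partial>N) \<longlonglongrightarrow> (\<integral>\<omega>. W0 \<omega> \<partial>N)"
  proof (rule integral_dominated_convergence)
    show "AE \<omega> in N. (\<lambda>k. min (W0 \<omega>) (g k (Z0 \<omega>))) \<longlonglongrightarrow> W0 \<omega>"
      using lim
    proof eventually_elim
      case (elim \<omega>)
      show ?case
      proof (rule tendstoI)
        fix e :: real assume "0 < e"
        then obtain d k0 where d: "d > 0"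
          "\<And>n w. k0 \<le> sz n \<Longrightarrow> w \<in> skorohod_ball a b (Z0 \<omega>) d \<Longrightarrow> W0 \<omega> - e / 2 < \<phi> n w"
          using elim[rule_format, of "e / 2"] by auto
        \<comment> \<open>Beyond distance \<open>d\<close> the penalty exceeds the oscillation \<open>2 * C\<close> of the functionals.\<close>
        obtain k1 where k1: "2 * C < real k1 * d"
          using reals_Archimedean3[OF d(1)] by blast
        have "W0 \<omega> - e / 2 \<le> g k (Z0 \<omega>)" if k: "k \<ge> max k0 k1" for k
          unfolding g_def envelope_def
        proof (intro cInf_greatest)
          fix y assume "y \<in> insert C {\<phi> n w + real k * e | n w e. n \<in> {n. k \<le> sz n} \<and> 0 < e \<and> w \<in> skorohod_ball a b (Z0 \<omega>) e}"
          then consider "y = C" | n w e' where "y = \<phi> n w + real k * e'" "k \<le> sz n" "0 < e'"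
              "w \<in> skorohod_ball a b (Z0 \<omega>) e'"
            by auto
          then show "W0 \<omega> - e / 2 \<le> y"
          proof cases
            case 1
            then show ?thesis using bd(2)[of \<omega>] \<open>0 < e\<close> by linarith
          next
            case 2
            show ?thesis
            proof (cases "e' \<le> d")
              case True
              then have "w \<in> skorohod_ball a b (Z0 \<omega>) d"
                using 2(4) skorohod_ball_mono by blast
              then have "W0 \<omega> - e / 2 < \<phi> n w"
                using d(2) k 2(2) by auto
              then show ?thesis
                using 2(1,3) by (simp add: add_increasing2 less_imp_le)
            next
              case False
              have "real k1 * d \<le> real k * e'"
                using False k d(1) by (intro mult_mono) auto
              then show ?thesis
                using 2(1) k1 bd(3)[of n w] bd(2)[of \<omega>] \<open>0 < e\<close> by linarith
            qed
          qed
        qed simp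
        then have "\<forall>k\<ge>max k0 k1. dist (min (W0 \<omega>) (g k (Z0 \<omega>))) (W0 \<omega>) < e"
          using \<open>0 < e\<close> by (fastforce simp: dist_real_def min_def)
        then show "\<forall>\<^sub>F k in sequentially. dist (min (W0 \<omega>) (g k (Z0 \<omega>))) (W0 \<omega>) < e"
          unfolding eventually_sequentially by blast
      qed
    qed
    show "AE \<omega> in N. norm (min (W0 \<omega>) (g k (Z0 \<omega>))) \<le> C" for k
    proof (rule AE_I2)
      fix \<omega> show "norm (min (W0 \<omega>) (g k (Z0 \<omega>))) \<le> C"
        using bd(2)[of \<omega>] gC[of k "Z0 \<omega>"] by (simp add: min_def)
    qed
  qed (use W0 mg in auto)
  then have "\<forall>\<^sub>F k in sequentially. (\<integral>\<omega>. W0 \<omega> \<partial>N) - \<epsilon> / 2 < (\<integral>\<omega>. min (W0 \<omega>) (g k (Z0 \<omega>)) \<partial>N)"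
    using \<open>0 < \<epsilon>\<close> by (intro order_tendstoD(1)) auto
  then obtain k where k: "(\<integral>\<omega>. W0 \<omega> \<partial>N) - \<epsilon> / 2 < (\<integral>\<omega>. min (W0 \<omega>) (g k (Z0 \<omega>)) \<partial>N)"
    unfolding eventually_sequentially by blast
  also have "\<dots> \<le> (\<integral>\<omega>. g k (Z0 \<omega>) \<partial>N)"
  proof (rule integral_mono)
    show "integrable N (\<lambda>\<omega>. min (W0 \<omega>) (g k (Z0 \<omega>)))"
    proof (rule N.integrable_const_bound[where B = C])
      show "AE \<omega> in N. norm (min (W0 \<omega>) (g k (Z0 \<omega>))) \<le> C"
      proof (rule AE_I2)
        fix \<omega> show "norm (min (W0 \<omega>) (g k (Z0 \<omega>))) \<le> C"
          using bd(2)[of \<omega>] gC[of k "Z0 \<omega>"] by (simp add: min_def)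
      qed
    qed (use W0 mg in auto)
    show "integrable N (\<lambda>\<omega>. g k (Z0 \<omega>))"
      by (rule N.integrable_const_bound[where B = C]) (use gC mg in auto)
  qed simp
  finally have lower: "(\<integral>\<omega>. W0 \<omega> \<partial>N) - \<epsilon> / 2 < (\<integral>\<omega>. g k (Z0 \<omega>) \<partial>N)" .
  have "bounded (g k ` skorohod_space a b)"
    using gC by (auto simp: bounded_iff)
  then have "((\<lambda>n. \<integral>\<omega>. g k (Z n \<omega>) \<partial>M) \<longlongrightarrow> (\<integral>\<omega>. g k (Z0 \<omega>) \<partial>N)) F"
    using weak g by blast
  then have "\<forall>\<^sub>F n in F. (\<integral>\<omega>. g k (Z0 \<omega>) \<partial>N) - \<epsilon> / 2 < (\<integral>\<omega>. g k (Z n \<omega>) \<partial>M)"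
    using \<open>0 < \<epsilon>\<close> by (intro order_tendstoD(1)) auto
  moreover have "\<forall>\<^sub>F n in F. k \<le> sz n"
    unfolding F_def by (intro eventually_filtercomapI eventually_ge_at_top)
  ultimately show ?thesis
  proof eventually_elim
    case (elim n)
    have "(\<integral>\<omega>. g k (Z n \<omega>) \<partial>M) \<le> (\<integral>\<omega>. W n \<omega> \<partial>M)"
    proof (rule integral_mono_AE)
      show "integrable M (\<lambda>\<omega>. g k (Z n \<omega>))"
        by (rule M.integrable_const_bound[where B = C]) (use gC mg in auto)
      show "integrable M (W n)"
        by (rule M.integrable_const_bound[where B = C]) (use bd W in auto)
      have Zsp: "Z n \<omega> \<in> skorohod_space a b" if "\<omega> \<in> space M" for \<omega>
        using measurable_space[OF Z that] by simp
      show "AE \<omega> in M. g k (Z n \<omega>) \<le> W n \<omega>"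
        using eq[of n] AE_space[of M]
      proof eventually_elim
        case (elim \<omega>)
        show ?case
          unfolding g_def elim(1) using C \<open>k \<le> sz n\<close> Zsp[OF elim(2)] by (intro envelope_le pb) auto
      qed
    qed
    then show ?case
      using lower elim(1) by linarith
  qed
qed

text \<open>
  The lower bound above, applied to \<open>\<phi>\<close> and to \<open>- \<phi>\<close>. This form of the continuous mapping theorem is
  made for functionals that change with \<open>n\<close> and are discontinuous on the Skorohod space, but converge
  along every sequence of paths that tends to a typical path of the limit.
\<close>

theorem extended_continuous_mapping:
  fixes sz :: "'i \<Rightarrow> nat" and W :: "'i \<Rightarrow> 'a \<Rightarrow> real" and W0 :: "'b \<Rightarrow> real" and Z :: "'i \<Rightarrow> 'a \<Rightarrow> real ^ 'q \<Rightarrow> real"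
  assumes M: "prob_space M" and N: "prob_space N"
    and Z: "\<And>n. Z n \<in> M \<rightarrow>\<^sub>M skorohod_borel a b" and Z0: "Z0 \<in> N \<rightarrow>\<^sub>M skorohod_borel a b"
    and weak: "\<And>h. continuous_map (skorohod_topology a b) euclideanreal h \<Longrightarrow>
                 bounded (h ` skorohod_space a b) \<Longrightarrow>
                 ((\<lambda>n. \<integral>\<omega>. h (Z n \<omega>) \<partial>M) \<longlongrightarrow> (\<integral>\<omega>. h (Z0 \<omega>) \<partial>N)) (filtercomap sz at_top)"
    and W: "\<And>n. W n \<in> borel_measurable M" and W0: "W0 \<in> borel_measurable N"
    and bd: "\<And>n \<omega>. \<bar>W n \<omega>\<bar> \<le> C" "\<And>\<omega>. \<bar>W0 \<omega>\<bar> \<le> C" "\<And>n w. \<bar>\<phi> n w\<bar> \<le> C"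
    and eq: "\<And>n. AE \<omega> in M. W n \<omega> = \<phi> n (Z n \<omega>)"
    and lim: "AE \<omega> in N. \<forall>\<epsilon>>0. \<exists>d>0. \<exists>k. \<forall>n. k \<le> sz n \<longrightarrow>
                (\<forall>w\<in>skorohod_ball a b (Z0 \<omega>) d. \<bar>\<phi> n w - W0 \<omega>\<bar> < \<epsilon>)"
  shows "((\<lambda>n. \<integral>\<omega>. W n \<omega> \<partial>M) \<longlongrightarrow> (\<integral>\<omega>. W0 \<omega> \<partial>N)) (filtercomap sz at_top)"
proof (rule tendstoI)
  fix \<epsilon> :: real assume \<epsilon>: "0 < \<epsilon>"
  have "\<forall>\<^sub>F n in filtercomap sz at_top. (\<integral>\<omega>. W0 \<omega> \<partial>N) - \<epsilon> < (\<integral>\<omega>. W n \<omega> \<partial>M)"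
  proof (rule weak_limit_lower_bound[where W = W and \<phi> = \<phi> and C = C, OF M N Z Z0 weak W W0 bd eq _ \<epsilon>])
    show "AE \<omega> in N. \<forall>\<epsilon>>0. \<exists>d>0. \<exists>k. \<forall>n. k \<le> sz n \<longrightarrow>
            (\<forall>w\<in>skorohod_ball a b (Z0 \<omega>) d. W0 \<omega> - \<epsilon> < \<phi> n w)"
      using lim
    proof eventually_elim
      case (elim \<omega>)
      show ?case
      proof (intro allI impI)
        fix \<epsilon> :: real assume "0 < \<epsilon>"
        then obtain d k where d: "0 < d"
          "\<And>n w. k \<le> sz n \<Longrightarrow> w \<in> skorohod_ball a b (Z0 \<omega>) d \<Longrightarrow> \<bar>\<phi> n w - W0 \<omega>\<bar> < \<epsilon>"
          using elim by meson
        then have "\<And>n w. k \<le> sz n \<Longrightarrow> w \<in> skorohod_ball a b (Z0 \<omega>) d \<Longrightarrow> W0 \<omega> - \<epsilon> < \<phi> n w"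
          by (smt (verit))
        then show "\<exists>d>0. \<exists>k. \<forall>n. k \<le> sz n \<longrightarrow> (\<forall>w\<in>skorohod_ball a b (Z0 \<omega>) d. W0 \<omega> - \<epsilon> < \<phi> n w)"
          using d(1) by blast
      qed
    qed
  qed
  moreover have "\<forall>\<^sub>F n in filtercomap sz at_top. (\<integral>\<omega>. - W0 \<omega> \<partial>N) - \<epsilon> < (\<integral>\<omega>. - W n \<omega> \<partial>M)"
  proof (rule weak_limit_lower_bound[where W = "\<lambda>n \<omega>. - W n \<omega>" and \<phi> = "\<lambda>n w. - \<phi> n w" and C = C,
          OF M N Z Z0 weak _ _ _ _ _ _ _ \<epsilon>])
    show "AE \<omega> in N. \<forall>\<epsilon>>0. \<exists>d>0. \<exists>k. \<forall>n. k \<le> sz n \<longrightarrow>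
            (\<forall>w\<in>skorohod_ball a b (Z0 \<omega>) d. - W0 \<omega> - \<epsilon> < - \<phi> n w)"
      using lim
    proof eventually_elim
      case (elim \<omega>)
      show ?case
      proof (intro allI impI)
        fix \<epsilon> :: real assume "0 < \<epsilon>"
        then obtain d k where d: "0 < d"
          "\<And>n w. k \<le> sz n \<Longrightarrow> w \<in> skorohod_ball a b (Z0 \<omega>) d \<Longrightarrow> \<bar>\<phi> n w - W0 \<omega>\<bar> < \<epsilon>"
          using elim by meson
        then have "\<And>n w. k \<le> sz n \<Longrightarrow> w \<in> skorohod_ball a b (Z0 \<omega>) d \<Longrightarrow> - W0 \<omega> - \<epsilon> < - \<phi> n w"
          by (smt (verit))
        then show "\<exists>d>0. \<exists>k. \<forall>n. k \<le> sz n \<longrightarrow> (\<forall>w\<in>skorohod_ball a b (Z0 \<omega>) d. - W0 \<omega> - \<epsilon> < - \<phi> n w)"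
          using d(1) by blast
      qed
    qed
  qed (use W W0 bd eq in auto)
  ultimately show "\<forall>\<^sub>F n in filtercomap sz at_top. dist (\<integral>\<omega>. W n \<omega> \<partial>M) (\<integral>\<omega>. W0 \<omega> \<partial>N) < \<epsilon>"
    by eventually_elim (simp add: dist_real_def)
qed

section \<open>Riemann--Stieltjes sums over product grids\<close>

text \<open>
  The interval is half-open so that the half-open cells of a partition cover it exactly once.
\<close>

abbreviation unif01 :: "real measure" where
  "unif01 \<equiv> restrict_space lborel {0..<1}"

lemma prob_space_unif01: "prob_space unif01"
  by (intro prob_space_restrict_space) auto

lemma product_sigma_finite_unif01: "product_sigma_finite (\<lambda>_. unif01)"
  by (simp add: product_sigma_finite_def prob_space_imp_sigma_finite prob_space_unif01)

lemma prob_space_PiM_unif01: "prob_space (Pi\<^sub>M v (\<lambda>_. unif01))"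
  by (intro prob_space_PiM prob_space_unif01)

lemma space_PiM_unif01: "u \<in> space (Pi\<^sub>M v (\<lambda>_. unif01)) \<Longrightarrow> p \<in> v \<Longrightarrow> 0 \<le> u p \<and> u p < 1"
  by (auto simp: space_PiM space_restrict_space dest: PiE_mem)

lemma measurable_component_unif01:
  "p \<in> v \<Longrightarrow> (\<lambda>u. u p) \<in> borel_measurable (Pi\<^sub>M v (\<lambda>_. unif01))"
  using measurable_comp[OF measurable_component_singleton[of p v "\<lambda>_. unif01"],
      of "\<lambda>x. x" borel] by (simp add: o_def measurable_restrict_space1)

lemma has_integral_cell:
  fixes g g' :: "real \<Rightarrow> real"
  assumes "0 \<le> s" "s \<le> t" "t \<le> 1"
    and g: "\<And>x. x \<in> {0..1} \<Longrightarrow> (g has_real_derivative g' x) (at x within {0..1})"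
    and c: "continuous_on {0..1} g'"
  shows "integrable unif01 (\<lambda>x. indicator {s..<t} x * g' x)"
    and "(\<integral>x. indicator {s..<t} x * g' x \<partial>unif01) = g t - g s"
proof -
  have c': "continuous_on {s..t} g'"
    using assms(1,3) by (intro continuous_on_subset[OF c]) auto
  have FTC: "has_bochner_integral lborel (\<lambda>x. indicator {s..t} x *\<^sub>R g' x) (g t - g s)"
  proof (rule has_bochner_integral_FTC_Icc[OF assms(2) _ c'])
    fix x assume "s \<le> x" "x \<le> t"
    then have "(g has_real_derivative g' x) (at x within {s..t})"
      using assms(1,3) by (intro DERIV_subset[OF g]) auto
    then show "(g has_vector_derivative g' x) (at x within {s..t})"
      by (simp add: has_real_derivative_iff_has_vector_derivative)
  qed
  have eq: "AE x in lborel. indicator {0..<1} x *\<^sub>R (indicator {s..<t} x * g' x) = indicator {s..t} x *\<^sub>R g' x"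
    using AE_lborel_singleton[of t]
    by eventually_elim (use assms(1-3) in \<open>auto simp: indicator_def\<close>)
  have m: "(\<lambda>x. indicator {s..t} x *\<^sub>R g' x) \<in> borel_measurable borel"
    using borel_measurable_continuous_on_indicator[OF _ c'] by simp
  have "(\<lambda>x. indicator {s..<t} x * (indicator {s..t} x *\<^sub>R g' x)) \<in> borel_measurable borel"
    using m by measurable
  moreover have "(\<lambda>x. indicator {0..<1} x *\<^sub>R (indicator {s..<t} x * g' x)) = (\<lambda>x. indicator {s..<t} x * (indicator {s..t} x *\<^sub>R g' x))"
    using assms(1-3) by (auto simp: indicator_def fun_eq_iff)
  ultimately have m2: "(\<lambda>x. indicator {0..<1} x *\<^sub>R (indicator {s..<t} x * g' x)) \<in> borel_measurable lborel"
    by simp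
  have hb: "has_bochner_integral lborel (\<lambda>x. indicator {0..<1} x *\<^sub>R (indicator {s..<t} x * g' x)) (g t - g s)"
    using has_bochner_integral_cong_AE[OF m2 _ eq] FTC m by simp
  then show "integrable unif01 (\<lambda>x. indicator {s..<t} x * g' x)"
    by (subst integrable_restrict_space) (auto simp: has_bochner_integral_iff)
  show "(\<integral>x. indicator {s..<t} x * g' x \<partial>unif01) = g t - g s"
    using hb by (subst integral_restrict_space) (auto simp: has_bochner_integral_iff)
qed

lemma cells_partition_unit:
  fixes y :: "nat \<Rightarrow> real"
  assumes "y 0 = 0" "y m = 1" "\<And>i. i < m \<Longrightarrow> y i \<le> y (Suc i)" and "0 \<le> x" "x < 1"
  shows "(\<Sum>i<m. indicator {y i..<y (Suc i)} x) = (1::real)"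
proof -
  have "(\<Sum>i<m. indicator {y i..<y (Suc i)} x) = (\<Sum>i<m. indicator {y i..} x - indicator {y (Suc i)..} x :: real)"
    using assms(3) by (intro sum.cong) (fastforce simp: indicator_def)+
  also have "\<dots> = indicator {y 0..} x - indicator {y m..} x"
    by (rule sum_lessThan_telescope')
  finally show ?thesis
    using assms by (simp add: indicator_def)
qed

lemma cells_ordered:
  fixes y :: "nat \<Rightarrow> real"
  assumes "y 0 = 0" "y m = 1" "\<And>i. i < m \<Longrightarrow> y i \<le> y (Suc i)" and "i < m"
  shows "0 \<le> y i" "y (Suc i) \<le> 1"
proof -
  have mono: "y i \<le> y j" if "i \<le> j" "j \<le> m" for i j
    using that assms(3) by (induction j) (auto simp: le_Suc_eq intro: order_trans)
  show "0 \<le> y i" "y (Suc i) \<le> 1"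
    using mono[of 0 i] mono[of "Suc i" m] assms(1,2,4) by auto
qed

text \<open>
  Each increment \<open>g p (y p (Suc (k p))) - g p (y p (k p))\<close> is the integral of \<open>g' p\<close> over an interval,
  so by Fubini the weight of a cell is the integral of the product density over that cell. Since the
  cells partition the cube, the difference of the sum and the integral is the integral of the product
  density times \<open>a k - H u\<close>, where \<open>k\<close> is the cell of \<open>u\<close>, and this factor is at most \<open>\<delta>\<close>.
\<close>

lemma Riemann_Stieltjes_sum_estimate:
  fixes g g' :: "'q \<Rightarrow> real \<Rightarrow> real" and y :: "'q \<Rightarrow> nat \<Rightarrow> real" and a :: "('q \<Rightarrow> nat) \<Rightarrow> real"
  assumes v: "finite v"
    and y: "\<And>p. p \<in> v \<Longrightarrow> y p 0 = 0" "\<And>p. p \<in> v \<Longrightarrow> y p (m p) = 1"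
      "\<And>p i. p \<in> v \<Longrightarrow> i < m p \<Longrightarrow> y p i \<le> y p (Suc i)"
    and g: "\<And>p x. p \<in> v \<Longrightarrow> x \<in> {0..1} \<Longrightarrow> (g p has_real_derivative g' p x) (at x within {0..1})"
    and c: "\<And>p. p \<in> v \<Longrightarrow> continuous_on {0..1} (g' p)"
    and K: "\<And>p x. p \<in> v \<Longrightarrow> x \<in> {0..1} \<Longrightarrow> \<bar>g' p x\<bar> \<le> K p"
    and H: "H \<in> borel_measurable (Pi\<^sub>M v (\<lambda>_. unif01))"
    and close: "\<And>k u. k \<in> (\<Pi>\<^sub>E p\<in>v. {..<m p}) \<Longrightarrow> u \<in> space (Pi\<^sub>M v (\<lambda>_. unif01)) \<Longrightarrow>
                  (\<And>p. p \<in> v \<Longrightarrow> y p (k p) \<le> u p \<and> u p \<le> y p (Suc (k p))) \<Longrightarrow> \<bar>a k - H u\<bar> \<le> \<delta>"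
    and C: "\<And>u. u \<in> space (Pi\<^sub>M v (\<lambda>_. unif01)) \<Longrightarrow> \<bar>H u\<bar> \<le> C"
    and "0 \<le> \<delta>"
  shows "\<bar>(\<Sum>k\<in>(\<Pi>\<^sub>E p\<in>v. {..<m p}). a k * (\<Prod>p\<in>v. g p (y p (Suc (k p))) - g p (y p (k p))))
            - (\<integral>u. H u * (\<Prod>p\<in>v. g' p (u p)) \<partial>Pi\<^sub>M v (\<lambda>_. unif01))\<bar> \<le> \<delta> * (\<Prod>p\<in>v. K p)"
proof -
  let ?U = "Pi\<^sub>M v (\<lambda>_. unif01)"
  let ?I = "\<Pi>\<^sub>E p\<in>v. {..<m p}"
  interpret U: prob_space ?U by (rule prob_space_PiM_unif01)
  interpret product_sigma_finite "\<lambda>_::'q. unif01" by (rule product_sigma_finite_unif01)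
  have fI: "finite ?I" using v by (intro finite_PiE) auto
  define cell where "cell k u = (\<Prod>p\<in>v. indicator {y p (k p)..<y p (Suc (k p))} (u p) :: real)" for k u
  have cells: "(\<Sum>k\<in>?I. cell k u) = 1" if u: "u \<in> space ?U" for u
  proof -
    have "(\<Sum>k\<in>?I. cell k u) = (\<Prod>p\<in>v. \<Sum>i<m p. indicator {y p i..<y p (Suc i)} (u p))"
      unfolding cell_def using v by (subst prod_sum_PiE) auto
    also have "\<dots> = (\<Prod>p\<in>v. 1)"
      using y space_PiM_unif01[OF u] by (intro prod.cong cells_partition_unit) auto
    finally show ?thesis by simp
  qed
  have km: "k p < m p" if "k \<in> ?I" "p \<in> v" for k p
    using that by (auto dest: PiE_mem)
  have ord: "0 \<le> y p (k p)" "y p (k p) \<le> y p (Suc (k p))" "y p (Suc (k p)) \<le> 1"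
    if "k \<in> ?I" "p \<in> v" for k p
    using cells_ordered[of "y p" "m p" "k p"] y that km[OF that] by auto
  have D: "integrable ?U (\<lambda>u. cell k u * (\<Prod>p\<in>v. g' p (u p)))"
      "(\<integral>u. cell k u * (\<Prod>p\<in>v. g' p (u p)) \<partial>?U) = (\<Prod>p\<in>v. g p (y p (Suc (k p))) - g p (y p (k p)))"
    if k: "k \<in> ?I" for k
    unfolding cell_def prod.distrib[symmetric]
     apply (intro product_integrable_prod v has_integral_cell[OF ord[OF k] g c]; assumption)
    apply (subst product_integral_prod[OF v])
    apply (intro has_integral_cell[OF ord[OF k] g c]; assumption)
    apply (intro prod.cong refl has_integral_cell[OF ord[OF k] g c]; assumption)
    done
  have prodK: "\<bar>\<Prod>p\<in>v. g' p (u p)\<bar> \<le> (\<Prod>p\<in>v. K p)" if u: "u \<in> space ?U" for u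
    unfolding abs_prod using space_PiM_unif01[OF u] by (intro prod_mono conjI K) (auto simp: less_imp_le)
  have mg: "(\<lambda>u. \<Prod>p\<in>v. g' p (u p)) \<in> borel_measurable ?U"
  proof (intro borel_measurable_prod)
    fix p assume p: "p \<in> v"
    have "g' p \<in> borel_measurable unif01"
      by (subst measurable_cong_sets[OF _ refl, of _ "restrict_space borel {0..<1}"])
        (auto intro!: sets_restrict_space_cong borel_measurable_continuous_on_restrict
          continuous_on_subset[OF c[OF p]])
    then show "(\<lambda>u. g' p (u p)) \<in> borel_measurable ?U"
      by (intro measurable_compose[OF measurable_component_singleton[OF p]])
  qed
  have intH: "integrable ?U (\<lambda>u. H u * (\<Prod>p\<in>v. g' p (u p)))"
  proof (rule U.integrable_const_bound[where B = "C * (\<Prod>p\<in>v. K p)"])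
    show "AE u in ?U. norm (H u * (\<Prod>p\<in>v. g' p (u p))) \<le> C * (\<Prod>p\<in>v. K p)"
    proof (rule AE_I2)
      fix u assume u: "u \<in> space ?U"
      then show "norm (H u * (\<Prod>p\<in>v. g' p (u p))) \<le> C * (\<Prod>p\<in>v. K p)"
        unfolding real_norm_def abs_mult
        by (intro mult_mono C prodK order_trans[OF _ C[OF u]]) auto
    qed
  qed (use H mg in measurable)
  have intS: "integrable ?U (\<lambda>u. \<Sum>k\<in>?I. a k * (cell k u * (\<Prod>p\<in>v. g' p (u p))))"
    using D by (intro Bochner_Integration.integrable_sum integrable_mult_right) auto
  have "(\<Sum>k\<in>?I. a k * (\<Prod>p\<in>v. g p (y p (Suc (k p))) - g p (y p (k p))))
      = (\<integral>u. (\<Sum>k\<in>?I. a k * (cell k u * (\<Prod>p\<in>v. g' p (u p)))) \<partial>?U)"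
    using D by (subst Bochner_Integration.integral_sum) (auto intro!: sum.cong)
  then have "(\<Sum>k\<in>?I. a k * (\<Prod>p\<in>v. g p (y p (Suc (k p))) - g p (y p (k p))))
       - (\<integral>u. H u * (\<Prod>p\<in>v. g' p (u p)) \<partial>?U)
      = (\<integral>u. (\<Sum>k\<in>?I. a k * (cell k u * (\<Prod>p\<in>v. g' p (u p)))) - H u * (\<Prod>p\<in>v. g' p (u p)) \<partial>?U)"
    using intS intH by (simp add: Bochner_Integration.integral_diff)
  also have "\<bar>\<dots>\<bar> \<le> (\<integral>u. \<delta> * (\<Prod>p\<in>v. K p) \<partial>?U)"
  proof (rule order_trans[OF integral_abs_bound], rule integral_mono)
    fix u assume u: "u \<in> space ?U"
    have "(\<Sum>k\<in>?I. a k * (cell k u * (\<Prod>p\<in>v. g' p (u p)))) - H u * (\<Prod>p\<in>v. g' p (u p))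
        = (\<Sum>k\<in>?I. (a k - H u) * cell k u) * (\<Prod>p\<in>v. g' p (u p))"
    proof -
      have "(\<Sum>k\<in>?I. (a k - H u) * cell k u) = (\<Sum>k\<in>?I. a k * cell k u) - H u * (\<Sum>k\<in>?I. cell k u)"
        by (simp add: left_diff_distrib sum_subtractf sum_distrib_left)
      then show ?thesis
        using cells[OF u] by (simp add: left_diff_distrib sum_distrib_right mult.assoc)
    qed
    moreover have "\<bar>\<Sum>k\<in>?I. (a k - H u) * cell k u\<bar> \<le> (\<Sum>k\<in>?I. \<delta> * cell k u)"
    proof (rule order_trans[OF sum_abs sum_mono])
      fix k assume k: "k \<in> ?I"
      have c0: "0 \<le> cell k u"
        unfolding cell_def by (intro prod_nonneg) auto
      show "\<bar>(a k - H u) * cell k u\<bar> \<le> \<delta> * cell k u"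
      proof (cases "cell k u = 0")
        case False
        then have "y p (k p) \<le> u p \<and> u p \<le> y p (Suc (k p))" if "p \<in> v" for p
          unfolding cell_def using v that by (fastforce simp: indicator_def)
        then show ?thesis
          using close[OF k u] c0 by (simp add: abs_mult mult_right_mono)
      qed simp
    qed
    ultimately show "\<bar>(\<Sum>k\<in>?I. a k * (cell k u * (\<Prod>p\<in>v. g' p (u p)))) - H u * (\<Prod>p\<in>v. g' p (u p))\<bar>
        \<le> \<delta> * (\<Prod>p\<in>v. K p)"
      using cells[OF u] prodK[OF u] \<open>0 \<le> \<delta>\<close>
      by (simp add: abs_mult sum_distrib_left[symmetric] mult_mono)
  qed (use intS intH in auto)
  also have "\<dots> = \<delta> * (\<Prod>p\<in>v. K p)"
    using U.prob_space by simp
  finally show ?thesis .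
qed

section \<open>Summation by parts and alternating sums\<close>

text \<open>
  The weights whose tail sums are the values of \<open>g\<close>: beginning at \<open>l\<close>, they telescope to \<open>g l\<close>.
\<close>

definition Abel_weight :: "nat \<Rightarrow> (nat \<Rightarrow> real) \<Rightarrow> nat \<Rightarrow> real" where
  "Abel_weight m g k = (if k < m then g k - g (Suc k) else g m)"

lemma sum_Abel_weight: "l \<le> m \<Longrightarrow> (\<Sum>k=l..m. Abel_weight m g k) = g l"
proof -
  assume "l \<le> m"
  then have "{l..m} = insert m {l..<m}" by auto
  then have "(\<Sum>k=l..m. Abel_weight m g k) = g m + (\<Sum>k=l..<m. g k - g (Suc k))"
    by (simp add: Abel_weight_def)
  also have "(\<Sum>k=l..<m. g k - g (Suc k)) = - (\<Sum>k=l..<m. g (Suc k) - g k)"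
    by (simp add: sum_negf[symmetric])
  finally show ?thesis
    using sum_Suc_diff'[OF \<open>l \<le> m\<close>, of g] by simp
qed

text \<open>
  On the right, write each partial sum out and interchange the sums: the coefficient of \<open>e l\<close> is a
  product of tail sums of Abel weights, which is the product of the \<open>g p (l p)\<close>.
\<close>

lemma Abel_summation_PiE:
  fixes e :: "('q::finite \<Rightarrow> nat) \<Rightarrow> real"
  shows "(\<Sum>l\<in>(\<Pi>\<^sub>E p\<in>UNIV. {1..m p}). e l * (\<Prod>p\<in>UNIV. g p (l p))) =
    (\<Sum>k\<in>(\<Pi>\<^sub>E p\<in>UNIV. {..m p}). (\<Sum>l\<in>(\<Pi>\<^sub>E p\<in>UNIV. {1..k p}). e l) *
        (\<Prod>p\<in>UNIV. Abel_weight (m p) (g p) (k p)))" (is "?L = ?R")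
proof -
  let ?W = "\<lambda>k. \<Prod>p\<in>UNIV. Abel_weight (m p) (g p) (k p)"
  let ?A = "\<Pi>\<^sub>E p\<in>UNIV. {1..m p}" and ?B = "\<Pi>\<^sub>E p\<in>UNIV. {..m p}"
  have fin: "finite ?A" "finite ?B"
    by (auto intro!: finite_PiE)
  have "?R = (\<Sum>k\<in>?B. \<Sum>l\<in>?A. if \<forall>p. l p \<le> k p then e l * ?W k else 0)"
  proof (rule sum.cong[OF refl])
    fix k assume k: "k \<in> ?B"
    have "(\<Pi>\<^sub>E p\<in>UNIV. {1..k p}) = {l \<in> ?A. \<forall>p. l p \<le> k p}"
      using k by (fastforce simp: PiE_iff intro: order_trans)
    then show "(\<Sum>l\<in>(\<Pi>\<^sub>E p\<in>UNIV. {1..k p}). e l) * ?W k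
        = (\<Sum>l\<in>?A. if \<forall>p. l p \<le> k p then e l * ?W k else 0)"
      using fin by (simp add: sum.inter_filter sum_distrib_right if_distrib[of "\<lambda>t. t * _"] cong: if_cong)
  qed
  also have "\<dots> = (\<Sum>l\<in>?A. \<Sum>k\<in>?B. if \<forall>p. l p \<le> k p then e l * ?W k else 0)"
    by (rule sum.swap)
  also have "\<dots> = ?L"
  proof (rule sum.cong[OF refl])
    fix l assume l: "l \<in> ?A"
    have "{k \<in> ?B. \<forall>p. l p \<le> k p} = (\<Pi>\<^sub>E p\<in>UNIV. {l p..m p})"
      by (auto simp: PiE_iff)
    then have "(\<Sum>k\<in>?B. if \<forall>p. l p \<le> k p then e l * ?W k else 0) = (\<Sum>k\<in>(\<Pi>\<^sub>E p\<in>UNIV. {l p..m p}). e l * ?W k)"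
      using fin by (simp add: sum.inter_filter[symmetric])
    also have "\<dots> = e l * (\<Prod>p\<in>UNIV. \<Sum>k=l p..m p. Abel_weight (m p) (g p) k)"
      by (subst prod_sum_PiE) (auto simp: sum_distrib_left)
    also have "(\<Prod>p\<in>UNIV. \<Sum>k=l p..m p. Abel_weight (m p) (g p) k) = (\<Prod>p\<in>UNIV. g p (l p))"
      using l by (intro prod.cong sum_Abel_weight) (auto simp: PiE_iff)
    finally show "(\<Sum>k\<in>?B. if \<forall>p. l p \<le> k p then e l * ?W k else 0) = e l * (\<Prod>p\<in>UNIV. g p (l p))" .
  qed
  finally show ?thesis by simp
qed

text \<open>
  The set \<open>v\<close> collects the coordinates in which \<open>k\<close> stays below the last index. Together with Abel
  summation this produces the face terms of the multivariate integration by parts formula, one for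
  each \<open>v\<close>.
\<close>

lemma sum_PiE_atMost_split:
  fixes F :: "('q::finite \<Rightarrow> nat) \<Rightarrow> real"
  shows "(\<Sum>k\<in>(\<Pi>\<^sub>E p\<in>UNIV. {..m p}). F k) =
    (\<Sum>v\<in>UNIV. \<Sum>k\<in>(\<Pi>\<^sub>E p\<in>v. {..<m p}). F (\<lambda>p. if p \<in> v then k p else m p))"
proof -
  have "(\<Sum>v\<in>UNIV. \<Sum>k\<in>(\<Pi>\<^sub>E p\<in>v. {..<m p}). F (\<lambda>p. if p \<in> v then k p else m p))
      = (\<Sum>(v, k)\<in>Sigma UNIV (\<lambda>v. \<Pi>\<^sub>E p\<in>v. {..<m p}). F (\<lambda>p. if p \<in> v then k p else m p))"
    by (rule sum.Sigma) (auto intro!: finite_PiE)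
  also have "\<dots> = (\<Sum>k\<in>(\<Pi>\<^sub>E p\<in>UNIV. {..m p}). F k)"
  proof (rule sum.reindex_bij_witness[where
        i = "\<lambda>k. ({p. k p < m p}, restrict k {p. k p < m p})" and
        j = "\<lambda>(v, k) p. if p \<in> v then k p else m p"])
    fix a assume "a \<in> Sigma UNIV (\<lambda>v. \<Pi>\<^sub>E p\<in>v. {..<m p})"
    then obtain v k where a: "a = (v, k)" and k: "k \<in> (\<Pi>\<^sub>E p\<in>v. {..<m p})" by blast
    have kv: "p \<in> v \<Longrightarrow> k p < m p" "p \<notin> v \<Longrightarrow> k p = undefined" for p
      using k by (auto simp: PiE_iff extensional_def)
    have v: "{p. (if p \<in> v then k p else m p) < m p} = v"
      using kv by auto
    show "(case a of (v, k) \<Rightarrow> \<lambda>p. if p \<in> v then k p else m p) \<in> (\<Pi>\<^sub>E p\<in>UNIV. {..m p})"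
      using kv by (auto simp: a PiE_iff less_imp_le)
    show "({p. (case a of (v, k) \<Rightarrow> \<lambda>p. if p \<in> v then k p else m p) p < m p},
           restrict (case a of (v, k) \<Rightarrow> \<lambda>p. if p \<in> v then k p else m p)
             {p. (case a of (v, k) \<Rightarrow> \<lambda>p. if p \<in> v then k p else m p) p < m p}) = a"
      unfolding a prod.case v using kv by (auto simp: fun_eq_iff restrict_def)
  next
    fix k assume k: "k \<in> (\<Pi>\<^sub>E p\<in>UNIV. {..m p})"
    then have kp: "k p \<le> m p" for p
      by (auto simp: PiE_iff)
    show "({p. k p < m p}, restrict k {p. k p < m p}) \<in> Sigma UNIV (\<lambda>v. \<Pi>\<^sub>E p\<in>v. {..<m p})"
      by (auto simp: PiE_iff)
    show "(case ({p. k p < m p}, restrict k {p. k p < m p}) of (v, k) \<Rightarrow> \<lambda>p. if p \<in> v then k p else m p) = k"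
      using kp by (auto simp: fun_eq_iff not_less intro: antisym)
  qed auto
  finally show ?thesis by simp
qed

lemma alt_sum_prod:
  fixes f :: "'q::finite \<Rightarrow> real \<Rightarrow> real"
  shows "alt_sum v (\<lambda>z. \<Prod>p\<in>UNIV. f p (z $ p)) s t =
    (\<Prod>p\<in>v. f p (t $ p) - f p (s $ p)) * (\<Prod>p\<in>- v. f p (t $ p))"
proof -
  have "(\<Prod>p\<in>v. f p (t $ p) - f p (s $ p)) = (\<Prod>p\<in>v. - f p (s $ p) + f p (t $ p))"
    by simp
  also have "\<dots> = (\<Sum>X\<in>Pow v. (\<Prod>p\<in>X. - f p (s $ p)) * (\<Prod>p\<in>v - X. f p (t $ p)))"
    by (rule prod_add) simp
  finally have "(\<Prod>p\<in>v. f p (t $ p) - f p (s $ p)) * (\<Prod>p\<in>- v. f p (t $ p)) =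
      (\<Sum>X\<in>Pow v. (\<Prod>p\<in>X. - f p (s $ p)) * (\<Prod>p\<in>v - X. f p (t $ p)) * (\<Prod>p\<in>- v. f p (t $ p)))"
    by (simp add: sum_distrib_right)
  also have "\<dots> = alt_sum v (\<lambda>z. \<Prod>p\<in>UNIV. f p (z $ p)) s t"
    unfolding alt_sum_def
  proof (rule sum.cong[OF refl])
    fix X assume "X \<in> Pow v"
    then have X: "X \<subseteq> v" by simp
    have "(\<Prod>p\<in>UNIV. f p (glue X s t $ p)) = (\<Prod>p\<in>X. f p (glue X s t $ p)) * (\<Prod>p\<in>- X. f p (glue X s t $ p))"
      by (subst prod.union_disjoint[symmetric]) (auto simp: Un_commute)
    also have "(\<Prod>p\<in>X. f p (glue X s t $ p)) = (\<Prod>p\<in>X. f p (s $ p))"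
      by (auto intro!: prod.cong simp: glue_def)
    also have "(\<Prod>p\<in>- X. f p (glue X s t $ p)) = (\<Prod>p\<in>- X. f p (t $ p))"
      by (auto intro!: prod.cong simp: glue_def)
    also have "- X = (v - X) \<union> - v"
      using X by auto
    also have "(\<Prod>p\<in>(v - X) \<union> - v. f p (t $ p)) = (\<Prod>p\<in>v - X. f p (t $ p)) * (\<Prod>p\<in>- v. f p (t $ p))"
      by (rule prod.union_disjoint) auto
    finally show "(\<Prod>p\<in>X. - f p (s $ p)) * (\<Prod>p\<in>v - X. f p (t $ p)) * (\<Prod>p\<in>- v. f p (t $ p))
        = (- 1) ^ card X * (\<Prod>p\<in>UNIV. f p (glue X s t $ p))"
      by (simp add: prod_uminus)
  qed
  finally show ?thesis by simp
qed

lemma measurable_vec_lambda: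
  fixes f :: "'q::finite \<Rightarrow> 'a \<Rightarrow> real"
  assumes "\<And>p. f p \<in> borel_measurable M"
  shows "(\<lambda>u. \<chi> p. f p u) \<in> borel_measurable M"
proof (subst borel_measurable_euclidean_space, intro ballI)
  fix i :: "real ^ 'q" assume "i \<in> Basis"
  then obtain p where "i = axis p 1"
    by (auto simp: Basis_vec_def)
  then show "(\<lambda>u. (\<chi> p. f p u) \<bullet> i) \<in> borel_measurable M"
    using assms by (simp add: inner_axis)
qed

text \<open>
  An equidistant partition with many nodes, tagged at the lower nodes, is fine enough for both limits.
\<close>

lemma has_RS_integral_unique:
  fixes a b :: "real ^ 'q::finite"
  assumes "has_RS_integral v c a b h g L" "has_RS_integral v c a b h g L'"
    and ab: "\<And>p. p \<in> v \<Longrightarrow> a $ p < b $ p"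
  shows "L = L'"
proof (rule ccontr)
  assume "L \<noteq> L'"
  define e where "e = \<bar>L - L'\<bar> / 2"
  have e: "e > 0" using \<open>L \<noteq> L'\<close> by (simp add: e_def)
  define S where "S m y \<xi> = (\<Sum>k\<in>(\<Pi>\<^sub>E p\<in>v. {..<m p}).
      h (\<xi> k) * alt_sum v g (node v c y k) (node v c y (\<lambda>p. Suc (k p))))" for m y \<xi>
  define adm where "adm d m y \<xi> \<longleftrightarrow> product_partition v a b m y \<and> (\<forall>p\<in>v. \<forall>i<m p. y p (Suc i) - y p i < d) \<and>
      (\<forall>k\<in>(\<Pi>\<^sub>E p\<in>v. {..<m p}). \<xi> k \<in> cbox (node v c y k) (node v c y (\<lambda>p. Suc (k p))))" for d m y \<xi>
  have "\<exists>d>0. \<forall>m y \<xi>. adm d m y \<xi> \<longrightarrow> \<bar>S m y \<xi> - L\<bar> < e" "\<exists>d>0. \<forall>m y \<xi>. adm d m y \<xi> \<longrightarrow> \<bar>S m y \<xi> - L'\<bar> < e"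
    using assms(1,2)[unfolded has_RS_integral_def, rule_format, OF e] unfolding adm_def S_def .
  then obtain d1 d2 where d1: "d1 > 0" and d1': "\<And>m y \<xi>. adm d1 m y \<xi> \<Longrightarrow> \<bar>S m y \<xi> - L\<bar> < e"
    and d2: "d2 > 0" and d2': "\<And>m y \<xi>. adm d2 m y \<xi> \<Longrightarrow> \<bar>S m y \<xi> - L'\<bar> < e"
    by blast
  define D where "D = (\<Sum>p\<in>UNIV. \<bar>b $ p - a $ p\<bar>)"
  obtain n :: nat where n: "D / min d1 d2 < real n"
    using reals_Archimedean2 by blast
  moreover have "0 \<le> D / min d1 d2"
    using d1 d2 by (auto simp: D_def intro!: divide_nonneg_pos sum_nonneg)
  ultimately have "0 < real n" by linarith
  then have n: "D / min d1 d2 < real n" "n > 0"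
    using n by simp_all
  define y where "y p i = a $ p + (b $ p - a $ p) * (real i / real n)" for p i
  have step: "y p (Suc i) - y p i = (b $ p - a $ p) / real n" for p i
    using n(2) by (simp add: y_def field_simps)
  have part: "product_partition v a b (\<lambda>_. n) y"
    unfolding product_partition_def
  proof (intro ballI conjI allI impI)
    fix p i assume p: "p \<in> v"
    have "0 < y p (Suc i) - y p i"
      unfolding step using ab[OF p] n by simp
    then show "y p i < y p (Suc i)" by simp
  qed (use n in \<open>auto simp: y_def\<close>)
  have small: "y p (Suc i) - y p i < min d1 d2" for p i
  proof -
    have "\<bar>b $ p - a $ p\<bar> \<le> D"
      unfolding D_def by (rule member_le_sum) auto
    then have "b $ p - a $ p \<le> D"
      by linarith
    also have "D < real n * min d1 d2"
      using n d1 d2 by (simp add: field_simps)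
    finally have "(b $ p - a $ p) / real n < min d1 d2"
      using n by (simp only: pos_divide_less_eq of_nat_0_less_iff mult.commute)
    then show ?thesis
      unfolding step .
  qed
  have tag: "\<forall>k\<in>(\<Pi>\<^sub>E p\<in>v. {..<n}). node v c y k \<in> cbox (node v c y k) (node v c y (\<lambda>p. Suc (k p)))"
  proof
    fix k assume k: "k \<in> (\<Pi>\<^sub>E p\<in>v. {..<n})"
    have "y p (k p) \<le> y p (Suc (k p))" if "p \<in> v" for p
      using part k that unfolding product_partition_def by (auto dest: PiE_mem intro: less_imp_le)
    then show "node v c y k \<in> cbox (node v c y k) (node v c y (\<lambda>p. Suc (k p)))"
      by (auto simp: mem_box_cart node_def)
  qed
  have "adm d1 (\<lambda>_. n) y (node v c y)" "adm d2 (\<lambda>_. n) y (node v c y)"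
    unfolding adm_def using part tag small by auto
  then have "\<bar>L - L'\<bar> < 2 * e"
    using d1'[of "\<lambda>_. n" y "node v c y"] d2'[of "\<lambda>_. n" y "node v c y"] by linarith
  then show False
    by (simp add: e_def)
qed

lemma RS_integral_eqI:
  fixes a b :: "real ^ 'q::finite"
  assumes "has_RS_integral v c a b h g L" "\<And>p. p \<in> v \<Longrightarrow> a $ p < b $ p"
  shows "RS_integral v c a b h g = L"
  unfolding RS_integral_def using assms has_RS_integral_unique by (intro the_equality) blast+

section \<open>Integration by parts for product integrands\<close>

text \<open>
  Points of the face of the box \<open>[0, b]\<close> on which the coordinates outside \<open>v\<close> are those of \<open>b\<close>,
  parametrised by the unit cube.
\<close>

definition edge_point :: "'q set \<Rightarrow> real ^ 'q \<Rightarrow> ('q \<Rightarrow> real) \<Rightarrow> real ^ 'q" where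
  "edge_point v b u = (\<chi> p. if p \<in> v then b $ p * u p else b $ p)"

lemma edge_point_in_cube:
  assumes "b \<in> cbox 0 1" "u \<in> space (Pi\<^sub>M v (\<lambda>_. unif01))"
  shows "edge_point v b u \<in> cbox 0 1"
proof -
  have "0 \<le> b $ p * u p \<and> b $ p * u p \<le> 1" if "p \<in> v" for p
    using assms(1) space_PiM_unif01[OF assms(2) that] by (auto simp: mem_box_cart mult_le_one)
  then show ?thesis
    using assms(1) by (auto simp: mem_box_cart edge_point_def)
qed

lemma measurable_edge_point:
  fixes c :: "real ^ 'q::finite \<Rightarrow> real"
  assumes c: "continuous_on (cbox 0 1) c" and b: "b \<in> cbox 0 1"
  shows "(\<lambda>u. c (edge_point v b u)) \<in> borel_measurable (Pi\<^sub>M v (\<lambda>_. unif01))"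
proof -
  have "(\<lambda>z. indicator (cbox 0 1) z *\<^sub>R c z) \<in> borel_measurable borel"
    by (intro borel_measurable_continuous_on_indicator c) simp
  moreover have "edge_point v b \<in> borel_measurable (Pi\<^sub>M v (\<lambda>_. unif01))"
    unfolding edge_point_def
  proof (rule measurable_vec_lambda)
    show "(\<lambda>u. if p \<in> v then b $ p * u p else b $ p) \<in> borel_measurable (Pi\<^sub>M v (\<lambda>_. unif01))" for p
      using measurable_component_unif01[of p v] by (cases "p \<in> v") auto
  qed
  ultimately have "(\<lambda>u. indicator (cbox 0 1) (edge_point v b u) *\<^sub>R c (edge_point v b u))
      \<in> borel_measurable (Pi\<^sub>M v (\<lambda>_. unif01))"
    by (rule measurable_compose_rev)
  then show ?thesis
    by (subst measurable_cong[where g = "\<lambda>u. indicator (cbox 0 1) (edge_point v b u) *\<^sub>R c (edge_point v b u)"])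
      (auto simp: edge_point_in_cube[OF b])
qed

lemma continuous_on_cube_bounded:
  fixes c :: "real ^ 'q::finite \<Rightarrow> real"
  assumes "continuous_on (cbox 0 1) c"
  obtains C where "0 \<le> C" "\<And>z. z \<in> cbox 0 1 \<Longrightarrow> \<bar>c z\<bar> \<le> C"
proof -
  have "bounded (c ` cbox 0 1)"
    by (intro compact_imp_bounded compact_continuous_image assms compact_cbox)
  then obtain C where "\<forall>z\<in>cbox 0 1. \<bar>c z\<bar> \<le> C"
    by (auto simp: bounded_iff)
  then show ?thesis
    by (intro that[of "max C 0"]) (auto simp: le_max_iff_disj)
qed

text \<open>
  The integrands are \<open>z \<mapsto> \<Prod>p. \<kappa> p (x $ p - \<theta> $ p * z $ p)\<close>, with \<open>\<theta>\<close> the scaling of the axes and \<open>x\<close> the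
  location. Bounds that are uniform over the whole line make all estimates below uniform in \<open>x\<close>. The
  condition \<open>1 \<le> K\<close> lets products of different numbers of factors be bounded by one power of \<open>K\<close>.
\<close>

locale smooth_factors =
  fixes \<kappa> \<kappa>' :: "'q::finite \<Rightarrow> real \<Rightarrow> real" and K :: real
  assumes deriv: "\<And>p y. (\<kappa> p has_real_derivative \<kappa>' p y) (at y)"
    and cont_deriv: "\<And>p. continuous_on UNIV (\<kappa>' p)"
    and bound: "\<And>p y. \<bar>\<kappa> p y\<bar> \<le> K"
    and bound_deriv: "\<And>p y. \<bar>\<kappa>' p y\<bar> \<le> K"
    and K: "1 \<le> K"
begin

lemma cont: "continuous_on UNIV (\<kappa> p)"
  using deriv by (intro continuous_at_imp_continuous_on ballI DERIV_isCont)

text \<open>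
  The Stieltjes integral of \<open>c\<close> against the product integrand in the variables in \<open>v\<close>, the others being
  fixed at \<open>b\<close>. It is written as an integral over the unit cube, so that \<open>b\<close> occurs in the integrand
  only and continuity in all parameters follows by dominated convergence.
\<close>

definition parts_integral ::
    "'q set \<Rightarrow> (real ^ 'q \<Rightarrow> real) \<Rightarrow> real ^ 'q \<Rightarrow> real ^ 'q \<Rightarrow> real ^ 'q \<Rightarrow> real" where
  "parts_integral v c b \<theta> x =
     (\<integral>u. c (edge_point v b u) * (\<Prod>p\<in>v. - (\<theta> $ p * b $ p) * \<kappa>' p (x $ p - \<theta> $ p * b $ p * u p))
        \<partial>Pi\<^sub>M v (\<lambda>_. unif01)) * (\<Prod>p\<in>- v. \<kappa> p (x $ p - \<theta> $ p * b $ p))"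

text \<open>
  The integral of the product integrand against \<open>dc\<close> over \<open>[0, b]\<close> after integration by parts, for \<open>c\<close>
  that vanishes when a coordinate is \<open>0\<close>: only the faces through \<open>b\<close> remain.
\<close>

definition parts_functional ::
    "(real ^ 'q \<Rightarrow> real) \<Rightarrow> real ^ 'q \<Rightarrow> real ^ 'q \<Rightarrow> real ^ 'q \<Rightarrow> real" where
  "parts_functional c b \<theta> x = (\<Sum>v\<in>UNIV. (-1) ^ card v * parts_integral v c b \<theta> x)"

lemma prod_bound:
  assumes "\<And>p. \<bar>f p\<bar> \<le> T * K" and T: "1 \<le> T"
  shows "\<bar>\<Prod>p\<in>v. f p\<bar> * \<bar>\<Prod>p\<in>- v. \<kappa> p (z p)\<bar> \<le> (T * K) ^ CARD('q)"
proof -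
  have K_TK: "K \<le> T * K" using T K by simp
  have "\<bar>\<Prod>p\<in>v. f p\<bar> * \<bar>\<Prod>p\<in>- v. \<kappa> p (z p)\<bar> \<le> (\<Prod>p\<in>v. T * K) * (\<Prod>p\<in>- v. T * K)"
    unfolding abs_prod
    by (intro mult_mono prod_mono conjI prod_nonneg assms order_trans[OF bound K_TK])
      (use T K in auto)
  also have "\<dots> = (T * K) ^ CARD('q)"
    by (simp add: power_add[symmetric] card_Un_disjoint[symmetric] Un_commute)
  finally show ?thesis .
qed

text \<open>
  After rescaling the box to the unit cube, this covers both the sums that define the Riemann--Stieltjes
  integral (arbitrary nodes, \<open>a k\<close> a value of \<open>c\<close> in the cell) and the grid sums of the monitoring
  process (equidistant nodes, \<open>a k\<close> a value of a path near \<open>c\<close>).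
\<close>

lemma parts_sum_estimate:
  fixes y :: "'q \<Rightarrow> nat \<Rightarrow> real" and a :: "('q \<Rightarrow> nat) \<Rightarrow> real"
  assumes c: "continuous_on (cbox 0 1) c" and b: "b \<in> cbox 0 1"
    and \<theta>: "\<And>p. 0 \<le> \<theta> $ p \<and> \<theta> $ p \<le> T" and T: "1 \<le> T"
    and y: "\<And>p. p \<in> v \<Longrightarrow> y p 0 = 0" "\<And>p. p \<in> v \<Longrightarrow> y p (m p) = 1"
      "\<And>p i. p \<in> v \<Longrightarrow> i < m p \<Longrightarrow> y p i \<le> y p (Suc i)"
    and close: "\<And>k z. k \<in> (\<Pi>\<^sub>E p\<in>v. {..<m p}) \<Longrightarrow> z \<in> cbox 0 1 \<Longrightarrow>
       (\<And>p. p \<in> v \<Longrightarrow> b $ p * y p (k p) \<le> z $ p \<and> z $ p \<le> b $ p * y p (Suc (k p))) \<Longrightarrow>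
       (\<And>p. p \<notin> v \<Longrightarrow> z $ p = b $ p) \<Longrightarrow> \<bar>a k - c z\<bar> \<le> \<delta>"
    and "0 \<le> \<delta>"
  shows "\<bar>(\<Sum>k\<in>(\<Pi>\<^sub>E p\<in>v. {..<m p}). a k *
              (\<Prod>p\<in>v. \<kappa> p (x $ p - \<theta> $ p * b $ p * y p (Suc (k p))) - \<kappa> p (x $ p - \<theta> $ p * b $ p * y p (k p)))) *
            (\<Prod>p\<in>- v. \<kappa> p (x $ p - \<theta> $ p * b $ p)) - parts_integral v c b \<theta> x\<bar>
         \<le> \<delta> * (T * K) ^ CARD('q)" (is "\<bar>?S * ?P - _\<bar> \<le> _")
proof -
  let ?U = "Pi\<^sub>M v (\<lambda>_. unif01)"
  define g where "g p u = \<kappa> p (x $ p - \<theta> $ p * b $ p * u)" for p u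
  define g' where "g' p u = - (\<theta> $ p * b $ p) * \<kappa>' p (x $ p - \<theta> $ p * b $ p * u)" for p u
  have g: "(g p has_real_derivative g' p u) (at u within S)" for p u S
  proof -
    have "((\<lambda>u. x $ p - \<theta> $ p * b $ p * u) has_real_derivative - (\<theta> $ p * b $ p)) (at u)"
      by (auto intro!: derivative_eq_intros)
    from DERIV_chain2[OF deriv this] show ?thesis
      unfolding g_def g'_def by (rule DERIV_subset[OF _ subset_UNIV, THEN DERIV_cong]) simp
  qed
  have cg: "continuous_on {0..1} (g' p)" for p
    unfolding g'_def by (intro continuous_intros continuous_on_compose2[OF cont_deriv]) auto
  have gK: "\<bar>g' p u\<bar> \<le> T * K" for p u
  proof -
    have "\<bar>\<theta> $ p * b $ p\<bar> \<le> T"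
      using \<theta>[of p] b by (auto simp: mem_box_cart abs_mult intro: order_trans[OF mult_left_le])
    then show ?thesis
      unfolding g'_def abs_mult by (intro mult_mono bound_deriv) (use T in \<open>auto simp: abs_mult\<close>)
  qed
  obtain C where C: "\<And>z. z \<in> cbox 0 1 \<Longrightarrow> \<bar>c z\<bar> \<le> C"
    using continuous_on_cube_bounded[OF c] by blast
  have "\<bar>(\<Sum>k\<in>(\<Pi>\<^sub>E p\<in>v. {..<m p}). a k * (\<Prod>p\<in>v. g p (y p (Suc (k p))) - g p (y p (k p))))
          - (\<integral>u. c (edge_point v b u) * (\<Prod>p\<in>v. g' p (u p)) \<partial>?U)\<bar> \<le> \<delta> * (\<Prod>p\<in>v. T * K)"
  proof (rule Riemann_Stieltjes_sum_estimate[where C = C and y = y and m = m and a = a and g = g and g' = g'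
        and K = "\<lambda>_. T * K" and \<delta> = \<delta> and H = "\<lambda>u. c (edge_point v b u)" and v = v])
    fix k u assume k: "k \<in> (\<Pi>\<^sub>E p\<in>v. {..<m p})" and u: "u \<in> space ?U"
      and yu: "\<And>p. p \<in> v \<Longrightarrow> y p (k p) \<le> u p \<and> u p \<le> y p (Suc (k p))"
    have "0 \<le> b $ p" for p using b by (simp add: mem_box_cart)
    then show "\<bar>a k - c (edge_point v b u)\<bar> \<le> \<delta>"
      using yu by (intro close[OF k edge_point_in_cube[OF b u]]) (auto simp: edge_point_def mult_left_mono)
  qed (use y g cg gK C edge_point_in_cube[OF b] measurable_edge_point[OF c b] \<open>0 \<le> \<delta>\<close> in auto)
  then have "\<bar>?S - (\<integral>u. c (edge_point v b u) * (\<Prod>p\<in>v. g' p (u p)) \<partial>?U)\<bar> * \<bar>?P\<bar> \<le> \<delta> * (\<Prod>p\<in>v. T * K) * \<bar>?P\<bar>"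
    unfolding g_def by (rule mult_right_mono) simp
  also have "\<dots> = \<delta> * (\<bar>\<Prod>p\<in>v. T * K\<bar> * \<bar>?P\<bar>)"
    using T K by (simp add: abs_prod)
  also have "\<dots> \<le> \<delta> * (T * K) ^ CARD('q)"
    using T K by (intro mult_left_mono prod_bound \<open>0 \<le> \<delta>\<close>) auto
  finally show ?thesis
    unfolding parts_integral_def g'_def by (simp add: abs_mult[symmetric] left_diff_distrib)
qed

lemma alt_sum_factors_node:
  "alt_sum v (\<lambda>z. \<Prod>p\<in>UNIV. \<kappa> p (x $ p - \<theta> $ p * z $ p)) (node v c y k) (node v c y k') =
    (\<Prod>p\<in>v. \<kappa> p (x $ p - \<theta> $ p * y p (k' p)) - \<kappa> p (x $ p - \<theta> $ p * y p (k p))) *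
    (\<Prod>p\<in>- v. \<kappa> p (x $ p - \<theta> $ p * c $ p))"
  using alt_sum_prod[of v "\<lambda>p z. \<kappa> p (x $ p - \<theta> $ p * z)" "node v c y k" "node v c y k'"]
  by (simp add: node_def)

lemma has_RS_integral_parts:
  assumes h: "continuous_on (cbox 0 1) h" and b: "\<And>p. 0 < b $ p \<and> b $ p \<le> 1"
    and \<theta>: "\<And>p. 0 \<le> \<theta> $ p \<and> \<theta> $ p \<le> T" and T: "1 \<le> T"
  shows "has_RS_integral v b 0 b h (\<lambda>z. \<Prod>p\<in>UNIV. \<kappa> p (x $ p - \<theta> $ p * z $ p)) (parts_integral v h b \<theta> x)"
  unfolding has_RS_integral_def
proof (intro allI impI)
  fix e :: real assume "0 < e"
  define \<delta> where "\<delta> = e / (2 * (T * K) ^ CARD('q))"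
  have TK: "0 < (T * K) ^ CARD('q)" using T K by simp
  have \<delta>: "0 < \<delta>" "\<delta> * (T * K) ^ CARD('q) < e"
    using \<open>0 < e\<close> TK T K by (auto simp: \<delta>_def)
  have "uniformly_continuous_on (cbox 0 1) h"
    by (intro compact_uniformly_continuous h compact_cbox)
  then obtain d where d: "d > 0" "\<And>z z'. z \<in> cbox 0 1 \<Longrightarrow> z' \<in> cbox 0 1 \<Longrightarrow> dist z z' < d \<Longrightarrow> dist (h z) (h z') < \<delta>"
    using \<delta>(1) unfolding uniformly_continuous_on_def by meson
  define d' where "d' = d / CARD('q)"
  have "d' > 0" using d by (simp add: d'_def)
  show "\<exists>d>0. \<forall>m y \<xi>. product_partition v 0 b m y \<and> (\<forall>p\<in>v. \<forall>i<m p. y p (Suc i) - y p i < d) \<and>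
          (\<forall>k\<in>(\<Pi>\<^sub>E p\<in>v. {..<m p}). \<xi> k \<in> cbox (node v b y k) (node v b y (\<lambda>p. Suc (k p)))) \<longrightarrow>
          \<bar>(\<Sum>k\<in>(\<Pi>\<^sub>E p\<in>v. {..<m p}). h (\<xi> k) * alt_sum v (\<lambda>z. \<Prod>p\<in>UNIV. \<kappa> p (x $ p - \<theta> $ p * z $ p))
              (node v b y k) (node v b y (\<lambda>p. Suc (k p)))) - parts_integral v h b \<theta> x\<bar> < e"
  proof (intro exI[of _ d'] conjI \<open>d' > 0\<close> allI impI, elim conjE)
    fix m y \<xi>
    assume y: "product_partition v 0 b m y" and mesh: "\<forall>p\<in>v. \<forall>i<m p. y p (Suc i) - y p i < d'"
      and \<xi>: "\<forall>k\<in>(\<Pi>\<^sub>E p\<in>v. {..<m p}). \<xi> k \<in> cbox (node v b y k) (node v b y (\<lambda>p. Suc (k p)))"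
    let ?I = "\<Pi>\<^sub>E p\<in>v. {..<m p}"
    have b1: "b \<in> cbox 0 1" using b by (auto simp: mem_box_cart less_imp_le)
    have bn: "b $ p \<noteq> 0" for p using b[of p] by simp
    have "\<bar>(\<Sum>k\<in>?I. h (\<xi> k) * (\<Prod>p\<in>v. \<kappa> p (x $ p - \<theta> $ p * b $ p * (y p (Suc (k p)) / b $ p))
               - \<kappa> p (x $ p - \<theta> $ p * b $ p * (y p (k p) / b $ p)))) *
            (\<Prod>p\<in>- v. \<kappa> p (x $ p - \<theta> $ p * b $ p)) - parts_integral v h b \<theta> x\<bar> \<le> \<delta> * (T * K) ^ CARD('q)"
    proof (rule parts_sum_estimate[OF h b1 \<theta> T, where y = "\<lambda>p i. y p i / b $ p"])
      fix k z
      assume k: "k \<in> ?I" and z: "z \<in> cbox 0 1"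
        and zv: "\<And>p. p \<in> v \<Longrightarrow> b $ p * (y p (k p) / b $ p) \<le> z $ p \<and> z $ p \<le> b $ p * (y p (Suc (k p)) / b $ p)"
        and znv: "\<And>p. p \<notin> v \<Longrightarrow> z $ p = b $ p"
      have kp: "k p < m p" if "p \<in> v" for p
        using k that by (auto dest: PiE_mem)
      have \<xi>k: "p \<in> v \<Longrightarrow> y p (k p) \<le> \<xi> k $ p \<and> \<xi> k $ p \<le> y p (Suc (k p))" "p \<notin> v \<Longrightarrow> \<xi> k $ p = b $ p" for p
        using \<xi> k by (auto simp: mem_box_cart node_def intro: antisym split: if_splits)
      have yb: "0 \<le> y p (k p)" "y p (Suc (k p)) \<le> b $ p" if "p \<in> v" for p
        using cells_ordered[of "\<lambda>i. y p i / b $ p" "m p" "k p"] y that kp[OF that] b[of p]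
        unfolding product_partition_def
        by (auto simp: divide_right_mono less_imp_le zero_le_divide_iff)
      have "\<xi> k \<in> cbox 0 1"
        unfolding mem_box_cart
      proof
        fix p show "0 $ p \<le> \<xi> k $ p \<and> \<xi> k $ p \<le> 1 $ p"
          using \<xi>k[of p] yb[of p] b[of p] by (cases "p \<in> v") auto
      qed
      moreover have "dist (\<xi> k) z < d"
      proof -
        have "\<bar>(\<xi> k - z) $ p\<bar> < d'" for p
        proof (cases "p \<in> v")
          case True
          have "y p (Suc (k p)) - y p (k p) < d'"
            using mesh kp[OF True] True by blast
          then show ?thesis
            using \<xi>k(1)[OF True] zv[OF True] bn[of p] by (auto simp: abs_if)
        next
          case False
          then show ?thesis
            using \<xi>k(2) znv \<open>d' > 0\<close> by simp
        qed
        then have "(\<Sum>p\<in>UNIV. \<bar>(\<xi> k - z) $ p\<bar>) < (\<Sum>p\<in>(UNIV::'q set). d')"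
          by (intro sum_strict_mono) auto
        then show ?thesis
          using norm_le_l1_cart[of "\<xi> k - z"] by (simp add: dist_norm d'_def)
      qed
      ultimately show "\<bar>h (\<xi> k) - h z\<bar> \<le> \<delta>"
        using d(2)[OF _ z] by (simp add: dist_real_def less_imp_le)
    qed (use y b \<delta> bn in \<open>auto simp: product_partition_def less_imp_le divide_right_mono\<close>)
    also note \<delta>(2)
    finally show "\<bar>(\<Sum>k\<in>?I. h (\<xi> k) * alt_sum v (\<lambda>z. \<Prod>p\<in>UNIV. \<kappa> p (x $ p - \<theta> $ p * z $ p))
              (node v b y k) (node v b y (\<lambda>p. Suc (k p)))) - parts_integral v h b \<theta> x\<bar> < e"
      unfolding alt_sum_factors_node using bn by (simp add: sum_distrib_right mult.assoc)
  qed
qed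

text \<open>
  A face on which some coordinate is fixed at \<open>0\<close> carries only tags where \<open>h\<close> vanishes.
\<close>

lemma has_RS_integral_zero:
  assumes "\<And>z. z \<in> cbox 0 1 \<Longrightarrow> (\<exists>p. z $ p = 0) \<Longrightarrow> h z = 0"
    and b: "\<And>p. 0 < b $ p \<and> b $ p \<le> 1" and w: "w \<noteq> {}" "w \<subseteq> - v"
  shows "has_RS_integral v (glue w 0 b) 0 b h g 0"
  unfolding has_RS_integral_def
proof (intro allI impI exI[of _ 1] conjI, simp, elim conjE)
  fix e :: real and m y \<xi>
  assume "0 < e" and y: "product_partition v 0 b m y"
    and \<xi>: "\<forall>k\<in>(\<Pi>\<^sub>E p\<in>v. {..<m p}). \<xi> k \<in> cbox (node v (glue w 0 b) y k) (node v (glue w 0 b) y (\<lambda>p. Suc (k p)))"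
  have "h (\<xi> k) = 0" if k: "k \<in> (\<Pi>\<^sub>E p\<in>v. {..<m p})" for k
  proof (rule assms(1))
    have kp: "k p < m p" if "p \<in> v" for p
      using k that by (auto dest: PiE_mem)
    have \<xi>k: "node v (glue w 0 b) y k $ p \<le> \<xi> k $ p \<and> \<xi> k $ p \<le> node v (glue w 0 b) y (\<lambda>p. Suc (k p)) $ p" for p
      using \<xi> k by (simp add: mem_box_cart)
    have yb: "0 \<le> y p (k p)" "y p (Suc (k p)) \<le> b $ p" if "p \<in> v" for p
      using cells_ordered[of "\<lambda>i. y p i / b $ p" "m p" "k p"] y that kp[OF that] b[of p]
      unfolding product_partition_def
      by (auto simp: divide_right_mono less_imp_le zero_le_divide_iff)
    show "\<xi> k \<in> cbox 0 1"
      unfolding mem_box_cart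
    proof
      fix p show "0 $ p \<le> \<xi> k $ p \<and> \<xi> k $ p \<le> 1 $ p"
        using \<xi>k[of p] yb[of p] b[of p] by (auto simp: node_def glue_def split: if_splits)
    qed
    obtain p where "p \<in> w" "p \<notin> v" using w by blast
    then show "\<exists>p. \<xi> k $ p = 0"
      using \<xi>k[of p] by (auto simp: node_def glue_def intro!: exI[of _ p])
  qed
  then show "\<bar>(\<Sum>k\<in>(\<Pi>\<^sub>E p\<in>v. {..<m p}). h (\<xi> k) *
      alt_sum v g (node v (glue w 0 b) y k) (node v (glue w 0 b) y (\<lambda>p. Suc (k p)))) - 0\<bar> < e"
    using \<open>0 < e\<close> by simp
qed

text \<open>
  In the integration by parts formula, every term with a coordinate fixed at \<open>0\<close> drops out. Those that
  remain are the face integrals through \<open>b\<close>: the corner \<open>b\<close> itself belongs to \<open>v = {}\<close>, and the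
  integral over the whole box to \<open>v = UNIV\<close>.
\<close>

theorem RS_by_parts_eq_parts_functional:
  assumes h: "continuous_on (cbox 0 1) h" and h0: "\<And>z. z \<in> cbox 0 1 \<Longrightarrow> (\<exists>p. z $ p = 0) \<Longrightarrow> h z = 0"
    and b: "\<And>p. 0 < b $ p \<and> b $ p \<le> 1" and \<theta>: "\<And>p. 0 \<le> \<theta> $ p"
  shows "RS_by_parts 0 b (\<lambda>z. \<Prod>p\<in>UNIV. \<kappa> p (x $ p - \<theta> $ p * z $ p)) h = parts_functional h b \<theta> x"
proof -
  let ?g = "\<lambda>z. \<Prod>p\<in>UNIV. \<kappa> p (x $ p - \<theta> $ p * z $ p)"
  define T where "T = 1 + (\<Sum>p\<in>UNIV. \<theta> $ p)"
  have T: "1 \<le> T" using \<theta> by (simp add: T_def sum_nonneg)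
  have \<theta>T: "0 \<le> \<theta> $ p \<and> \<theta> $ p \<le> T" for p
    using \<theta> member_le_sum[of p UNIV "\<lambda>p. \<theta> $ p"] by (auto simp: T_def)
  have b1: "b \<in> cbox 0 1" using b by (auto simp: mem_box_cart less_imp_le)
  have RSv: "RS_integral v b 0 b h ?g = parts_integral v h b \<theta> x" for v
    using b by (intro RS_integral_eqI has_RS_integral_parts[OF h b \<theta>T T]) auto
  have RS0: "RS_integral v (glue w 0 b) 0 b h ?g = (if w = {} then parts_integral v h b \<theta> x else 0)"
    if "w \<in> Pow (- v)" for v w
  proof (cases "w = {}")
    case True
    then have "glue w 0 b = b" by (simp add: glue_def vec_eq_iff)
    then show ?thesis using RSv True by simp
  next
    case False
    then show ?thesis
      using that b by (auto intro!: RS_integral_eqI has_RS_integral_zero[OF h0])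
  qed
  have inner: "(\<Sum>w\<in>Pow (- v). (-1) ^ card w * RS_integral v (glue w 0 b) 0 b h ?g) = parts_integral v h b \<theta> x" for v
  proof -
    have "(\<Sum>w\<in>Pow (- v). (-1) ^ card w * RS_integral v (glue w 0 b) 0 b h ?g)
        = (\<Sum>w\<in>Pow (- v). if w = {} then parts_integral v h b \<theta> x else 0)"
      by (intro sum.cong) (auto simp: RS0)
    then show ?thesis by simp
  qed
  have empty: "parts_integral {} h b \<theta> x = h b * ?g b"
  proof -
    interpret prob_space "Pi\<^sub>M {} (\<lambda>_::'q. unif01)" by (rule prob_space_PiM_unif01)
    have "edge_point {} b = (\<lambda>_. b)" by (simp add: edge_point_def fun_eq_iff vec_eq_iff)
    then show ?thesis by (simp add: parts_integral_def prob_space)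
  qed
  have "alt_sum UNIV (\<lambda>z. h z * ?g z) 0 b = (\<Sum>v\<in>Pow (UNIV :: 'q set). if v = {} then h b * ?g b else 0)"
    unfolding alt_sum_def
  proof (rule sum.cong[OF refl])
    fix v :: "'q set"
    show "(-1) ^ card v * (h (glue v 0 b) * ?g (glue v 0 b)) = (if v = {} then h b * ?g b else 0)"
    proof (cases "v = {}")
      case True
      then have "glue v 0 b = b" by (simp add: glue_def vec_eq_iff)
      then show ?thesis using True by simp
    next
      case False
      then have "\<exists>p. glue v 0 b $ p = 0" by (auto simp: glue_def)
      moreover have "glue v 0 b \<in> cbox 0 1" using b1 by (auto simp: glue_def mem_box_cart)
      ultimately show ?thesis using h0 False by simp
    qed
  qed
  then have A: "alt_sum UNIV (\<lambda>z. h z * ?g z) 0 b = (-1) ^ card ({}::'q set) * parts_integral {} h b \<theta> x"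
    using empty by simp
  have "1 \<le> card v \<and> card v \<le> CARD('q) - 1 \<longleftrightarrow> v \<noteq> {} \<and> v \<noteq> UNIV" for v :: "'q set"
  proof (cases "v = UNIV")
    case True
    have "0 < CARD('q)" by simp
    then have "\<not> CARD('q) \<le> CARD('q) - 1" by linarith
    then show ?thesis unfolding True by blast
  next
    case False
    then have "card v < CARD('q)" by (intro psubset_card_mono) auto
    then show ?thesis
      using False by (auto simp: Suc_le_eq card_gt_0_iff)
  qed
  then have "{v. 1 \<le> card v \<and> card v \<le> CARD('q) - 1} = UNIV - {{}, UNIV :: 'q set}"
    by blast
  then have "(\<Sum>v | 1 \<le> card v \<and> card v \<le> CARD('q) - 1. (-1) ^ card v * parts_integral v h b \<theta> x) =
     (\<Sum>v\<in>UNIV - {{}, UNIV :: 'q set}. (-1) ^ card v * parts_integral v h b \<theta> x)"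
    by simp
  also have "\<dots> = parts_functional h b \<theta> x - (\<Sum>v\<in>{{}, UNIV :: 'q set}. (-1) ^ card v * parts_integral v h b \<theta> x)"
    unfolding parts_functional_def by (rule sum_diff) auto
  finally show ?thesis
    unfolding RS_by_parts_def A inner RSv by simp
qed

lemma continuous_parts_integral:
  assumes c: "continuous_on (cbox 0 1) c" and T: "1 \<le> T"
  shows "continuous_on (cbox 0 1 \<times> cbox 0 (\<chi> p. T) \<times> UNIV) (\<lambda>(b, \<theta>, x). parts_integral v c b \<theta> x)"
proof -
  let ?S = "cbox 0 1 \<times> cbox 0 (\<chi> p. T) \<times> (UNIV :: (real ^ 'q) set)" and ?U = "Pi\<^sub>M v (\<lambda>_. unif01)"
  interpret U: prob_space ?U by (rule prob_space_PiM_unif01)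
  obtain C where C: "0 \<le> C" "\<And>z. z \<in> cbox 0 1 \<Longrightarrow> \<bar>c z\<bar> \<le> C"
    using continuous_on_cube_bounded[OF c] by blast
  define f where "f = (\<lambda>(b, \<theta>, x) u. c (edge_point v b u) *
     (\<Prod>p\<in>v. - (\<theta> $ p * b $ p) * \<kappa>' p (x $ p - \<theta> $ p * b $ p * u p)))"
  have mf: "f s \<in> borel_measurable ?U" if s: "s \<in> ?S" for s
  proof -
    obtain b \<theta> x where s': "s = (b, \<theta>, x)" "b \<in> cbox 0 1"
      using s by (cases s) auto
    have "(\<lambda>u. \<kappa>' p (x $ p - \<theta> $ p * b $ p * u p)) \<in> borel_measurable ?U" if "p \<in> v" for p
      using borel_measurable_continuous_onI[OF cont_deriv] measurable_component_unif01[OF that]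
      by measurable
    then show ?thesis
      unfolding f_def s' prod.case using measurable_edge_point[OF c s'(2)] by measurable
  qed
  have bf: "\<bar>f s u\<bar> \<le> C * (\<Prod>p\<in>v. T * K)" if s: "s \<in> ?S" and u: "u \<in> space ?U" for s u
  proof -
    obtain b \<theta> x where s': "s = (b, \<theta>, x)" "b \<in> cbox 0 1" "\<theta> \<in> cbox 0 (\<chi> p. T)"
      using s by (cases s) auto
    have "\<bar>- (\<theta> $ p * b $ p) * \<kappa>' p (x $ p - \<theta> $ p * b $ p * u p)\<bar> \<le> T * K" for p
    proof -
      have "\<bar>\<theta> $ p * b $ p\<bar> \<le> T"
        using s'(2,3) by (auto simp: mem_box_cart abs_mult intro: order_trans[OF mult_left_le])
      then show ?thesis
        unfolding abs_mult by (intro mult_mono bound_deriv) (use T in \<open>auto simp: abs_mult\<close>)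
    qed
    then have "\<bar>\<Prod>p\<in>v. - (\<theta> $ p * b $ p) * \<kappa>' p (x $ p - \<theta> $ p * b $ p * u p)\<bar> \<le> (\<Prod>p\<in>v. T * K)"
      unfolding abs_prod by (intro prod_mono) auto
    then show ?thesis
      unfolding f_def s' prod.case abs_mult
      by (intro mult_mono C edge_point_in_cube s' u) auto
  qed
  have "continuous_on ?S (\<lambda>s. \<integral>u. f s u \<partial>?U)"
    unfolding continuous_on_sequentially
  proof (intro allI ballI impI, elim conjE)
    fix s :: "nat \<Rightarrow> (real ^ 'q) \<times> (real ^ 'q) \<times> (real ^ 'q)" and s0 assume s0: "s0 \<in> ?S" and s: "\<forall>n. s n \<in> ?S" and lim: "s \<longlonglongrightarrow> s0"
    obtain b \<theta> x where s0': "s0 = (b, \<theta>, x)" by (cases s0)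
    have lims: "(\<lambda>n. fst (s n)) \<longlonglongrightarrow> b" "(\<lambda>n. fst (snd (s n))) \<longlonglongrightarrow> \<theta>" "(\<lambda>n. snd (snd (s n))) \<longlonglongrightarrow> x"
      using tendsto_fst[OF lim] tendsto_fst[OF tendsto_snd[OF lim]] tendsto_snd[OF tendsto_snd[OF lim]]
      by (simp_all add: s0')
    have "(\<lambda>n. \<integral>u. f (s n) u \<partial>?U) \<longlonglongrightarrow> (\<integral>u. f s0 u \<partial>?U)"
    proof (rule integral_dominated_convergence[where w = "\<lambda>_. C * (\<Prod>p\<in>v. T * K)"])
      show "AE u in ?U. (\<lambda>n. f (s n) u) \<longlonglongrightarrow> f s0 u"
      proof (rule AE_I2)
        fix u assume u: "u \<in> space ?U"
        have e: "(\<lambda>n. edge_point v (fst (s n)) u) \<longlonglongrightarrow> edge_point v b u"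
          unfolding edge_point_def
        proof (intro tendsto_vec_lambda)
          show "(\<lambda>n. if p \<in> v then fst (s n) $ p * u p else fst (s n) $ p) \<longlonglongrightarrow> (if p \<in> v then b $ p * u p else b $ p)" for p
            using lims by (cases "p \<in> v") (auto intro!: tendsto_intros)
        qed
        have "(\<lambda>n. c (edge_point v (fst (s n)) u)) \<longlonglongrightarrow> c (edge_point v b u)"
        proof (rule continuous_on_tendsto_compose[OF c e])
          show "edge_point v b u \<in> cbox 0 1"
            using s0 u by (auto simp: s0' intro: edge_point_in_cube)
          show "\<forall>\<^sub>F n in sequentially. edge_point v (fst (s n)) u \<in> cbox 0 1"
          proof (intro always_eventually allI edge_point_in_cube u)
            show "fst (s n) \<in> cbox 0 1" for n
              using s[rule_format, of n] by (cases "s n") auto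
          qed
        qed
        moreover have "(\<lambda>n. \<kappa>' p (snd (snd (s n)) $ p - fst (snd (s n)) $ p * fst (s n) $ p * u p))
            \<longlonglongrightarrow> \<kappa>' p (x $ p - \<theta> $ p * b $ p * u p)" for p
          by (rule continuous_on_tendsto_compose[OF cont_deriv]) (use lims in \<open>auto intro!: tendsto_intros\<close>)
        ultimately show "(\<lambda>n. f (s n) u) \<longlonglongrightarrow> f s0 u"
          unfolding f_def s0' case_prod_beta fst_conv snd_conv
          using lims by (intro tendsto_intros) auto
      qed
      show "AE u in ?U. norm (f (s n) u) \<le> C * (\<Prod>p\<in>v. T * K)" for n
        using bf s by (intro AE_I2) auto
    qed (use mf s s0 in auto)
    then show "((\<lambda>s. \<integral>u. f s u \<partial>?U) \<circ> s) \<longlonglongrightarrow> (\<integral>u. f s0 u \<partial>?U)"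
      by (simp add: o_def)
  qed
  moreover have "continuous_on ?S (\<lambda>s. \<Prod>p\<in>- v. \<kappa> p (snd (snd s) $ p - fst (snd s) $ p * fst s $ p))"
    by (intro continuous_intros continuous_on_compose2[OF cont]) auto
  ultimately have "continuous_on ?S (\<lambda>s. (\<integral>u. f s u \<partial>?U) * (\<Prod>p\<in>- v. \<kappa> p (snd (snd s) $ p - fst (snd s) $ p * fst s $ p)))"
    by (rule continuous_on_mult)
  then show ?thesis
    by (simp add: f_def parts_integral_def case_prod_beta)
qed

lemma continuous_parts_functional:
  assumes c: "continuous_on (cbox 0 1) c" and T: "1 \<le> T"
  shows "continuous_on (cbox 0 1 \<times> cbox 0 (\<chi> p. T) \<times> UNIV) (\<lambda>(b, \<theta>, x). parts_functional c b \<theta> x)"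
proof -
  have "continuous_on (cbox 0 1 \<times> cbox 0 (\<chi> p. T) \<times> UNIV)
      (\<lambda>s. \<Sum>v\<in>UNIV. (-1) ^ card v * (case s of (b, \<theta>, x) \<Rightarrow> parts_integral v c b \<theta> x))"
    by (intro continuous_on_sum continuous_on_mult continuous_on_const continuous_parts_integral[OF c T])
  then show ?thesis
    by (simp add: parts_functional_def case_prod_beta)
qed

text \<open>
  The discrete analogue of \<^const>\<open>RS_by_parts\<close> on the grid with spacing \<open>1 / n p\<close> and upper corner
  \<open>m p / n p\<close>: by Abel summation, it is the sum over the grid of the increments of \<open>w\<close> times the
  product of the \<open>\<kappa> p (x $ p - \<tau> p * i)\<close> if \<open>w\<close> vanishes when a coordinate is \<open>0\<close>. In this form it
  depends on the values of \<open>w\<close> only, with weights of bounded total size.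
\<close>

definition grid_functional ::
    "(real ^ 'q \<Rightarrow> real) \<Rightarrow> ('q \<Rightarrow> nat) \<Rightarrow> ('q \<Rightarrow> nat) \<Rightarrow> ('q \<Rightarrow> real) \<Rightarrow> real ^ 'q \<Rightarrow> real" where
  "grid_functional w m n \<tau> x = (\<Sum>k\<in>(\<Pi>\<^sub>E p\<in>UNIV. {..m p}). w (\<chi> p. real (k p) / real (n p)) *
     (\<Prod>p\<in>UNIV. Abel_weight (m p) (\<lambda>i. \<kappa> p (x $ p - \<tau> p * real i)) (k p)))"

lemma grid_functional_estimate:
  assumes c: "continuous_on (cbox 0 1) c"
    and mn: "\<And>p. 1 \<le> m p \<and> m p \<le> n p"
    and \<tau>: "\<And>p. 0 \<le> \<tau> p \<and> real (n p) * \<tau> p \<le> T" and T: "1 \<le> T"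
    and close: "\<And>z z'. z \<in> cbox 0 1 \<Longrightarrow> z' \<in> cbox 0 1 \<Longrightarrow> (\<And>p. \<bar>z $ p - z' $ p\<bar> \<le> 1 / real (n p)) \<Longrightarrow> \<bar>w z - c z'\<bar> \<le> \<delta>"
    and "0 \<le> \<delta>"
  shows "\<bar>grid_functional w m n \<tau> x - parts_functional c (\<chi> p. real (m p) / real (n p)) (\<chi> p. real (n p) * \<tau> p) x\<bar>
    \<le> 2 ^ CARD('q) * (\<delta> * (T * K) ^ CARD('q))"
proof -
  define b :: "real ^ 'q" where "b = (\<chi> p. real (m p) / real (n p))"
  define \<theta> :: "real ^ 'q" where "\<theta> = (\<chi> p. real (n p) * \<tau> p)"
  define S where "S v = (\<Sum>k\<in>(\<Pi>\<^sub>E p\<in>v. {..<m p}). w (\<chi> p. real (if p \<in> v then k p else m p) / real (n p)) *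
      (\<Prod>p\<in>v. \<kappa> p (x $ p - \<theta> $ p * b $ p * (real (Suc (k p)) / real (m p))) - \<kappa> p (x $ p - \<theta> $ p * b $ p * (real (k p) / real (m p))))) *
      (\<Prod>p\<in>- v. \<kappa> p (x $ p - \<theta> $ p * b $ p))" for v
  have mn0: "real (m p) \<noteq> 0" "real (n p) \<noteq> 0" "real (m p) \<le> real (n p)" for p
    using mn[of p] by auto
  have b1: "b \<in> cbox 0 1"
    using mn by (auto simp: b_def mem_box_cart divide_le_eq)
  have \<theta>b: "\<theta> $ p * b $ p * (real i / real (m p)) = \<tau> p * real i" "\<theta> $ p * b $ p = \<tau> p * real (m p)" for p i
    using mn0[of p] by (simp_all add: \<theta>_def b_def)
  have "grid_functional w m n \<tau> x = (\<Sum>v\<in>UNIV. (-1) ^ card v * S v)"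
    unfolding grid_functional_def sum_PiE_atMost_split
  proof (rule sum.cong[OF refl])
    fix v :: "'q set"
    have W: "(\<Prod>p\<in>UNIV. Abel_weight (m p) (\<lambda>i. \<kappa> p (x $ p - \<tau> p * real i)) (if p \<in> v then k p else m p))
        = (-1) ^ card v * ((\<Prod>p\<in>v. \<kappa> p (x $ p - \<tau> p * real (Suc (k p))) - \<kappa> p (x $ p - \<tau> p * real (k p))) *
          (\<Prod>p\<in>- v. \<kappa> p (x $ p - \<tau> p * real (m p))))" if k: "k \<in> (\<Pi>\<^sub>E p\<in>v. {..<m p})" for k
    proof -
      have "(\<Prod>p\<in>UNIV. Abel_weight (m p) (\<lambda>i. \<kappa> p (x $ p - \<tau> p * real i)) (if p \<in> v then k p else m p))
        = (\<Prod>p\<in>v. Abel_weight (m p) (\<lambda>i. \<kappa> p (x $ p - \<tau> p * real i)) (if p \<in> v then k p else m p)) *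
          (\<Prod>p\<in>- v. Abel_weight (m p) (\<lambda>i. \<kappa> p (x $ p - \<tau> p * real i)) (if p \<in> v then k p else m p))"
        by (subst prod.union_disjoint[symmetric]) (auto simp: Un_commute)
      also have "(\<Prod>p\<in>v. Abel_weight (m p) (\<lambda>i. \<kappa> p (x $ p - \<tau> p * real i)) (if p \<in> v then k p else m p))
        = (\<Prod>p\<in>v. - (\<kappa> p (x $ p - \<tau> p * real (Suc (k p))) - \<kappa> p (x $ p - \<tau> p * real (k p))))"
        using k by (intro prod.cong) (auto simp: Abel_weight_def dest: PiE_mem)
      also have "\<dots> = (-1) ^ card v * (\<Prod>p\<in>v. \<kappa> p (x $ p - \<tau> p * real (Suc (k p))) - \<kappa> p (x $ p - \<tau> p * real (k p)))"
        by (rule prod_uminus)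
      also have "(\<Prod>p\<in>- v. Abel_weight (m p) (\<lambda>i. \<kappa> p (x $ p - \<tau> p * real i)) (if p \<in> v then k p else m p))
        = (\<Prod>p\<in>- v. \<kappa> p (x $ p - \<tau> p * real (m p)))"
        by (intro prod.cong) (auto simp: Abel_weight_def)
      finally show ?thesis by (simp add: mult.assoc)
    qed
    show "(\<Sum>k\<in>(\<Pi>\<^sub>E p\<in>v. {..<m p}). w (\<chi> p. real (if p \<in> v then k p else m p) / real (n p)) *
        (\<Prod>p\<in>UNIV. Abel_weight (m p) (\<lambda>i. \<kappa> p (x $ p - \<tau> p * real i)) (if p \<in> v then k p else m p))) = (-1) ^ card v * S v"
      unfolding S_def \<theta>b(1) unfolding \<theta>b(2) sum_distrib_left sum_distrib_right
    proof (rule sum.cong[OF refl], goal_cases)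
      case (1 k)
      show ?case
        unfolding W[OF 1] by (simp only: mult_ac)
    qed
  qed
  then have "grid_functional w m n \<tau> x - parts_functional c b \<theta> x = (\<Sum>v\<in>UNIV. (-1) ^ card v * (S v - parts_integral v c b \<theta> x))"
    by (simp add: parts_functional_def sum_subtractf right_diff_distrib)
  also have "\<bar>\<dots>\<bar> \<le> (\<Sum>v\<in>(UNIV::'q set set). \<delta> * (T * K) ^ CARD('q))"
  proof (rule order_trans[OF sum_abs sum_mono])
    fix v :: "'q set"
    have "\<bar>S v - parts_integral v c b \<theta> x\<bar> \<le> \<delta> * (T * K) ^ CARD('q)"
      unfolding S_def
    proof (rule parts_sum_estimate[OF c b1 _ T, where y = "\<lambda>p i. real i / real (m p)"])
      fix k z
      assume k: "k \<in> (\<Pi>\<^sub>E p\<in>v. {..<m p})" and z: "z \<in> cbox 0 1"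
        and zv: "\<And>p. p \<in> v \<Longrightarrow> b $ p * (real (k p) / real (m p)) \<le> z $ p \<and> z $ p \<le> b $ p * (real (Suc (k p)) / real (m p))"
        and znv: "\<And>p. p \<notin> v \<Longrightarrow> z $ p = b $ p"
      have kp: "k p < m p" if "p \<in> v" for p
        using k that by (auto dest: PiE_mem)
      show "\<bar>w (\<chi> p. real (if p \<in> v then k p else m p) / real (n p)) - c z\<bar> \<le> \<delta>"
      proof (rule close[OF _ z])
        have "real (if p \<in> v then k p else m p) \<le> real (n p)" for p
          using kp[of p] mn0(3)[of p] by auto
        then show "(\<chi> p. real (if p \<in> v then k p else m p) / real (n p)) \<in> cbox 0 1"
          using mn by (auto simp: mem_box_cart divide_le_eq)
        fix p
        show "\<bar>(\<chi> p. real (if p \<in> v then k p else m p) / real (n p)) $ p - z $ p\<bar> \<le> 1 / real (n p)"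
        proof (cases "p \<in> v")
          case True
          have "real (k p) / real (n p) \<le> z $ p" "z $ p \<le> real (Suc (k p)) / real (n p)"
            using zv[OF True] mn0[of p] by (simp_all add: b_def)
          moreover have "real (Suc (k p)) / real (n p) = real (k p) / real (n p) + 1 / real (n p)"
            by (simp add: add_divide_distrib)
          ultimately show ?thesis
            using True by simp
        next
          case False
          then show ?thesis using znv[OF False] by (simp add: b_def)
        qed
      qed
    qed (use \<tau> mn0 \<open>0 \<le> \<delta>\<close> in \<open>auto simp: \<theta>_def divide_right_mono\<close>)
    then show "\<bar>(-1) ^ card v * (S v - parts_integral v c b \<theta> x)\<bar> \<le> \<delta> * (T * K) ^ CARD('q)"
      by (simp add: abs_mult power_abs)
  qed
  also have "\<dots> = 2 ^ CARD('q) * (\<delta> * (T * K) ^ CARD('q))"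
    using card_Pow[of "UNIV :: 'q set"] by simp
  finally show ?thesis by (simp add: b_def \<theta>_def)
qed

text \<open>
  The grid functional is close to the parts functional at the perturbed parameters \<open>m / n\<close> and \<open>n \<tau>\<close>,
  by the uniform continuity of \<open>c\<close>; and the parts functional is uniformly continuous in its parameters
  because these range over a compact set. Hence the radius \<open>d\<close> serves all locations \<open>x \<in> X\<close> and all
  paths \<open>w\<close> near \<open>c\<close> at once.
\<close>

theorem grid_functional_uniform_limit:
  assumes c: "continuous_on (cbox 0 1) c" and T: "1 \<le> T" and X: "compact X" and "0 < e"
  shows "\<exists>d>0. \<forall>w m n \<tau> b \<theta> x.
     (\<forall>p. 1 \<le> m p \<and> m p \<le> n p \<and> 0 \<le> \<tau> p \<and> real (n p) * \<tau> p \<le> T \<and> 1 / real (n p) < d \<and>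
          \<bar>real (m p) / real (n p) - b $ p\<bar> < d \<and> \<bar>real (n p) * \<tau> p - \<theta> $ p\<bar> < d) \<longrightarrow>
     b \<in> cbox 0 1 \<longrightarrow> \<theta> \<in> cbox 0 (\<chi> p. T) \<longrightarrow> x \<in> X \<longrightarrow> (\<forall>z\<in>cbox 0 1. \<bar>w z - c z\<bar> < d) \<longrightarrow>
     \<bar>grid_functional w m n \<tau> x - parts_functional c b \<theta> x\<bar> < e"
proof -
  let ?S = "cbox 0 1 \<times> cbox 0 (\<chi> p. T) \<times> X"
  define D where "D = 2 ^ CARD('q) * (T * K) ^ CARD('q)"
  have D: "0 < D" using T K by (simp add: D_def)
  define \<delta> where "\<delta> = e / (4 * D)"
  have \<delta>: "0 < \<delta>" "2 * \<delta> * D = e / 2"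
    using \<open>0 < e\<close> D by (auto simp: \<delta>_def)
  have "uniformly_continuous_on (cbox 0 1) c"
    by (intro compact_uniformly_continuous c compact_cbox)
  then obtain d1 where d1: "d1 > 0" "\<And>z z'. z \<in> cbox 0 1 \<Longrightarrow> z' \<in> cbox 0 1 \<Longrightarrow> dist z z' < d1 \<Longrightarrow> dist (c z) (c z') < \<delta>"
    using \<delta>(1) unfolding uniformly_continuous_on_def by meson
  have "continuous_on ?S (\<lambda>(b, \<theta>, x). parts_functional c b \<theta> x)"
    by (rule continuous_on_subset[OF continuous_parts_functional[OF c T]]) auto
  then have "uniformly_continuous_on ?S (\<lambda>(b, \<theta>, x). parts_functional c b \<theta> x)"
    by (intro compact_uniformly_continuous compact_Times compact_cbox X)
  then obtain d2 where d2: "d2 > 0" "\<And>s s'. s \<in> ?S \<Longrightarrow> s' \<in> ?S \<Longrightarrow> dist s s' < d2 \<Longrightarrow>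
      dist (case s of (b, \<theta>, x) \<Rightarrow> parts_functional c b \<theta> x) (case s' of (b, \<theta>, x) \<Rightarrow> parts_functional c b \<theta> x) < e / 2"
    using \<open>0 < e\<close> unfolding uniformly_continuous_on_def by (metis half_gt_zero)
  define d where "d = min \<delta> (min (d1 / CARD('q)) (d2 / (2 * CARD('q))))"
  have d: "0 < d" "d \<le> \<delta>" "CARD('q) * d \<le> d1" "2 * (CARD('q) * d) \<le> d2"
    using \<delta> d1(1) d2(1) by (auto simp: d_def min_def field_simps)
  have dist_le: "dist z z' < CARD('q) * r" if "\<And>p. \<bar>z $ p - z' $ p\<bar> < r" for z z' :: "real ^ 'q" and r :: real
  proof -
    have "(\<Sum>p\<in>UNIV. \<bar>(z - z') $ p\<bar>) < (\<Sum>p\<in>(UNIV::'q set). r)"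
      using that by (intro sum_strict_mono) auto
    then show ?thesis
      using norm_le_l1_cart[of "z - z'"] by (simp add: dist_norm)
  qed
  show ?thesis
  proof (intro exI[of _ d] conjI d(1) allI impI)
    fix w m n \<tau> and b \<theta> x :: "real ^ 'q"
    assume A: "\<forall>p. 1 \<le> m p \<and> m p \<le> n p \<and> 0 \<le> \<tau> p \<and> real (n p) * \<tau> p \<le> T \<and> 1 / real (n p) < d \<and>
          \<bar>real (m p) / real (n p) - b $ p\<bar> < d \<and> \<bar>real (n p) * \<tau> p - \<theta> $ p\<bar> < d"
      and b: "b \<in> cbox 0 1" and \<theta>: "\<theta> \<in> cbox 0 (\<chi> p. T)" and x: "x \<in> X"
      and w: "\<forall>z\<in>cbox 0 1. \<bar>w z - c z\<bar> < d"
    define b' :: "real ^ 'q" where "b' = (\<chi> p. real (m p) / real (n p))"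
    define \<theta>' :: "real ^ 'q" where "\<theta>' = (\<chi> p. real (n p) * \<tau> p)"
    have "\<bar>grid_functional w m n \<tau> x - parts_functional c b' \<theta>' x\<bar> \<le> 2 ^ CARD('q) * (2 * \<delta> * (T * K) ^ CARD('q))"
      unfolding b'_def \<theta>'_def
    proof (rule grid_functional_estimate[OF c _ _ T])
      fix z z' :: "real ^ 'q" assume z: "z \<in> cbox 0 1" "z' \<in> cbox 0 1" "\<And>p. \<bar>z $ p - z' $ p\<bar> \<le> 1 / real (n p)"
      then have "dist z z' < CARD('q) * d"
        using A by (intro dist_le) (meson le_less_trans)
      then have "\<bar>c z - c z'\<bar> < \<delta>"
        using d1(2)[OF z(1,2)] d(3) by (simp add: dist_real_def)
      moreover have "\<bar>w z - c z\<bar> < \<delta>"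
        using w z(1) d(2) by force
      ultimately show "\<bar>w z - c z'\<bar> \<le> 2 * \<delta>"
        by linarith
    qed (use A \<delta> in auto)
    also have "\<dots> = e / 2"
      using \<delta>(2) by (simp add: D_def mult_ac)
    finally have 1: "\<bar>grid_functional w m n \<tau> x - parts_functional c b' \<theta>' x\<bar> \<le> e / 2" .
    have "dist b' b < CARD('q) * d" "dist \<theta>' \<theta> < CARD('q) * d"
      using A by (auto simp: b'_def \<theta>'_def intro!: dist_le)
    then have "dist (b', \<theta>', x) (b, \<theta>, x) < d2"
      using d(4) sqrt_sum_squares_le_sum_abs[of "dist b' b" "dist \<theta>' \<theta>"] by (simp add: dist_Pair_Pair)
    moreover have "b' \<in> cbox 0 1"
      using A by (auto simp: b'_def mem_box_cart divide_le_eq)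
    moreover have "\<theta>' \<in> cbox 0 (\<chi> p. T)"
      using A by (auto simp: \<theta>'_def mem_box_cart)
    ultimately have "\<bar>parts_functional c b' \<theta>' x - parts_functional c b \<theta> x\<bar> < e / 2"
      using d2(2)[of "(b', \<theta>', x)" "(b, \<theta>, x)"] b \<theta> x by (simp add: dist_real_def)
    with 1 show "\<bar>grid_functional w m n \<tau> x - parts_functional c b \<theta> x\<bar> < e"
      by linarith
  qed
qed

end

section \<open>Smoothness of the sinc kernel\<close>

definition sinc_deriv :: "real \<Rightarrow> real" where
  "sinc_deriv x = (if x = 0 then 0 else (x * cos x - sin x) / x\<^sup>2)"

lemma DERIV_sinc: "(sinc has_real_derivative sinc_deriv x) (at x)"
proof (cases "x = 0")
  case True
  have "((\<lambda>h. (sin h / h - 1) / h) \<longlongrightarrow> 0) (at (0::real))"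
    by real_asymp
  then have "((\<lambda>h. (sinc (0 + h) - sinc 0) / h) \<longlongrightarrow> 0) (at 0)"
    by (rule Lim_transform_eventually) (auto simp: eventually_at_filter)
  then show ?thesis
    using True by (simp add: DERIV_def sinc_deriv_def)
next
  case False
  have "((\<lambda>x. sin x / x) has_real_derivative sinc_deriv x) (at x)"
    using False by (auto intro!: derivative_eq_intros simp: sinc_deriv_def power2_eq_square mult.commute)
  then show ?thesis
    by (rule has_field_derivative_transform_within_open[where S = "- {0}"]) (use False in auto)
qed

lemma isCont_sinc_deriv: "isCont sinc_deriv x"
proof (cases "x = 0")
  case True
  have "((\<lambda>x. (x * cos x - sin x) / x\<^sup>2) \<longlongrightarrow> 0) (at (0::real))"
    by real_asymp
  then have "(sinc_deriv \<longlongrightarrow> 0) (at 0)"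
    by (rule Lim_transform_eventually) (auto simp: eventually_at_filter sinc_deriv_def)
  then show ?thesis
    using True by (simp add: isCont_def sinc_deriv_def)
next
  case False
  have "isCont (\<lambda>x. (x * cos x - sin x) / x\<^sup>2) x"
    using False by (intro continuous_intros) auto
  moreover have "\<forall>\<^sub>F y in nhds x. sinc_deriv y = (y * cos y - sin y) / y\<^sup>2"
    using eventually_nhds_in_open[of "- {0}" x] False
    by (auto elim!: eventually_mono simp: sinc_deriv_def)
  ultimately show ?thesis
    using isCont_cong[of sinc_deriv "\<lambda>x. (x * cos x - sin x) / x\<^sup>2" x] by blast
qed

text \<open>
  On \<open>[-1, 1]\<close> by compactness; outside, the numerator is at most \<open>2 * \<bar>x\<bar>\<close> and the denominator is
  at least \<open>\<bar>x\<bar>\<close>.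
\<close>

lemma bounded_sinc_deriv: "\<exists>C. \<forall>x. \<bar>sinc_deriv x\<bar> \<le> C"
proof -
  have "bounded (sinc_deriv ` {-1..1})"
    by (intro compact_imp_bounded compact_continuous_image continuous_at_imp_continuous_on ballI isCont_sinc_deriv)
      simp
  then obtain C where C: "\<And>x. x \<in> {-1..1} \<Longrightarrow> \<bar>sinc_deriv x\<bar> \<le> C"
    unfolding bounded_iff by (metis image_eqI real_norm_def)
  have "\<bar>sinc_deriv x\<bar> \<le> max C 2" for x
  proof (cases "\<bar>x\<bar> \<le> 1")
    case True
    then show ?thesis using C[of x] by (auto simp: abs_le_iff le_max_iff_disj)
  next
    case False
    have "\<bar>x * cos x - sin x\<bar> \<le> \<bar>x\<bar> * \<bar>cos x\<bar> + \<bar>sin x\<bar>"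
      by (metis abs_mult abs_triangle_ineq4)
    also have "\<dots> \<le> \<bar>x\<bar> * 1 + \<bar>x\<bar>"
      using False by (intro add_mono mult_left_mono abs_cos_le_one abs_sin_x_le_abs_x) auto
    also have "\<dots> \<le> 2 * x\<^sup>2"
      using False self_le_power[of "\<bar>x\<bar>" 2] by simp
    finally have "\<bar>sinc_deriv x\<bar> \<le> 2"
      using False by (simp add: sinc_deriv_def abs_divide divide_le_eq)
    then show ?thesis by simp
  qed
  then show ?thesis by blast
qed

lemma abs_sinc_le_1: "\<bar>sinc x\<bar> \<le> 1"
  using abs_sin_x_le_abs_x[of x] by (simp add: abs_divide divide_le_eq)

definition kernel_factor :: "real ^ 3 \<Rightarrow> 3 \<Rightarrow> real \<Rightarrow> real" where
  "kernel_factor \<Omega> j y = \<Omega> $ j / pi * sinc (\<Omega> $ j * y)"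

lemma kernel_eq_prod:
  assumes "\<And>j. 0 < \<Omega> $ j"
  shows "kernel \<Omega> x = (\<Prod>j\<in>UNIV. kernel_factor \<Omega> j (x $ j))"
  unfolding kernel_def kernel_factor_def
proof (rule prod.cong[OF refl])
  fix j :: 3
  show "(if x $ j = 0 then \<Omega> $ j / pi else sin (\<Omega> $ j * x $ j) / (pi * x $ j)) =
      \<Omega> $ j / pi * sinc (\<Omega> $ j * x $ j)"
    using assms[of j] by (simp add: field_simps)
qed

lemma smooth_factors_kernel:
  assumes \<Omega>: "\<And>j. 0 < \<Omega> $ j"
  shows "\<exists>\<kappa>' K. smooth_factors (kernel_factor \<Omega>) \<kappa>' K"
proof -
  obtain C where C: "\<And>x. \<bar>sinc_deriv x\<bar> \<le> C"
    using bounded_sinc_deriv by blast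
  have C0: "0 \<le> C" using C[of 0] by linarith
  define K where "K = 1 + (\<Sum>j\<in>UNIV. \<Omega> $ j / pi + (\<Omega> $ j)\<^sup>2 / pi * C)"
  have pos: "0 \<le> \<Omega> $ j / pi" "0 \<le> (\<Omega> $ j)\<^sup>2 / pi * C" for j
    using \<Omega>[of j] C0 by simp_all
  have "\<Omega> $ j / pi + (\<Omega> $ j)\<^sup>2 / pi * C \<le> K - 1" for j
    unfolding K_def using pos by (simp, intro member_le_sum) (auto intro: add_nonneg_nonneg)
  then have K: "\<Omega> $ j / pi \<le> K" "(\<Omega> $ j)\<^sup>2 / pi * C \<le> K" for j
    using pos[of j] by (smt (verit))+
  show ?thesis
  proof (intro exI[of _ K] exI[of _ "\<lambda>j y. (\<Omega> $ j)\<^sup>2 / pi * sinc_deriv (\<Omega> $ j * y)"], unfold_locales)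
    fix p :: 3 and y :: real
    have "((\<lambda>y. \<Omega> $ p * y) has_real_derivative \<Omega> $ p) (at y)"
      by (auto intro!: derivative_eq_intros)
    from DERIV_cmult[OF DERIV_chain2[OF DERIV_sinc this], of "\<Omega> $ p / pi"]
    show "(kernel_factor \<Omega> p has_real_derivative (\<Omega> $ p)\<^sup>2 / pi * sinc_deriv (\<Omega> $ p * y)) (at y)"
      unfolding kernel_factor_def[abs_def] by (rule DERIV_cong) (simp add: power2_eq_square)
    show "continuous_on UNIV (\<lambda>y. (\<Omega> $ p)\<^sup>2 / pi * sinc_deriv (\<Omega> $ p * y))"
      by (intro continuous_intros continuous_on_compose2[OF continuous_at_imp_continuous_on[of UNIV sinc_deriv]])
        (auto simp: isCont_sinc_deriv)
    have "\<bar>kernel_factor \<Omega> p y\<bar> \<le> \<Omega> $ p / pi * 1"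
      unfolding kernel_factor_def abs_mult using pos(1)[of p]
      by (intro mult_mono abs_sinc_le_1) auto
    then show "\<bar>kernel_factor \<Omega> p y\<bar> \<le> K"
      using K(1)[of p] by simp
    have "\<bar>(\<Omega> $ p)\<^sup>2 / pi * sinc_deriv (\<Omega> $ p * y)\<bar> \<le> (\<Omega> $ p)\<^sup>2 / pi * C"
      unfolding abs_mult by (intro mult_mono C) auto
    then show "\<bar>(\<Omega> $ p)\<^sup>2 / pi * sinc_deriv (\<Omega> $ p * y)\<bar> \<le> K"
      using K(2)[of p] by simp
    show "1 \<le> K"
      unfolding K_def using pos by (simp add: sum_nonneg)
  qed
qed

section \<open>Piecewise continuous paths in the Skorohod space\<close>

text \<open>
  Inside a quadrant, coordinate \<open>p\<close> approaches \<open>t $ p\<close> from one side only, and \<open>floor\<close> has one-sided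
  limits: from the right its value at \<open>c * t $ p\<close>, from the left, for \<open>c > 0\<close>, the value \<open>\<lceil>c * t $ p\<rceil> - 1\<close>.
\<close>

lemma floor_constant_in_quadrant:
  assumes "0 \<le> c"
  shows "\<exists>m. \<forall>\<^sub>F x in at t within quadrant a b t R. \<lfloor>c * x $ p\<rfloor> = m"
proof -
  let ?F = "at t within quadrant a b t R"
  have lim: "((\<lambda>x. c * x $ p) \<longlongrightarrow> c * t $ p) ?F"
    by (intro tendsto_intros)
  have Q: "\<forall>\<^sub>F x in ?F. x \<in> quadrant a b t R"
    by (simp add: eventually_at_filter)
  show ?thesis
  proof (cases "p \<in> R \<or> c = 0")
    case True
    have "\<forall>\<^sub>F x in ?F. c * x $ p < of_int \<lfloor>c * t $ p\<rfloor> + 1"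
      by (rule order_tendstoD(2)[OF lim]) linarith
    with Q have "\<forall>\<^sub>F x in ?F. \<lfloor>c * x $ p\<rfloor> = \<lfloor>c * t $ p\<rfloor>"
    proof eventually_elim
      case (elim x)
      have "c * t $ p \<le> c * x $ p"
        using True elim(1) assms unfolding quadrant_def
        by (cases "c = 0") (auto intro!: mult_left_mono split: if_splits)
      then show ?case
        using elim(2) by (intro floor_unique) linarith+
    qed
    then show ?thesis by blast
  next
    case False
    have "\<forall>\<^sub>F x in ?F. of_int (\<lceil>c * t $ p\<rceil> - 1) < c * x $ p"
      by (rule order_tendstoD(1)[OF lim]) linarith
    with Q have "\<forall>\<^sub>F x in ?F. \<lfloor>c * x $ p\<rfloor> = \<lceil>c * t $ p\<rceil> - 1"
    proof eventually_elim
      case (elim x)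
      have "x $ p < t $ p"
        using False elim(1) unfolding quadrant_def by (auto split: if_splits)
      then have "c * x $ p < c * t $ p"
        using False assms by (intro mult_strict_left_mono) auto
      then show ?case
        using elim(2) by (intro floor_unique) linarith+
    qed
    then show ?thesis by blast
  qed
qed

lemma skorohod_space_floor_piecewise:
  assumes "0 \<le> c" and F: "\<And>m. continuous_on (cbox a b) (F m)"
  shows "restrict (\<lambda>x. F \<lfloor>c * x $ p\<rfloor> x) (cbox a b) \<in> skorohod_space a b"
  unfolding skorohod_space_def
proof (intro CollectI conjI ballI allI)
  fix t R assume t: "t \<in> cbox a b"
  let ?f = "restrict (\<lambda>x. F \<lfloor>c * x $ p\<rfloor> x) (cbox a b)"
  have lim: "(?f \<longlongrightarrow> F m t) (at t within quadrant a b t R)"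
    if m: "\<forall>\<^sub>F x in at t within quadrant a b t R. \<lfloor>c * x $ p\<rfloor> = m" for m R
  proof (rule Lim_transform_eventually)
    have "(F m \<longlongrightarrow> F m t) (at t within cbox a b)"
      using F t by (simp add: continuous_on_def)
    then show "(F m \<longlongrightarrow> F m t) (at t within quadrant a b t R)"
      by (rule tendsto_within_subset) (auto simp: quadrant_def)
    have "\<forall>\<^sub>F x in at t within quadrant a b t R. x \<in> quadrant a b t R"
      by (simp add: eventually_at_filter)
    with m show "\<forall>\<^sub>F x in at t within quadrant a b t R. F m x = ?f x"
      by eventually_elim (auto simp: quadrant_def)
  qed
  show "\<exists>l. (?f \<longlongrightarrow> l) (at t within quadrant a b t R)"
    using lim floor_constant_in_quadrant[OF \<open>0 \<le> c\<close>] by blast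
  have "\<forall>\<^sub>F x in at t within quadrant a b t UNIV. c * x $ p < of_int \<lfloor>c * t $ p\<rfloor> + 1"
    by (rule order_tendstoD(2)[of _ "c * t $ p"]) (intro tendsto_intros, linarith)
  moreover have "\<forall>\<^sub>F x in at t within quadrant a b t UNIV. x \<in> quadrant a b t UNIV"
    by (simp add: eventually_at_filter)
  ultimately have "\<forall>\<^sub>F x in at t within quadrant a b t UNIV. \<lfloor>c * x $ p\<rfloor> = \<lfloor>c * t $ p\<rfloor>"
  proof eventually_elim
    case (elim x)
    have "c * t $ p \<le> c * x $ p"
      using elim(2) \<open>0 \<le> c\<close> unfolding quadrant_def by (auto intro!: mult_left_mono)
    then show ?case
      using elim(1) by (intro floor_unique) linarith+
  qed
  from lim[OF this] show "(?f \<longlongrightarrow> ?f t) (at t within quadrant a b t UNIV)"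
    using t by simp
qed auto

lemma skorohod_space_continuous:
  "continuous_on (cbox a b) f \<Longrightarrow> restrict f (cbox a b) \<in> skorohod_space a b"
  using skorohod_space_floor_piecewise[of 0 a b "\<lambda>_. f"] by simp

text \<open>
  The map from the coefficients to the path is continuous even for the uniform distance of paths, and
  the coefficients range over a space with a countable base.
\<close>

lemma measurable_skorohod_combination:
  fixes g :: "'i::countable \<Rightarrow> real ^ 'q \<Rightarrow> real"
  assumes I: "finite I" and g: "\<And>i x. i \<in> I \<Longrightarrow> x \<in> cbox a b \<Longrightarrow> \<bar>g i x\<bar> \<le> C"
    and D: "\<And>c. restrict (\<lambda>x. \<Sum>i\<in>I. c i * g i x) (cbox a b) \<in> skorohod_space a b"
    and Y: "\<And>i. i \<in> I \<Longrightarrow> Y i \<in> borel_measurable M"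
  shows "(\<lambda>\<omega>. restrict (\<lambda>x. \<Sum>i\<in>I. Y i \<omega> * g i x) (cbox a b)) \<in> M \<rightarrow>\<^sub>M skorohod_borel a b"
proof -
  define path where "path c = restrict (\<lambda>x. \<Sum>i\<in>I. c i * g i x) (cbox a b)" for c :: "'i \<Rightarrow> real"
  define Y' where "Y' \<omega> = (\<lambda>i. if i \<in> I then Y i \<omega> else 0)" for \<omega>
  have Y': "Y' \<in> borel_measurable M"
  proof (rule measurable_coordinatewise_then_product)
    show "(\<lambda>\<omega>. Y' \<omega> i) \<in> borel_measurable M" for i
      unfolding Y'_def using Y by (cases "i \<in> I") auto
  qed
  have "path \<in> borel \<rightarrow>\<^sub>M skorohod_borel a b"
    unfolding skorohod_borel_def
  proof (rule measurable_measure_of)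
    show "path \<in> space borel \<rightarrow> skorohod_space a b"
      using D by (auto simp: path_def)
    fix U assume "U \<in> {U. openin (skorohod_topology a b) U}"
    then have U: "openin (skorohod_topology a b) U" by simp
    have "open (path -` U)"
    proof (subst open_subopen, intro ballI)
      fix c assume "c \<in> path -` U"
      then obtain e where e: "e > 0" "skorohod_ball a b (path c) e \<subseteq> U"
        using U unfolding openin_skorohod by auto
      define V where "V = {c' :: 'i \<Rightarrow> real. (\<Sum>i\<in>I. \<bar>c' i - c i\<bar>) * \<bar>C\<bar> < e}"
      have "open V"
        unfolding V_def by (intro open_Collect_less continuous_intros continuous_on_product_coordinates)
      moreover have "c \<in> V" using e by (simp add: V_def)
      moreover have "V \<subseteq> path -` U"
      proof
        fix c' assume c': "c' \<in> V"
        have "path c' \<in> skorohod_ball a b (path c) e"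
        proof (rule skorohod_ball_uniform[OF _ e(1)])
          show "path c' \<in> skorohod_space a b"
            using D by (simp add: path_def)
          fix x assume x: "x \<in> cbox a b"
          have "\<bar>path c' x - path c x\<bar> = \<bar>\<Sum>i\<in>I. (c' i - c i) * g i x\<bar>"
            using x by (simp add: path_def sum_subtractf left_diff_distrib)
          also have "\<dots> \<le> (\<Sum>i\<in>I. \<bar>c' i - c i\<bar> * \<bar>C\<bar>)"
          proof (rule order_trans[OF sum_abs sum_mono])
            fix i assume "i \<in> I"
            then show "\<bar>(c' i - c i) * g i x\<bar> \<le> \<bar>c' i - c i\<bar> * \<bar>C\<bar>"
              unfolding abs_mult using g[OF _ x, of i] by (intro mult_left_mono) auto
          qed
          also have "\<dots> < e"
            using c' by (simp add: V_def sum_distrib_right)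
          finally show "\<bar>path c' x - path c x\<bar> < e" .
        qed
        then show "c' \<in> path -` U" using e(2) by blast
      qed
      ultimately show "\<exists>T. open T \<and> c \<in> T \<and> T \<subseteq> path -` U" by blast
    qed
    then show "path -` U \<inter> space borel \<in> sets borel" by simp
  qed (auto simp: openin_skorohod)
  from measurable_compose[OF Y' this] show ?thesis
    by (simp add: path_def Y'_def cong: sum.cong)
qed

lemma skorohod_continuous_uniform:
  assumes h: "continuous_map (skorohod_topology a b) euclideanreal h" and f: "f \<in> skorohod_space a b" and "0 < \<epsilon>"
  shows "\<exists>e>0. \<forall>g\<in>skorohod_space a b. (\<forall>x\<in>cbox a b. \<bar>g x - f x\<bar> < e) \<longrightarrow> \<bar>h g - h f\<bar> < \<epsilon>"
  using continuous_map_skorohodD[OF h f \<open>0 < \<epsilon>\<close>] skorohod_ball_uniform by metis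

text \<open>
  Near a continuous path, Skorohod closeness is uniform closeness: a small time change moves the values
  of a uniformly continuous function only a little.
\<close>

lemma skorohod_ball_uniform_at_continuous:
  assumes c: "continuous_on (cbox a b) c" and "0 < \<epsilon>"
  shows "\<exists>d>0. \<forall>w\<in>skorohod_ball a b c d. \<forall>x\<in>cbox a b. \<bar>w x - c x\<bar> < \<epsilon>"
proof -
  have "uniformly_continuous_on (cbox a b) c"
    by (intro compact_uniformly_continuous c compact_cbox)
  then obtain d where d: "d > 0" "\<And>x y. x \<in> cbox a b \<Longrightarrow> y \<in> cbox a b \<Longrightarrow> dist x y < d \<Longrightarrow> dist (c x) (c y) < \<epsilon> / 2"
    using \<open>0 < \<epsilon>\<close> unfolding uniformly_continuous_on_def by (metis half_gt_zero)
  show ?thesis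
  proof (intro exI[of _ "min d (\<epsilon> / 2)"] conjI ballI)
    fix w x assume w: "w \<in> skorohod_ball a b c (min d (\<epsilon> / 2))" and x: "x \<in> cbox a b"
    obtain tc where tc: "time_change a b tc" "norm (apply_tc tc x - x) < min d (\<epsilon> / 2)"
        "\<bar>w x - c (apply_tc tc x)\<bar> < min d (\<epsilon> / 2)"
      using w x unfolding skorohod_ball_def by blast
    have "\<bar>c (apply_tc tc x) - c x\<bar> < \<epsilon> / 2"
      using d(2)[OF apply_tc_in_box[OF tc(1) x] x] tc(2) by (simp add: dist_norm)
    then show "\<bar>w x - c x\<bar> < \<epsilon>"
      using tc(3) by linarith
  qed (use d \<open>0 < \<epsilon>\<close> in auto)
qed

section \<open>The monitoring functional on the grid\<close>

text \<open>
  The number of observations used along each axis when the first axis is observed up to index \<open>i\<close>.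
\<close>

definition grid_size :: "nat ^ 3 \<Rightarrow> int \<Rightarrow> 3 \<Rightarrow> nat" where
  "grid_size n i p = (if p = 1 then nat i else n $ p)"

definition window :: "real ^ 4 \<Rightarrow> real ^ 3" where
  "window x = (\<chi> p. if p = 1 then x $ 1 else 1)"

definition location :: "real ^ 4 \<Rightarrow> real ^ 3" where
  "location x = (\<chi> p. if p = 1 then x $ 2 else if p = 2 then x $ 3 else x $ 4)"

lemma window_eq_vector: "window x = vector [x $ 1, 1, 1]"
  by (simp add: window_def vec_eq_iff forall_3)

lemma location_eq_vector: "location x = vector [x $ 2, x $ 3, x $ 4]"
  by (simp add: location_def vec_eq_iff forall_3)

lemma continuous_window: "continuous_on S window"
  unfolding window_def
proof (intro continuous_on_vec_lambda)
  show "continuous_on S (\<lambda>x::real ^ 4. if p = 1 then x $ 1 else 1)" for p :: 3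
    by (cases "p = 1") (auto intro!: continuous_intros)
qed

lemma continuous_location: "continuous_on S location"
  unfolding location_def
proof (intro continuous_on_vec_lambda)
  show "continuous_on S (\<lambda>x::real ^ 4. if p = 1 then x $ 2 else if p = 2 then x $ 3 else x $ 4)" for p :: 3
    by (cases "p = 1"; cases "p = 2") (auto intro!: continuous_intros)
qed

lemma sum_int_triple_eq_sum_PiE:
  fixes F :: "int ^ 3 \<Rightarrow> real"
  shows "(\<Sum>i\<^sub>1 = 1..int (m 1). \<Sum>i\<^sub>2 = 1..int (m 2). \<Sum>i\<^sub>3 = 1..int (m 3). F (vector [i\<^sub>1, i\<^sub>2, i\<^sub>3]))
    = (\<Sum>l\<in>(\<Pi>\<^sub>E p\<in>UNIV. {1..m p}). F (\<chi> p. int (l p)))"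
proof -
  have "(\<Sum>i\<^sub>1 = 1..int (m 1). \<Sum>i\<^sub>2 = 1..int (m 2). \<Sum>i\<^sub>3 = 1..int (m 3). F (vector [i\<^sub>1, i\<^sub>2, i\<^sub>3]))
      = (\<Sum>(i\<^sub>1, i\<^sub>2, i\<^sub>3)\<in>{1..int (m 1)} \<times> {1..int (m 2)} \<times> {1..int (m 3)}. F (vector [i\<^sub>1, i\<^sub>2, i\<^sub>3]))"
    by (simp add: sum.cartesian_product)
  also have "\<dots> = (\<Sum>l\<in>(\<Pi>\<^sub>E p\<in>UNIV. {1..m p}). F (\<chi> p. int (l p)))"
  proof (rule sum.reindex_bij_witness[where
        i = "\<lambda>l. (int (l 1), int (l 2), int (l 3))" and
        j = "\<lambda>(i\<^sub>1, i\<^sub>2, i\<^sub>3) p. nat (if p = 1 then i\<^sub>1 else if p = 2 then i\<^sub>2 else i\<^sub>3)"], goal_cases)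
    case (2 a)
    then show ?case
      by (cases a) (auto simp: PiE_iff forall_3 nat_le_iff Suc_le_eq)
  next
    case (3 l)
    then show ?case
      by (simp add: fun_eq_iff forall_3)
  next
    case (4 l)
    then show ?case
      by (auto simp: PiE_iff Suc_le_eq)
  next
    case (5 a)
    have "(\<chi> p. int (nat (if p = 1 then i\<^sub>1 else if p = 2 then i\<^sub>2 else i\<^sub>3))) = (vector [i\<^sub>1, i\<^sub>2, i\<^sub>3] :: int ^ 3)"
      if "1 \<le> i\<^sub>1" "1 \<le> i\<^sub>2" "1 \<le> i\<^sub>3" for i\<^sub>1 i\<^sub>2 i\<^sub>3 :: int
      using that by (simp add: vec_eq_iff forall_3)
    with 5 show ?case by auto
  qed auto
  finally show ?thesis .
qed

lemma partial_sum_process_grid: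
  assumes "\<And>p. 0 < n $ p"
  shows "partial_sum_process \<epsilon> n \<omega> (\<chi> p. real (k p) / real (n $ p)) =
    real (n $ 1 * n $ 2 * n $ 3) powr (-1/2) * (\<Sum>l\<in>(\<Pi>\<^sub>E p\<in>UNIV. {1..k p}). \<epsilon> (\<chi> p. int (l p)) \<omega>)"
proof -
  have fl: "\<lfloor>real (n $ p) * (\<chi> p. real (k p) / real (n $ p)) $ p\<rfloor> = int (k p)" for p
    using assms[of p] by simp
  show ?thesis
    unfolding partial_sum_process_def fl by (simp only: sum_int_triple_eq_sum_PiE[of "\<lambda>i. \<epsilon> i \<omega>" k])
qed

context smooth_factors
begin

lemma continuous_Abel_weight:
  "continuous_on UNIV (\<lambda>y. Abel_weight m (\<lambda>i. \<kappa> p (y - \<tau> * real i)) k)"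
  unfolding Abel_weight_def
  by (cases "k < m") (auto intro!: continuous_intros continuous_on_compose2[OF cont])

lemma Abel_weight_bound: "\<bar>Abel_weight m (\<lambda>i. \<kappa> p (y i)) k\<bar> \<le> 2 * K"
proof -
  have "\<bar>\<kappa> p (y i)\<bar> \<le> K" for i by (rule bound)
  from this[of k] this[of "Suc k"] this[of m] show ?thesis
    using K unfolding Abel_weight_def by (auto simp: abs_le_iff) 
qed

lemma parts_functional_scale:
  "parts_functional (\<lambda>z. s * c z) b \<theta> x = s * parts_functional c b \<theta> x"
proof -
  have "parts_integral v (\<lambda>z. s * c z) b \<theta> x = s * parts_integral v c b \<theta> x" for v
    by (simp add: parts_integral_def mult.assoc)
  then show ?thesis
    by (simp add: parts_functional_def sum_distrib_left mult_ac)
qed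

end

locale smooth_factors_3 = smooth_factors \<kappa> \<kappa>' K for \<kappa> \<kappa>' :: "3 \<Rightarrow> real \<Rightarrow> real" and K :: real
begin

text \<open>
  The monitoring process as a functional of the path \<open>w\<close> of the partial sum process. Under the
  root, the product of the sampling periods is multiplied by the number of observations, which undoes
  the normalisation of the partial sums.
\<close>

definition monitor_functional ::
    "(real ^ 3 \<Rightarrow> real) \<Rightarrow> nat ^ 3 \<Rightarrow> (3 \<Rightarrow> real) \<Rightarrow> real ^ 4 \<Rightarrow> real" where
  "monitor_functional w n \<tau> x = sqrt (\<Prod>p\<in>UNIV. real (n $ p) * \<tau> p) *
     grid_functional w (grid_size n \<lfloor>real (n $ 1) * x $ 1\<rfloor>) (($) n) \<tau> (location x)"

definition limit_functional :: "(real ^ 3 \<Rightarrow> real) \<Rightarrow> real ^ 3 \<Rightarrow> real ^ 4 \<Rightarrow> real" where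
  "limit_functional c \<theta> x = sqrt (\<Prod>p\<in>UNIV. \<theta> $ p) * parts_functional c (window x) \<theta> (location x)"

text \<open>
  The coefficient of the value of \<open>w\<close> at the grid point \<open>k\<close>, as a function on the parameter box, with
  the number \<open>i\<close> of observation planes used as a separate argument. It is continuous for fixed \<open>i\<close>, so
  the paths jump only where the number of planes does.
\<close>

definition path_basis :: "nat ^ 3 \<Rightarrow> (3 \<Rightarrow> real) \<Rightarrow> (3 \<Rightarrow> nat) \<Rightarrow> int \<Rightarrow> real ^ 4 \<Rightarrow> real" where
  "path_basis n \<tau> k i x = (if \<forall>p. k p \<le> grid_size n i p then sqrt (\<Prod>p\<in>UNIV. real (n $ p) * \<tau> p) *
     (\<Prod>p\<in>UNIV. Abel_weight (grid_size n i p) (\<lambda>j. \<kappa> p (location x $ p - \<tau> p * real j)) (k p)) else 0)"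

text \<open>
  The set of grid points that enter depends on \<open>x\<close>. Extending the sum to the full grid with zero
  coefficients gives a linear combination of fixed functions of \<open>x\<close>, from which measurability and
  membership in the Skorohod space can be read off.
\<close>

lemma monitor_functional_eq:
  assumes "x $ 1 \<le> 1"
  shows "monitor_functional w n \<tau> x = (\<Sum>k\<in>(\<Pi>\<^sub>E p\<in>UNIV. {..n $ p}).
    w (\<chi> p. real (k p) / real (n $ p)) * path_basis n \<tau> k \<lfloor>real (n $ 1) * x $ 1\<rfloor> x)"
proof -
  let ?m = "grid_size n \<lfloor>real (n $ 1) * x $ 1\<rfloor>"
  have "\<lfloor>real (n $ 1) * x $ 1\<rfloor> \<le> \<lfloor>real (n $ 1)\<rfloor>"
    using assms by (intro floor_mono) (simp add: mult_left_le)
  then have m: "?m p \<le> n $ p" for p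
    by (auto simp: grid_size_def nat_le_iff)
  have "(\<Pi>\<^sub>E p\<in>UNIV. {..?m p}) = {k \<in> \<Pi>\<^sub>E p\<in>UNIV. {..n $ p}. \<forall>p. k p \<le> ?m p}"
    using m by (auto simp: PiE_iff intro: order_trans)
  moreover have "finite (\<Pi>\<^sub>E p\<in>UNIV. {..n $ p})"
    by (auto intro!: finite_PiE)
  ultimately show ?thesis
    by (simp add: monitor_functional_def grid_functional_def path_basis_def sum.inter_filter
        sum_distrib_left mult_ac if_distrib[of "\<lambda>t. _ * t"] cong: if_cong)
qed

lemma path_basis_bound:
  "\<bar>path_basis n \<tau> k i x\<bar> \<le> \<bar>sqrt (\<Prod>p\<in>UNIV. real (n $ p) * \<tau> p)\<bar> * (\<Prod>p\<in>(UNIV::3 set). 2 * K)"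
proof -
  have "\<bar>\<Prod>p\<in>UNIV. Abel_weight (grid_size n i p) (\<lambda>j. \<kappa> p (location x $ p - \<tau> p * real j)) (k p)\<bar> \<le> (\<Prod>p\<in>(UNIV::3 set). 2 * K)"
    unfolding abs_prod by (intro prod_mono conjI Abel_weight_bound) auto
  then show ?thesis
    using K by (auto simp: path_basis_def abs_mult intro!: mult_left_mono)
qed

lemma continuous_path_basis: "continuous_on S (path_basis n \<tau> k i)"
proof -
  have "continuous_on S (\<lambda>x. Abel_weight (grid_size n i p) (\<lambda>j. \<kappa> p (location x $ p - \<tau> p * real j)) (k p))" for p
    by (rule continuous_on_compose2[OF continuous_Abel_weight]) (auto intro!: continuous_intros continuous_location)
  then have "continuous_on S (\<lambda>x. sqrt (\<Prod>p\<in>UNIV. real (n $ p) * \<tau> p) *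
     (\<Prod>p\<in>UNIV. Abel_weight (grid_size n i p) (\<lambda>j. \<kappa> p (location x $ p - \<tau> p * real j)) (k p)))"
    by (intro continuous_on_mult_left continuous_on_prod)
  moreover have "path_basis n \<tau> k i = (\<lambda>x. sqrt (\<Prod>p\<in>UNIV. real (n $ p) * \<tau> p) *
     (\<Prod>p\<in>UNIV. Abel_weight (grid_size n i p) (\<lambda>j. \<kappa> p (location x $ p - \<tau> p * real j)) (k p)))"
    if "\<forall>p. k p \<le> grid_size n i p"
    using that by (auto simp: path_basis_def fun_eq_iff)
  moreover have "path_basis n \<tau> k i = (\<lambda>_. 0)" if "\<not> (\<forall>p. k p \<le> grid_size n i p)"
    using that by (auto simp: path_basis_def fun_eq_iff)
  ultimately show ?thesis
    by (cases "\<forall>p. k p \<le> grid_size n i p") simp_all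
qed

lemma path_combination_in_skorohod_space:
  "restrict (\<lambda>x. \<Sum>k\<in>I. c k * path_basis n \<tau> k \<lfloor>real (n $ 1) * x $ 1\<rfloor> x) (cbox a b) \<in> skorohod_space a b"
  by (intro skorohod_space_floor_piecewise[where F = "\<lambda>i x. \<Sum>k\<in>I. c k * path_basis n \<tau> k i x"]
      continuous_on_sum continuous_on_mult continuous_on_const continuous_path_basis) simp

lemma restrict_monitor_functional:
  assumes "b $ 1 \<le> 1"
  shows "restrict (monitor_functional w n \<tau>) (cbox a b) = restrict (\<lambda>x. \<Sum>k\<in>(\<Pi>\<^sub>E p\<in>UNIV. {..n $ p}).
    w (\<chi> p. real (k p) / real (n $ p)) * path_basis n \<tau> k \<lfloor>real (n $ 1) * x $ 1\<rfloor> x) (cbox a b)"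
proof (rule restrict_ext)
  fix x assume "x \<in> cbox a b"
  then have "x $ 1 \<le> 1"
    using assms by (auto simp: mem_box_cart intro: order_trans)
  then show "monitor_functional w n \<tau> x = (\<Sum>k\<in>(\<Pi>\<^sub>E p\<in>UNIV. {..n $ p}).
    w (\<chi> p. real (k p) / real (n $ p)) * path_basis n \<tau> k \<lfloor>real (n $ 1) * x $ 1\<rfloor> x)"
    by (rule monitor_functional_eq)
qed

lemma monitor_functional_in_skorohod_space:
  "b $ 1 \<le> 1 \<Longrightarrow> restrict (monitor_functional w n \<tau>) (cbox a b) \<in> skorohod_space a b"
  unfolding restrict_monitor_functional by (rule path_combination_in_skorohod_space)

lemma grid_point_in_cube:
  "k \<in> (\<Pi>\<^sub>E p\<in>UNIV. {..n $ p}) \<Longrightarrow> (\<chi> p. real (k p) / real (n $ p)) \<in> cbox 0 1"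
  by (auto simp: mem_box_cart divide_le_eq PiE_iff Suc_le_eq)

lemma monitor_functional_cong:
  assumes "b $ 1 \<le> 1" "\<And>z. z \<in> cbox 0 1 \<Longrightarrow> w z = w' z"
  shows "restrict (monitor_functional w n \<tau>) (cbox a b) = restrict (monitor_functional w' n \<tau>) (cbox a b)"
  unfolding restrict_monitor_functional[OF assms(1)]
  by (intro restrict_ext sum.cong refl) (simp add: assms(2)[OF grid_point_in_cube])

lemma measurable_monitor_functional:
  assumes "b $ 1 \<le> 1" "\<And>z. z \<in> cbox 0 1 \<Longrightarrow> (\<lambda>\<omega>. w \<omega> z) \<in> borel_measurable M"
  shows "(\<lambda>\<omega>. restrict (monitor_functional (w \<omega>) n \<tau>) (cbox a b)) \<in> M \<rightarrow>\<^sub>M skorohod_borel a b"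
  unfolding restrict_monitor_functional[OF assms(1)]
  by (rule measurable_skorohod_combination[where g = "\<lambda>k x. path_basis n \<tau> k \<lfloor>real (n $ 1) * x $ 1\<rfloor> x"])
    (auto intro!: finite_PiE path_basis_bound path_combination_in_skorohod_space assms(2) grid_point_in_cube)

lemma window_in_cube: "0 \<le> x $ 1 \<Longrightarrow> x $ 1 \<le> 1 \<Longrightarrow> window x \<in> cbox 0 1"
  by (auto simp: mem_box_cart window_def)

lemma continuous_parts_functional_window:
  assumes c: "continuous_on (cbox 0 1) c" and a: "0 \<le> a $ 1" "b $ 1 \<le> 1" and \<theta>: "\<And>p. 0 \<le> \<theta> $ p"
  shows "continuous_on (cbox a b) (\<lambda>x. parts_functional c (window x) \<theta> (location x))"
proof -
  define T where "T = 1 + (\<Sum>p\<in>UNIV. \<theta> $ p)"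
  have T: "1 \<le> T" using \<theta> by (simp add: T_def sum_nonneg)
  have \<theta>T: "\<theta> \<in> cbox 0 (\<chi> p. T)"
    using \<theta> member_le_sum[of _ UNIV "\<lambda>p. \<theta> $ p"] by (auto simp: T_def mem_box_cart add_increasing)
  have "continuous_on (cbox a b) (\<lambda>x. (\<lambda>(b, \<theta>, x). parts_functional c b \<theta> x) (window x, \<theta>, location x))"
  proof (rule continuous_on_compose2[OF continuous_parts_functional[OF c T]])
    show "continuous_on (cbox a b) (\<lambda>x. (window x, \<theta>, location x))"
      by (intro continuous_intros continuous_window continuous_location)
    show "(\<lambda>x. (window x, \<theta>, location x)) ` cbox a b \<subseteq> cbox 0 1 \<times> cbox 0 (\<chi> p. T) \<times> UNIV"
    proof (intro image_subsetI SigmaI)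
      fix x assume "x \<in> cbox a b"
      then have "a $ 1 \<le> x $ 1" "x $ 1 \<le> b $ 1" by (auto simp: mem_box_cart)
      then show "window x \<in> cbox 0 1" using a by (intro window_in_cube) linarith+
    qed (use \<theta>T in auto)
  qed
  then show ?thesis by simp
qed

text \<open>
  The rounded-down upper limit \<open>\<lfloor>n $ 1 * x $ 1\<rfloor> / n $ 1\<close> differs from \<open>x $ 1\<close> by at most \<open>1 / n $ 1\<close>, and it
  is positive for large \<open>n\<close> because \<open>x $ 1\<close> is bounded away from \<open>0\<close>. So \<open>grid_functional_uniform_limit\<close> applies
  uniformly over the box.
\<close>

theorem monitor_functional_uniform_limit:
  assumes c: "continuous_on (cbox 0 1) c" and a: "0 < a $ 1" "b $ 1 \<le> 1"
    and \<theta>: "\<And>p. 0 \<le> \<theta> $ p" and \<tau>: "\<And>p m. 0 \<le> \<tau> p m"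
    and lim: "\<And>e. 0 < e \<Longrightarrow> \<exists>N. \<forall>n :: nat ^ 3. (\<forall>p. N \<le> n $ p) \<longrightarrow> (\<forall>p. \<bar>real (n $ p) * \<tau> p (n $ p) - \<theta> $ p\<bar> < e)"
    and "0 < e"
  shows "\<exists>d>0. \<exists>N. \<forall>n w. (\<forall>p. N \<le> n $ p) \<longrightarrow> (\<forall>z\<in>cbox 0 1. \<bar>w z - c z\<bar> < d) \<longrightarrow>
    (\<forall>x\<in>cbox a b. \<bar>monitor_functional w n (\<lambda>p. \<tau> p (n $ p)) x - limit_functional c \<theta> x\<bar> < e)"
proof -
  \<comment> \<open>The slack of one leaves room for \<open>n $ p * \<tau> p (n $ p)\<close>, which is only close to \<open>\<theta> $ p\<close>.\<close>
  define T where "T = 2 + (\<Sum>p\<in>UNIV. \<theta> $ p)"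
  have T: "1 \<le> T" using \<theta> by (simp add: T_def sum_nonneg add_increasing2)
  have \<theta>T: "\<theta> $ p + 1 \<le> T" for p
    using \<theta> member_le_sum[of p UNIV "\<lambda>p. \<theta> $ p"] by (auto simp: T_def)
  have \<theta>box: "\<theta> \<in> cbox 0 (\<chi> p. T)"
    unfolding mem_box_cart
  proof
    fix p show "0 $ p \<le> \<theta> $ p \<and> \<theta> $ p \<le> (\<chi> p. T) $ p"
      using \<theta>[of p] \<theta>T[of p] by simp
  qed
  define S where "S = sqrt (\<Prod>p\<in>UNIV. \<theta> $ p)"
  have S0: "0 \<le> S" using \<theta> by (simp add: S_def prod_nonneg)
  define L where "L x = parts_functional c (window x) \<theta> (location x)" for x
  have "bounded (L ` cbox a b)"
    unfolding L_def using a \<theta>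
    by (intro compact_imp_bounded compact_continuous_image continuous_parts_functional_window c compact_cbox) auto
  then obtain C0 where C0: "\<forall>x\<in>cbox a b. \<bar>L x\<bar> \<le> C0"
    by (auto simp: bounded_iff)
  define C where "C = \<bar>C0\<bar>"
  have C: "0 \<le> C" "\<And>x. x \<in> cbox a b \<Longrightarrow> \<bar>L x\<bar> \<le> C"
    using C0 by (auto simp: C_def intro: order_trans)
  define e1 where "e1 = e / (2 * (S + 1))"
  define e2 where "e2 = min 1 (e / (2 * (C + 1)))"
  have e1: "0 < e1" "(S + 1) * e1 = e / 2"
    using S0 \<open>0 < e\<close> by (auto simp: e1_def field_simps)
  have e2: "0 < e2" "e2 \<le> 1" "e2 * C < e / 2"
  proof -
    show "0 < e2" "e2 \<le> 1" using C(1) \<open>0 < e\<close> by (auto simp: e2_def)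
    have "e2 * C \<le> e / (2 * (C + 1)) * C"
      using C(1) by (intro mult_right_mono) (auto simp: e2_def)
    also have "\<dots> < e / 2"
      using C(1) \<open>0 < e\<close> by (simp add: field_simps)
    finally show "e2 * C < e / 2" .
  qed
  obtain d1 where d1: "d1 > 0" and d1': "\<And>w m n \<tau> s \<theta> x.
     (\<forall>p. 1 \<le> m p \<and> m p \<le> n p \<and> 0 \<le> \<tau> p \<and> real (n p) * \<tau> p \<le> T \<and> 1 / real (n p) < d1 \<and>
          \<bar>real (m p) / real (n p) - s $ p\<bar> < d1 \<and> \<bar>real (n p) * \<tau> p - \<theta> $ p\<bar> < d1) \<Longrightarrow>
     s \<in> cbox 0 1 \<Longrightarrow> \<theta> \<in> cbox 0 (\<chi> p. T) \<Longrightarrow> x \<in> location ` cbox a b \<Longrightarrow> (\<forall>z\<in>cbox 0 1. \<bar>w z - c z\<bar> < d1) \<Longrightarrow>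
     \<bar>grid_functional w m n \<tau> x - parts_functional c s \<theta> x\<bar> < e1"
    using grid_functional_uniform_limit[OF c T _ e1(1), of "location ` cbox a b"]
      compact_continuous_image[OF continuous_location compact_cbox] by metis
  have "isCont (\<lambda>\<theta> :: real ^ 3. sqrt (\<Prod>p\<in>UNIV. \<theta> $ p)) \<theta>"
    by (intro continuous_intros)
  then obtain d2 where d2: "d2 > 0" "\<And>\<theta>'. dist \<theta>' \<theta> < d2 \<Longrightarrow> \<bar>sqrt (\<Prod>p\<in>UNIV. \<theta>' $ p) - S\<bar> < e2"
    using e2(1) unfolding continuous_at_eps_delta S_def dist_real_def by metis
  define d where "d = min d1 (min (d2 / 3) 1)"
  have d: "d > 0" "d \<le> d1" "3 * d \<le> d2" "d \<le> 1" using d1 d2(1) by (auto simp: d_def)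
  obtain N1 where N1: "\<And>n :: nat ^ 3. (\<forall>p. N1 \<le> n $ p) \<Longrightarrow> (\<forall>p. \<bar>real (n $ p) * \<tau> p (n $ p) - \<theta> $ p\<bar> < d)"
    using lim[OF d(1)] by blast
  obtain N2 :: nat where N2: "1 / d < real N2" using reals_Archimedean2 by blast
  obtain N3 :: nat where N3: "1 / a $ 1 < real N3" using reals_Archimedean2 by blast
  show ?thesis
  proof (intro exI[of _ d1] conjI d1 exI[of _ "N1 + N2 + N3"] allI impI ballI)
    fix n :: "nat ^ 3" and w x
    assume n: "\<forall>p. N1 + N2 + N3 \<le> n $ p" and w: "\<forall>z\<in>cbox 0 1. \<bar>w z - c z\<bar> < d1" and x: "x \<in> cbox a b"
    define \<theta>' :: "real ^ 3" where "\<theta>' = (\<chi> p. real (n $ p) * \<tau> p (n $ p))"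
    define i where "i = \<lfloor>real (n $ 1) * x $ 1\<rfloor>"
    have "\<forall>p. N1 \<le> n $ p" using n by (meson add_leD1)
    from N1[OF this] have near: "\<bar>real (n $ p) * \<tau> p (n $ p) - \<theta> $ p\<bar> < d" for p by blast
    have nN: "real N2 \<le> real (n $ p)" "real N3 \<le> real (n $ p)" for p
      using n[rule_format, of p] by auto
    have x1: "a $ 1 \<le> x $ 1" "x $ 1 \<le> 1"
      using x a by (auto simp: mem_box_cart intro: order_trans)
    have n0: "0 < real (n $ p)" for p
      using nN(1)[of p] N2 d(1) by (smt (verit) divide_pos_pos)
    have inv: "1 / real (n $ p) < d" for p
    proof -
      have "1 < real N2 * d" using N2 d(1) by (simp add: field_simps)
      also have "\<dots> \<le> real (n $ p) * d" using nN(1)[of p] d(1) by (intro mult_right_mono) auto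
      finally show ?thesis using n0[of p] by (simp add: field_simps)
    qed
    have "1 \<le> real (n $ 1) * x $ 1"
    proof -
      have "1 < real N3 * a $ 1" using N3 a(1) by (simp add: field_simps)
      also have "\<dots> \<le> real (n $ 1) * x $ 1" using nN(2)[of 1] x1 a(1) by (intro mult_mono) auto
      finally show ?thesis by simp
    qed
    then have i1: "1 \<le> i" by (simp add: i_def le_floor_iff)
    have ile: "of_int i \<le> real (n $ 1) * x $ 1" "real (n $ 1) * x $ 1 < of_int i + 1"
      unfolding i_def by linarith+
    have "real (n $ 1) * x $ 1 \<le> real (n $ 1) * 1" using x1 by (intro mult_left_mono) auto
    then have "i \<le> int (n $ 1)" using ile(1) by linarith
    have G: "\<bar>grid_functional w (grid_size n i) (($) n) (\<lambda>p. \<tau> p (n $ p)) (location x) - L x\<bar> < e1"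
      unfolding L_def
    proof (rule d1'[OF allI _ \<theta>box _ w])
      fix p :: 3
      have "real (n $ p) * \<tau> p (n $ p) \<le> T" using near[of p] \<theta>T[of p] d(4) by linarith
      moreover have "\<bar>real (grid_size n i p) / real (n $ p) - window x $ p\<bar> < d1"
      proof (cases "p = 1")
        case True
        have "of_int i / real (n $ 1) \<le> x $ 1" "x $ 1 < of_int i / real (n $ 1) + 1 / real (n $ 1)"
          using ile n0[of 1] by (simp_all add: field_simps)
        moreover have "real (nat i) = of_int i" using i1 by simp
        ultimately show ?thesis
          using True inv[of 1] d(2) by (simp add: grid_size_def window_def)
      next
        case False
        then show ?thesis using n0[of p] d1 by (simp add: grid_size_def window_def)
      qed
      moreover have "1 \<le> grid_size n i p \<and> grid_size n i p \<le> n $ p"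
        using i1 \<open>i \<le> int (n $ 1)\<close> n0[of p] by (auto simp: grid_size_def)
      ultimately show "1 \<le> grid_size n i p \<and> grid_size n i p \<le> n $ p \<and> 0 \<le> \<tau> p (n $ p) \<and>
          real (n $ p) * \<tau> p (n $ p) \<le> T \<and> 1 / real (n $ p) < d1 \<and>
          \<bar>real (grid_size n i p) / real (n $ p) - window x $ p\<bar> < d1 \<and> \<bar>real (n $ p) * \<tau> p (n $ p) - \<theta> $ p\<bar> < d1"
        using \<tau> inv[of p] near[of p] d(2) by auto
    qed (use x x1 a in \<open>auto intro!: window_in_cube\<close>)
    have "dist \<theta>' \<theta> < d2"
    proof -
      have "norm (\<theta>' - \<theta>) \<le> (\<Sum>p\<in>UNIV. \<bar>(\<theta>' - \<theta>) $ p\<bar>)" by (rule norm_le_l1_cart)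
      also have "\<dots> < (\<Sum>p\<in>(UNIV :: 3 set). d)"
        using near by (intro sum_strict_mono) (auto simp: \<theta>'_def)
      finally show ?thesis using d(3) by (simp add: dist_norm)
    qed
    then have S': "\<bar>sqrt (\<Prod>p\<in>UNIV. \<theta>' $ p) - S\<bar> < e2" by (rule d2(2))
    define S' where "S' = sqrt (\<Prod>p\<in>UNIV. \<theta>' $ p)"
    define A where "A = grid_functional w (grid_size n i) (($) n) (\<lambda>p. \<tau> p (n $ p)) (location x)"
    have "\<bar>S' * A - S * L x\<bar> = \<bar>S' * (A - L x) + (S' - S) * L x\<bar>"
      by (simp add: algebra_simps)
    also have "\<dots> \<le> \<bar>S'\<bar> * \<bar>A - L x\<bar> + \<bar>S' - S\<bar> * \<bar>L x\<bar>"
      by (metis abs_mult abs_triangle_ineq)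
    also have "\<dots> \<le> (S + 1) * e1 + e2 * C"
      using S' e2 G C(2)[OF x] S0 by (intro add_mono mult_mono) (auto simp: S'_def A_def)
    also have "\<dots> < e"
      using e1(2) e2(3) by simp
    finally show "\<bar>monitor_functional w n (\<lambda>p. \<tau> p (n $ p)) x - limit_functional c \<theta> x\<bar> < e"
      by (simp add: monitor_functional_def limit_functional_def S'_def A_def S_def L_def \<theta>'_def i_def)
  qed
qed

end

section \<open>Weak convergence of the monitoring process\<close>

lemma prod_UNIV_3: "(\<Prod>p\<in>(UNIV :: 3 set). f p) = f 1 * f 2 * (f 3 :: 'a :: comm_monoid_mult)"
  unfolding UNIV_3 by (simp add: mult.assoc)

lemma vector_4_1: "(vector [w, x, y, z] :: 'a :: zero ^ 4) $ 1 = w"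
  unfolding vector_def by simp

text \<open>
  Under the null hypothesis the residuals are the noise, and the monitoring process is a sum of noise
  values times products of kernel factors. Abel summation expresses it through partial sums of the
  noise, which up to normalisation are the values of the partial sum process at the grid points.
\<close>

lemma monitoring_process_eq:
  assumes "smooth_factors_3 (kernel_factor \<Omega>) \<kappa>' K"
    and \<Omega>: "\<And>j. 0 < \<Omega> $ j" and \<tau>: "\<And>p m. 0 < \<tau> p m" and x: "0 \<le> x $ 1" "x $ 1 \<le> 1"
  shows "monitoring_process \<Omega> \<tau> f (observation f \<tau> \<epsilon>) n \<omega> x =
    smooth_factors_3.monitor_functional (kernel_factor \<Omega>) (partial_sum_process \<epsilon> n \<omega>) n (\<lambda>p. \<tau> p (n $ p)) x"
proof -
  interpret smooth_factors_3 "kernel_factor \<Omega>" \<kappa>' K by fact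
  define i where "i = \<lfloor>real (n $ 1) * x $ 1\<rfloor>"
  let ?m = "grid_size n i"
  have i: "int (?m 1) = i" "int (?m 2) = int (n $ 2)" "int (?m 3) = int (n $ 3)"
    using x by (auto simp: grid_size_def i_def)
  have "i \<le> \<lfloor>real (n $ 1)\<rfloor>"
    unfolding i_def using x by (intro floor_mono) (simp add: mult_left_le)
  then have m: "?m p \<le> n $ p" for p
    by (auto simp: grid_size_def nat_le_iff)
  have ker: "kernel \<Omega> (vector [x $ 2, x $ 3, x $ 4] - sampling_point \<tau> n (\<chi> p. int (l p)))
      = (\<Prod>p\<in>UNIV. kernel_factor \<Omega> p (location x $ p - \<tau> p (n $ p) * real (l p)))" for l
    unfolding kernel_eq_prod[OF \<Omega>] location_eq_vector[symmetric]
    by (simp add: sampling_point_def mult.commute)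
  define E where "E k = (\<Sum>l\<in>(\<Pi>\<^sub>E p\<in>UNIV. {1..k p}). \<epsilon> (\<chi> p. int (l p)) \<omega>)" for k :: "3 \<Rightarrow> nat"
  let ?W = "\<lambda>k. \<Prod>p\<in>UNIV. Abel_weight (?m p) (\<lambda>j. kernel_factor \<Omega> p (location x $ p - \<tau> p (n $ p) * real j)) (k p)"
  have "monitoring_process \<Omega> \<tau> f (observation f \<tau> \<epsilon>) n \<omega> x =
     sqrt (\<Prod>p\<in>UNIV. \<tau> p (n $ p)) * (\<Sum>i\<^sub>1 = 1..int (?m 1). \<Sum>i\<^sub>2 = 1..int (?m 2). \<Sum>i\<^sub>3 = 1..int (?m 3).
        (\<lambda>l. \<epsilon> l \<omega> * kernel \<Omega> (vector [x $ 2, x $ 3, x $ 4] - sampling_point \<tau> n l)) (vector [i\<^sub>1, i\<^sub>2, i\<^sub>3]))"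
    unfolding i by (simp add: monitoring_process_def observation_def prod_UNIV_3 i_def)
  also have "\<dots> = sqrt (\<Prod>p\<in>UNIV. \<tau> p (n $ p)) * (\<Sum>l\<in>(\<Pi>\<^sub>E p\<in>UNIV. {1..?m p}). \<epsilon> (\<chi> p. int (l p)) \<omega> *
      (\<Prod>p\<in>UNIV. kernel_factor \<Omega> p (location x $ p - \<tau> p (n $ p) * real (l p))))"
    unfolding sum_int_triple_eq_sum_PiE[of "\<lambda>l. \<epsilon> l \<omega> *
      kernel \<Omega> (vector [x $ 2, x $ 3, x $ 4] - sampling_point \<tau> n l)" ?m] ker ..
  also have "\<dots> = sqrt (\<Prod>p\<in>UNIV. \<tau> p (n $ p)) * (\<Sum>k\<in>(\<Pi>\<^sub>E p\<in>UNIV. {..?m p}). E k * ?W k)"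
    unfolding E_def
    by (subst Abel_summation_PiE[of _ "\<lambda>p j. kernel_factor \<Omega> p (location x $ p - \<tau> p (n $ p) * real j)"]) (rule refl)
  also have "\<dots> = monitor_functional (partial_sum_process \<epsilon> n \<omega>) n (\<lambda>p. \<tau> p (n $ p)) x"
  proof (cases "\<forall>p. 0 < n $ p")
    case True
    define P where "P = real (n $ 1 * n $ 2 * n $ 3)"
    have P: "0 < P" "P = (\<Prod>p\<in>UNIV. real (n $ p))"
      using True by (auto simp: P_def prod_UNIV_3)
    have "sqrt (\<Prod>p\<in>UNIV. real (n $ p) * \<tau> p (n $ p)) * P powr (-1/2) = sqrt (\<Prod>p\<in>UNIV. \<tau> p (n $ p))"
      using P(1) by (simp add: prod.distrib P(2)[symmetric] real_sqrt_mult powr_minus_divide powr_half_sqrt)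
    then show ?thesis
      unfolding monitor_functional_def grid_functional_def partial_sum_process_grid[OF True[rule_format]] P_def[symmetric]
      by (simp add: sum_distrib_left mult_ac E_def i_def flip: mult.assoc)
  next
    case False
    then obtain p where p: "n $ p = 0" by auto
    \<comment> \<open>Some sample size is zero, so the sums over the noise are empty and the normalising root vanishes.\<close>
    have "E k = 0" if "k \<in> (\<Pi>\<^sub>E p\<in>UNIV. {..?m p})" for k
    proof -
      have "k p \<le> ?m p" using that by (simp add: PiE_iff)
      then have "k p = 0" using m[of p] p by linarith
      then have "(\<Pi>\<^sub>E p\<in>UNIV. {1..k p}) = {}" by (auto simp: PiE_eq_empty_iff intro!: exI[of _ p])
      then show ?thesis by (simp add: E_def)
    qed
    then show ?thesis
      using p by (auto simp: monitor_functional_def)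
  qed
  finally show ?thesis .
qed

lemma measurable_partial_sum_process:
  assumes "\<And>i. \<epsilon> i \<in> borel_measurable M"
  shows "(\<lambda>\<omega>. partial_sum_process \<epsilon> n \<omega> v) \<in> borel_measurable M"
  unfolding partial_sum_process_def using assms by measurable

theorem theorem3p1:
  fixes M :: "'a measure" and N :: "'b measure"
    and \<epsilon> :: "int ^ 3 \<Rightarrow> 'a \<Rightarrow> real" and B :: "'b \<Rightarrow> real ^ 3 \<Rightarrow> real"
    and f f\<^sub>0 :: "real ^ 3 \<Rightarrow> real" and \<tau> :: "3 \<Rightarrow> nat \<Rightarrow> real"
    and s\<^sub>0 \<sigma> :: real and \<Omega> \<tau>bar :: "real ^ 3"
  assumes "0 < s\<^sub>0" and "s\<^sub>0 < 1"
    and "\<And>j. 0 < \<Omega> $ j"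
    and "\<And>j. 0 < \<tau>bar $ j"
    and "\<And>j m. 0 < \<tau> j m"
    and "prob_space M"
    and "weakly_stationary M \<epsilon>"
    and "\<And>i. (\<integral>\<omega>. \<epsilon> i \<omega> \<partial>M) = 0"
    and "0 < \<sigma>"
    and "long_run_variance M \<epsilon> (\<sigma>\<^sup>2)"
    and "standard_brownian_motion N B"
    and "converges_weakly 0 1 M (partial_sum_process \<epsilon>) N (\<lambda>\<omega> v. \<sigma> * B \<omega> v) min_to_infinity"
    and "\<And>j. ((\<lambda>n. real (n $ j) * \<tau> j (n $ j)) \<longlongrightarrow> \<tau>bar $ j) min_to_infinity"
    and H0: "f = f\<^sub>0"
  shows "converges_weakly (vector [s\<^sub>0, 0, 0, 0]) (vector [1, \<tau>bar $ 1, \<tau>bar $ 2, \<tau>bar $ 3])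
           M (monitoring_process \<Omega> \<tau> f\<^sub>0 (observation f \<tau> \<epsilon>))
           N (limit_process \<Omega> \<tau>bar \<sigma> B) min_to_infinity"
proof -
  note \<Omega> = assms(3) and \<tau>bar = assms(4) and \<tau> = assms(5)
  define a :: "real ^ 4" where "a = vector [s\<^sub>0, 0, 0, 0]"
  define b :: "real ^ 4" where "b = vector [1, \<tau>bar $ 1, \<tau>bar $ 2, \<tau>bar $ 3]"
  have ab: "0 < a $ 1" "b $ 1 \<le> 1"
    using assms(1) by (simp_all add: a_def b_def vector_4_1)
  have x1: "0 < x $ 1" "x $ 1 \<le> 1" if "x \<in> cbox a b" for x
    using that ab by (meson mem_box_cart order_trans less_le_trans)+
  obtain \<kappa>' K where "smooth_factors (kernel_factor \<Omega>) \<kappa>' K"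
    using smooth_factors_kernel[OF \<Omega>] by blast
  then interpret smooth_factors_3 "kernel_factor \<Omega>" \<kappa>' K
    by (simp add: smooth_factors_3_def)
  have sf3: "smooth_factors_3 (kernel_factor \<Omega>) \<kappa>' K"
    by unfold_locales
  have \<epsilon>: "\<epsilon> i \<in> borel_measurable M" for i
    using assms(7) by (auto simp: weakly_stationary_def)
  define sz where "sz n = Min (range (\<lambda>j. n $ j))" for n :: "nat ^ 3"
  have sz: "k \<le> sz n \<longleftrightarrow> (\<forall>p. k \<le> n $ p)" for k n
    unfolding sz_def by (subst Min_ge_iff) auto
  have F: "min_to_infinity = filtercomap sz at_top"
    by (simp add: min_to_infinity_def sz_def[abs_def])

  interpret N: prob_space N
    using assms(11) by (simp add: standard_brownian_motion_def)
  have "AE \<omega> in N. continuous_on (cbox 0 1) (B \<omega>) \<and> (\<forall>t\<in>cbox 0 1. (\<exists>p. t $ p = 0) \<longrightarrow> B \<omega> t = 0)"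
    using assms(11) by (simp add: standard_brownian_motion_def)
  then obtain Nn where Nn: "Nn \<in> null_sets N" and
    good: "\<And>\<omega>. \<omega> \<in> space N - Nn \<Longrightarrow> continuous_on (cbox 0 1) (B \<omega>) \<and> (\<forall>t\<in>cbox 0 1. (\<exists>p. t $ p = 0) \<longrightarrow> B \<omega> t = 0)"
    by (elim AE_E3) blast
  \<comment> \<open>The path of \<open>\<sigma> * B\<close>, made continuous for every \<open>\<omega>\<close> by setting it to zero on the exceptional null set.\<close>
  define c where "c \<omega> v = (if \<omega> \<in> space N - Nn then \<sigma> * B \<omega> v else 0)" for \<omega> v
  have c_cont: "continuous_on (cbox 0 1) (c \<omega>)" for \<omega>
  proof (cases "\<omega> \<in> space N - Nn")
    case True
    then have "c \<omega> = (\<lambda>v. \<sigma> * B \<omega> v)" by (auto simp: c_def)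
    then show ?thesis using good[OF True] by (auto intro!: continuous_intros)
  next
    case False
    then have "c \<omega> = (\<lambda>_. 0)" by (auto simp: c_def)
    then show ?thesis by simp
  qed
  have c_meas: "(\<lambda>\<omega>. c \<omega> z) \<in> borel_measurable N" if "z \<in> cbox 0 1" for z
  proof -
    have "(\<lambda>\<omega>. B \<omega> z) \<in> borel_measurable N"
      using assms(11) that by (simp add: standard_brownian_motion_def)
    then show ?thesis
      unfolding c_def using Nn by (intro measurable_If_set borel_measurable_times) auto
  qed
  have c_eq: "AE \<omega> in N. \<omega> \<in> space N - Nn"
    using AE_not_in[OF Nn] AE_space by eventually_elim simp

  define X' where "X' n \<omega> = restrict (monitor_functional (partial_sum_process \<epsilon> n \<omega>) n (\<lambda>p. \<tau> p (n $ p))) (cbox a b)" for n \<omega>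
  define Y' where "Y' \<omega> = restrict (limit_functional (c \<omega>) \<tau>bar) (cbox a b)" for \<omega>
  have X'D: "X' n \<omega> \<in> skorohod_space a b" for n \<omega>
    unfolding X'_def by (rule monitor_functional_in_skorohod_space[OF ab(2)])
  have Y'D: "Y' \<omega> \<in> skorohod_space a b" for \<omega>
    unfolding Y'_def limit_functional_def using ab \<tau>bar
    by (intro skorohod_space_continuous continuous_on_mult_left continuous_parts_functional_window c_cont)
      (auto simp: less_imp_le)

  have X': "skorohod_version M a b (monitoring_process \<Omega> \<tau> f\<^sub>0 (observation f \<tau> \<epsilon>) n) (X' n)" for n
    unfolding skorohod_version_def
  proof
    show "X' n \<in> M \<rightarrow>\<^sub>M skorohod_borel a b"
      unfolding X'_def by (rule measurable_monitor_functional[OF ab(2) measurable_partial_sum_process[OF \<epsilon>]])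
    show "AE \<omega> in M. \<forall>x\<in>cbox a b. X' n \<omega> x = monitoring_process \<Omega> \<tau> f\<^sub>0 (observation f \<tau> \<epsilon>) n \<omega> x"
    proof (intro AE_I2 ballI)
      fix \<omega> x assume x: "x \<in> cbox a b"
      have "monitoring_process \<Omega> \<tau> f\<^sub>0 (observation f\<^sub>0 \<tau> \<epsilon>) n \<omega> x =
          monitor_functional (partial_sum_process \<epsilon> n \<omega>) n (\<lambda>p. \<tau> p (n $ p)) x"
        using x1[OF x] by (intro monitoring_process_eq[OF sf3 \<Omega> \<tau>]) auto
      then show "X' n \<omega> x = monitoring_process \<Omega> \<tau> f\<^sub>0 (observation f \<tau> \<epsilon>) n \<omega> x"
        unfolding X'_def H0 using x by simp
    qed
  qed

  have Y'_meas: "Y' \<in> N \<rightarrow>\<^sub>M skorohod_borel a b"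
  proof (rule measurable_skorohod_limit[OF _ Y'D])
    \<comment> \<open>The limit functional is a uniform limit of grid functionals for \<open>k + 1\<close> equidistant samples along
      each axis, and those depend measurably on finitely many values of the path.\<close>
    let ?n = "\<lambda>k. (\<chi> p. Suc k) :: nat ^ 3"
    let ?X = "\<lambda>k \<omega>. restrict (monitor_functional (c \<omega>) (?n k) (\<lambda>p. \<tau>bar $ p / real (Suc k))) (cbox a b)"
    show "?X k \<in> N \<rightarrow>\<^sub>M skorohod_borel a b" for k
      by (rule measurable_monitor_functional[OF ab(2) c_meas])
    fix \<omega> and e :: real assume "0 < e"
    have "\<exists>d>0. \<exists>N. \<forall>n w. (\<forall>p. N \<le> n $ p) \<longrightarrow> (\<forall>z\<in>cbox 0 1. \<bar>w z - c \<omega> z\<bar> < d) \<longrightarrow>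
       (\<forall>x\<in>cbox a b. \<bar>monitor_functional w n (\<lambda>p. \<tau>bar $ p / real (n $ p)) x - limit_functional (c \<omega>) \<tau>bar x\<bar> < e)"
    proof (rule monitor_functional_uniform_limit[OF c_cont ab, where \<tau> = "\<lambda>p m. \<tau>bar $ p / real m"])
      fix e :: real assume "0 < e"
      then show "\<exists>N. \<forall>n :: nat ^ 3. (\<forall>p. N \<le> n $ p) \<longrightarrow> (\<forall>p. \<bar>real (n $ p) * (\<tau>bar $ p / real (n $ p)) - \<tau>bar $ p\<bar> < e)"
        by (intro exI[of _ 1]) (auto simp: Suc_le_eq)
    qed (use \<tau>bar \<open>0 < e\<close> in \<open>auto simp: less_imp_le\<close>)
    then obtain d k0 where d: "0 < d" and k0': "\<And>n w. \<forall>p. k0 \<le> n $ p \<Longrightarrow> \<forall>z\<in>cbox 0 1. \<bar>w z - c \<omega> z\<bar> < d \<Longrightarrow>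
       \<forall>x\<in>cbox a b. \<bar>monitor_functional w n (\<lambda>p. \<tau>bar $ p / real (n $ p)) x - limit_functional (c \<omega>) \<tau>bar x\<bar> < e"
      by blast
    have k0: "\<And>n. \<forall>p. k0 \<le> n $ p \<Longrightarrow> \<forall>x\<in>cbox a b.
        \<bar>monitor_functional (c \<omega>) n (\<lambda>p. \<tau>bar $ p / real (n $ p)) x - limit_functional (c \<omega>) \<tau>bar x\<bar> < e"
      by (rule k0') (simp_all add: d)
    have "?X k \<omega> \<in> skorohod_ball a b (Y' \<omega>) e" if "k0 \<le> k" for k
    proof (rule skorohod_ball_uniform[OF monitor_functional_in_skorohod_space[OF ab(2)] \<open>0 < e\<close>])
      fix x assume "x \<in> cbox a b"
      then show "\<bar>?X k \<omega> x - Y' \<omega> x\<bar> < e"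
        using k0[of "?n k"] that by (simp add: Y'_def)
    qed
    then show "\<forall>\<^sub>F k in sequentially. ?X k \<omega> \<in> skorohod_ball a b (Y' \<omega>) e"
      unfolding eventually_sequentially by blast
  qed

  have Y': "skorohod_version N a b (limit_process \<Omega> \<tau>bar \<sigma> B) Y'"
    unfolding skorohod_version_def
  proof (intro conjI Y'_meas)
    show "AE \<omega> in N. \<forall>x\<in>cbox a b. Y' \<omega> x = limit_process \<Omega> \<tau>bar \<sigma> B \<omega> x"
      using c_eq
    proof (rule eventually_mono, intro ballI)
      fix \<omega> x assume \<omega>: "\<omega> \<in> space N - Nn" and x: "x \<in> cbox a b"
      have ker: "kernel \<Omega> (vector [x $ 2 - \<tau>bar $ 1 * z $ 1, x $ 3 - \<tau>bar $ 2 * z $ 2, x $ 4 - \<tau>bar $ 3 * z $ 3])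
          = (\<Prod>p\<in>UNIV. kernel_factor \<Omega> p (location x $ p - \<tau>bar $ p * z $ p))" for z :: "real ^ 3"
        unfolding kernel_eq_prod[OF \<Omega>] by (simp add: prod_UNIV_3 location_eq_vector)
      have "RS_by_parts 0 (window x) (\<lambda>z. \<Prod>p\<in>UNIV. kernel_factor \<Omega> p (location x $ p - \<tau>bar $ p * z $ p)) (B \<omega>)
          = parts_functional (B \<omega>) (window x) \<tau>bar (location x)"
        using good[OF \<omega>] x1[OF x] \<tau>bar
        by (intro RS_by_parts_eq_parts_functional) (auto simp: window_def less_imp_le)
      moreover have "c \<omega> = (\<lambda>v. \<sigma> * B \<omega> v)"
        using \<omega> by (auto simp: c_def)
      ultimately show "Y' \<omega> x = limit_process \<Omega> \<tau>bar \<sigma> B \<omega> x"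
        using x by (simp add: Y'_def limit_functional_def limit_process_def ker window_eq_vector
            parts_functional_scale prod_UNIV_3)
    qed
  qed

  obtain Z Z0 where Z: "\<And>n. skorohod_version M 0 1 (partial_sum_process \<epsilon> n) (Z n)"
    and Z0: "skorohod_version N 0 1 (\<lambda>\<omega> v. \<sigma> * B \<omega> v) Z0"
    and weak: "\<And>h. continuous_map (skorohod_topology 0 1) euclideanreal h \<Longrightarrow> bounded (h ` skorohod_space 0 1) \<Longrightarrow>
        ((\<lambda>n. \<integral>\<omega>. h (Z n \<omega>) \<partial>M) \<longlongrightarrow> (\<integral>\<omega>. h (Z0 \<omega>) \<partial>N)) (filtercomap sz at_top)"
    using assms(12) unfolding converges_weakly_def F by blast

  \<comment> \<open>The filter \<^const>\<open>min_to_infinity\<close> is generated by the sets on which all sample sizes exceed a bound.\<close>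
  have \<tau>_lim: "\<exists>k. \<forall>n :: nat ^ 3. (\<forall>p. k \<le> n $ p) \<longrightarrow> (\<forall>p. \<bar>real (n $ p) * \<tau> p (n $ p) - \<tau>bar $ p\<bar> < e)"
    if "0 < e" for e
  proof -
    have "\<forall>\<^sub>F n in filtercomap sz at_top. \<forall>p\<in>UNIV. \<bar>real (n $ p) * \<tau> p (n $ p) - \<tau>bar $ p\<bar> < e"
    proof (rule eventually_ball_finite)
      show "\<forall>p\<in>UNIV. \<forall>\<^sub>F n in filtercomap sz at_top. \<bar>real (n $ p) * \<tau> p (n $ p) - \<tau>bar $ p\<bar> < e"
        using tendstoD[OF assms(13) that] unfolding F dist_real_def by blast
    qed simp
    then show ?thesis
      unfolding eventually_filtercomap_at_top_linorder sz by simp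
  qed

  show ?thesis
    unfolding converges_weakly_def a_def[symmetric] b_def[symmetric]
  proof (intro exI[of _ X'] exI[of _ Y'] conjI allI X' Y' impI, elim conjE)
    fix h assume h: "continuous_map (skorohod_topology a b) euclideanreal h" and hb: "bounded (h ` skorohod_space a b)"
    obtain C where C: "\<And>g. g \<in> skorohod_space a b \<Longrightarrow> \<bar>h g\<bar> \<le> C"
      using hb unfolding bounded_iff real_norm_def by blast
    note hm = borel_measurable_skorohod_continuous[OF h]
    define \<phi> where "\<phi> n w = h (restrict (monitor_functional w n (\<lambda>p. \<tau> p (n $ p))) (cbox a b))" for n w
    show "((\<lambda>n. \<integral>\<omega>. h (X' n \<omega>) \<partial>M) \<longlongrightarrow> (\<integral>\<omega>. h (Y' \<omega>) \<partial>N)) min_to_infinity"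
      unfolding F
    proof (rule extended_continuous_mapping[where Z = Z and ?Z0.0 = Z0 and \<phi> = \<phi> and C = C and a = 0 and b = 1])
      show "prob_space M" by fact
      show "prob_space N" by unfold_locales
      show "Z n \<in> M \<rightarrow>\<^sub>M skorohod_borel 0 1" "Z0 \<in> N \<rightarrow>\<^sub>M skorohod_borel 0 1" for n
        using Z Z0 by (auto simp: skorohod_version_def)
      show "(\<lambda>\<omega>. h (X' n \<omega>)) \<in> borel_measurable M" "(\<lambda>\<omega>. h (Y' \<omega>)) \<in> borel_measurable N" for n
        using measurable_compose[OF _ hm, of "X' n" M] measurable_compose[OF _ hm, of Y' N] X'[of n] Y'
        by (auto simp: skorohod_version_def)
      show "\<bar>h (X' n \<omega>)\<bar> \<le> C" "\<bar>h (Y' \<omega>')\<bar> \<le> C" "\<bar>\<phi> n w\<bar> \<le> C" for n \<omega> \<omega>' w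
        unfolding \<phi>_def using X'D Y'D monitor_functional_in_skorohod_space[OF ab(2)] C by auto
      show "AE \<omega> in M. h (X' n \<omega>) = \<phi> n (Z n \<omega>)" for n
      proof -
        have "AE \<omega> in M. \<forall>x\<in>cbox 0 1. Z n \<omega> x = partial_sum_process \<epsilon> n \<omega> x"
          using Z by (simp add: skorohod_version_def)
        then show ?thesis
        proof (rule eventually_mono)
          fix \<omega> assume "\<forall>x\<in>cbox 0 1. Z n \<omega> x = partial_sum_process \<epsilon> n \<omega> x"
          then show "h (X' n \<omega>) = \<phi> n (Z n \<omega>)"
            unfolding \<phi>_def X'_def by (subst monitor_functional_cong[OF ab(2), of "Z n \<omega>"]) auto
        qed
      qed
      show "AE \<omega> in N. \<forall>\<epsilon>>0. \<exists>d>0. \<exists>k. \<forall>n. k \<le> sz n \<longrightarrow>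
              (\<forall>w\<in>skorohod_ball 0 1 (Z0 \<omega>) d. \<bar>\<phi> n w - h (Y' \<omega>)\<bar> < \<epsilon>)"
      proof -
        have "AE \<omega> in N. \<forall>x\<in>cbox 0 1. Z0 \<omega> x = \<sigma> * B \<omega> x"
          using Z0 by (simp add: skorohod_version_def)
        with c_eq show ?thesis
        proof eventually_elim
          case (elim \<omega>)
          then have Z0c: "Z0 \<omega> x = c \<omega> x" if "x \<in> cbox 0 1" for x
            using that by (simp add: c_def)
          then have Z0_cont: "continuous_on (cbox 0 1) (Z0 \<omega>)"
            using c_cont continuous_on_cong by blast
          show ?case
          proof (intro allI impI)
            fix \<epsilon>' :: real assume "0 < \<epsilon>'"
            obtain e where e: "e > 0" "\<And>g. g \<in> skorohod_space a b \<Longrightarrow> \<forall>x\<in>cbox a b. \<bar>g x - Y' \<omega> x\<bar> < e \<Longrightarrow> \<bar>h g - h (Y' \<omega>)\<bar> < \<epsilon>'"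
              using skorohod_continuous_uniform[OF h Y'D \<open>0 < \<epsilon>'\<close>] by blast
            have "\<exists>d>0. \<exists>k. \<forall>n w. (\<forall>p. k \<le> n $ p) \<longrightarrow> (\<forall>z\<in>cbox 0 1. \<bar>w z - c \<omega> z\<bar> < d) \<longrightarrow>
                (\<forall>x\<in>cbox a b. \<bar>monitor_functional w n (\<lambda>p. \<tau> p (n $ p)) x - limit_functional (c \<omega>) \<tau>bar x\<bar> < e)"
              using \<tau> \<tau>bar by (intro monitor_functional_uniform_limit[OF c_cont ab _ _ \<tau>_lim e(1)]) (auto simp: less_imp_le)
            then obtain d1 k where d1: "d1 > 0" "\<And>n w. \<forall>p. k \<le> n $ p \<Longrightarrow> \<forall>z\<in>cbox 0 1. \<bar>w z - c \<omega> z\<bar> < d1 \<Longrightarrow>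
                \<forall>x\<in>cbox a b. \<bar>monitor_functional w n (\<lambda>p. \<tau> p (n $ p)) x - limit_functional (c \<omega>) \<tau>bar x\<bar> < e"
              by blast
            obtain d where d: "d > 0" "\<And>w x. w \<in> skorohod_ball 0 1 (Z0 \<omega>) d \<Longrightarrow> x \<in> cbox 0 1 \<Longrightarrow> \<bar>w x - Z0 \<omega> x\<bar> < d1"
              using skorohod_ball_uniform_at_continuous[OF Z0_cont d1(1)] by blast
            have "\<bar>\<phi> n w - h (Y' \<omega>)\<bar> < \<epsilon>'" if "k \<le> sz n" "w \<in> skorohod_ball 0 1 (Z0 \<omega>) d" for n w
              unfolding \<phi>_def
            proof (rule e(2)[OF monitor_functional_in_skorohod_space[OF ab(2)]])
              have "\<forall>z\<in>cbox 0 1. \<bar>w z - c \<omega> z\<bar> < d1"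
                using d(2)[OF that(2)] Z0c by simp
              from d1(2)[OF that(1)[unfolded sz] this]
              show "\<forall>x\<in>cbox a b. \<bar>restrict (monitor_functional w n (\<lambda>p. \<tau> p (n $ p))) (cbox a b) x - Y' \<omega> x\<bar> < e"
                by (simp add: Y'_def)
            qed
            then show "\<exists>d>0. \<exists>k. \<forall>n. k \<le> sz n \<longrightarrow> (\<forall>w\<in>skorohod_ball 0 1 (Z0 \<omega>) d. \<bar>\<phi> n w - h (Y' \<omega>)\<bar> < \<epsilon>')"
              using d(1) by blast
          qed
        qed
      qed
    qed (use weak in blast)
  qed
qed

end
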